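(* Let $(\mathbb{E},\|\cdot\|_{\mathbb{E}})$ be a complex Banach space, let $m_e$ be a sequence of moments, and let $\tilde{\mathbb{M}}$ be a strongly regular sequence admitting a nonzero proximate order. Given $d\in\mathbb{R}$, the space $\mathbb{E}\{z\}_{\tilde{\mathbb{M}},d}$ of formal power series in $\mathbb{E}[[z]]$ that are $\tilde{\mathbb{M}}$-summable in direction $d$ is closed under $m_e$-differentiation: if $\hat f\in\mathbb{E}\{z\}_{\tilde{\mathbb{M}},d}$, then $\partial_{m_e,z}\hat f\in\mathbb{E}\{z\}_{\tilde{\mathbb{M}},d}$.
   Context: Sectors. $S_d(\theta)=\{z\in\mathcal{R}:|\arg(z)-d|<\theta/2\}$, where $\mathcal{R}$ is the Riemann surface of the logarithm; $\hat S_d(\theta;r)=S_d(\theta)\cup D(0,r)$. Strongly regular sequences. A sequence $\mathbb{M}=(M_p)_{p\ge0}$ of positive reals with $M_0=1$ is strongly regular if: (lc) $M_p^2\le M_{p-1}M_{p+1}$ for $p\ge1$; (mg) there is $A_1>0$ with $M_{p+q}\le A_1^{p+q}M_pM_q$ for all $p,q\ge0$; (snq) there is $A_2>0$ with $\sum_{q\ge p}\frac{M_q}{(q+1)M_{q+1}}\le A_2\frac{M_p}{M_{p+1}}$ for all $p\ge0$. Its associated function is $M(t)=\sup_{p\ge0}\log(t^p/M_p)$ for $t>0$, $M(0)=0$. Put $\rho(M)=\limsup_{t\to\infty}\max\{0,\log M(t)/\log t\}\in(0,\infty)$ and $\omega(\mathbb{M})=1/\rho(M)$. $\mathbb{M}$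 admits a nonzero proximate order if there are a nonnegative, continuous, piecewise continuously differentiable function $\varrho(t)$ on some $(c,\infty)$ with $\lim_{t\to\infty}\varrho(t)\in(0,\infty)$ and $\lim_{t\to\infty}t\varrho'(t)\log t=0$, and constants $A,B\in\mathbb{R}$ with $A\le\log(t)\left(\varrho(t)-\frac{\log M(t)}{\log t}\right)\le B$ for $t$ large. Kernel functions and moments. Let $\mathbb{M}$ be strongly regular with $\omega(\mathbb{M})<2$. Functions $e,E$ are kernel functions for $\mathbb{M}$-summability if: (1) $e$ is holomorphic on $S_0(\omega(\mathbb{M})\pi)$; there is $t_0>0$ such that every $z_0\in S_0(\omega(\mathbb{M})\pi)$ has a neighborhood $U\subseteq S_0(\omega(\mathbb{M})\pi)$ with $\int_0^{t_0}\sup_{z\in U}|e(t/z)|\frac{dt}{t}<\infty$; for every $\epsilon>0$ there are $c,k>0$ with $|e(z)|\le c\exp(-M(|z|/k))$ on $S_0(\omega(\mathbb{M})\pi-\epsilon)$; $e(x)\in\mathbb{R}$ for $x>0$. (2) $E$ is entire, $|E(z)|\le\tilde c\exp(M(|z|/\tilde k))$ on $\mathbb{C}$ for some $\tilde c,\tilde k>0$; and there is $\beta>0$ such that for all $0<\tilde\theta<2\pi-\omega(\mathbb{M})\pi$ and $M_E>0$ there is $\tilde c_2>0$ with $|E(z)|\le\tilde c_2|z|^{-\beta}$ on $S_\pi(\tilde\theta)\setminus D(0,M_E)$. (3) $m_e(z)=\int_0^\infty t^{z-1}e(t)\,dt$ is continuous on $\{\mathrm{Re}(z)\ge0\}$,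 holomorphic on $\{\mathrm{Re}(z)>0\}$, and $E(z)=\sum_{p\ge0}z^p/m_e(p)$. A sequence of moments is a sequence $m_e=(m_e(p))_{p\ge0}$ arising from such a pair of kernels for some strongly regular $\mathbb{M}$; it is a known fact that it is strongly regular and equivalent to $\mathbb{M}$ (i.e. $B_1^pM_p\le m_e(p)\le B_2^pM_p$ for some $B_1,B_2>0$). Moment differentiation. $\partial_{m_e,z}:\mathbb{E}[[z]]\to\mathbb{E}[[z]]$ is the linear operator $\partial_{m_e,z}\left(\sum_{p\ge0}\frac{u_p}{m_e(p)}z^p\right)=\sum_{p\ge0}\frac{u_{p+1}}{m_e(p)}z^p$. Summability. Let $\mathbb{M}$ be strongly regular admitting a nonzero proximate order. $\hat u=\sum_pu_pz^p\in\mathbb{E}[[z]]$ is $\mathbb{M}$-summable in direction $d$ if $\sum_p\frac{u_p}{M_p}z^p$ converges near $0$ and extends to a holomorphic function on some $\hat S_d(\theta;r)$, $\theta,r>0$, such that for all $0<\theta'<\theta$, $0<r'<r$ there are $\tilde c,\tilde k>0$ with norm bounded by $\tilde c\exp(M(|z|/\tilde k))$ for $z\in\hat S_d(\theta';r')$. $\mathbb{E}\{z\}_{\mathbb{M},d}$ denotes the set of such series (replacing $\mathbb{M}$ by the sequence of moments of any kernel for $\mathbb{M}$-summability gives the same set).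
   Formalization: Summability divides the coefficients by the moments of some kernel for M-summability (ramified kernels if ω(M) ≥ 2) instead of by M_p itself; dividing by M_p for an arbitrary strongly regular M makes the claim false. *)

theory Defs
  imports "HOL-Complex_Analysis.Complex_Analysis"
begin

section \<open>Complex Banach spaces and vector-valued holomorphic functions\<close>

class complex_banach = banach +
  fixes scaleC :: "complex \<Rightarrow> 'a \<Rightarrow> 'a" (infixr "*\<^sub>C" 75)
  assumes scaleC_add_right: "c *\<^sub>C (x + y) = c *\<^sub>C x + c *\<^sub>C y"
    and scaleC_add_left: "(b + c) *\<^sub>C x = b *\<^sub>C x + c *\<^sub>C x"
    and scaleC_scaleC: "b *\<^sub>C (c *\<^sub>C x) = (b * c) *\<^sub>C x"
    and scaleR_eq_scaleC: "r *\<^sub>R x = complex_of_real r *\<^sub>C x"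
    and norm_scaleC: "norm (c *\<^sub>C x) = cmod c * norm x"

instantiation complex :: complex_banach
begin

definition scaleC_complex :: "complex \<Rightarrow> complex \<Rightarrow> complex"
  where "scaleC_complex c x = c * x"

instance
  by standard (auto simp: scaleC_complex_def algebra_simps norm_mult scaleR_conv_of_real)

end

definition vec_holomorphic_on :: "(complex \<Rightarrow> 'a::complex_banach) \<Rightarrow> complex set \<Rightarrow> bool"
    (infixl "(vec'_holomorphic'_on)" 50)
  where "f vec_holomorphic_on S \<longleftrightarrow>
    (\<forall>z\<in>S. \<exists>D. (f has_derivative (\<lambda>h. h *\<^sub>C D)) (at z within S))"


section \<open>Sectors\<close>

text \<open>The Riemann surface of the logarithm is modelled by its global coordinate
  \<open>w = log z\<close>, which ranges over the whole complex plane: the point with modulus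
  \<open>r > 0\<close> and argument \<open>a\<close> (a real number, not reduced modulo \<open>2 * pi\<close>) is
  \<open>w = ln r + i * a\<close>.  The projection to the punctured plane is \<open>exp\<close>.\<close>

definition log_sector :: "real \<Rightarrow> real \<Rightarrow> complex set"
  where "log_sector d \<theta> = {w. \<bar>Im w - d\<bar> < \<theta> / 2}"

text \<open>The projected sector; for \<open>\<theta> \<le> 2 * pi\<close> the projection is injective on \<open>log_sector d \<theta>\<close>,
  and it is only used for such openings.\<close>

definition sector :: "real \<Rightarrow> real \<Rightarrow> complex set"
  where "sector d \<theta> = exp ` log_sector d \<theta>"


section \<open>Strongly regular sequences\<close>

definition strongly_regular :: "(nat \<Rightarrow> real) \<Rightarrow> bool"
  where "strongly_regular M \<longleftrightarrow>
    (\<forall>p. M p > 0) \<and> M 0 = 1 \<and>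
    (\<forall>p\<ge>1. (M p)\<^sup>2 \<le> M (p - 1) * M (p + 1)) \<and>
    (\<exists>A>0. \<forall>p q. M (p + q) \<le> A ^ (p + q) * M p * M q) \<and>
    (\<exists>A>0. \<forall>p.
        summable (\<lambda>j. M (p + j) / (real (p + j + 1) * M (p + j + 1))) \<and>
        (\<Sum>j. M (p + j) / (real (p + j + 1) * M (p + j + 1))) \<le> A * (M p / M (p + 1)))"

definition assoc_fun :: "(nat \<Rightarrow> real) \<Rightarrow> real \<Rightarrow> real"
  where "assoc_fun M t = (if t > 0 then (SUP p. ln (t ^ p / M p)) else 0)"

definition growth_order :: "(nat \<Rightarrow> real) \<Rightarrow> real"
  where "growth_order M =
    real_of_ereal (Limsup at_top (\<lambda>t. ereal (max 0 (ln (assoc_fun M t) / ln t))))"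

definition growth_index :: "(nat \<Rightarrow> real) \<Rightarrow> real"
  where "growth_index M = 1 / growth_order M"

text \<open>The break points of \<open>\<rho>\<close> may accumulate at infinity (and at \<open>c\<close>); the derivative is only
  considered at the points where it exists.\<close>

definition admits_nonzero_proximate_order :: "(nat \<Rightarrow> real) \<Rightarrow> bool"
  where "admits_nonzero_proximate_order M \<longleftrightarrow>
    (\<exists>c \<rho>. (\<forall>t>c. \<rho> t \<ge> (0::real)) \<and> continuous_on {c<..} \<rho> \<and>
       (\<forall>a b. c < a \<and> a < b \<longrightarrow> \<rho> piecewise_C1_differentiable_on {a..b}) \<and>
       (\<exists>L>0. (\<rho> \<longlongrightarrow> L) at_top) \<and>
       ((\<lambda>t. t * deriv \<rho> t * ln t) \<longlongrightarrow> 0)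
         (inf at_top (principal {t. \<rho> differentiable (at t)})) \<and>
       (\<exists>A B. \<forall>\<^sub>F t in at_top.
          A \<le> ln t * (\<rho> t - ln (assoc_fun M t) / ln t) \<and>
          ln t * (\<rho> t - ln (assoc_fun M t) / ln t) \<le> B))"


section \<open>Kernel functions and moments\<close>

definition moment_fun :: "(complex \<Rightarrow> complex) \<Rightarrow> complex \<Rightarrow> complex"
  where "moment_fun e z =
    (LINT t:{0<..}|lborel. complex_of_real t powr (z - 1) * e (complex_of_real t))"

definition kernel_functions ::
    "(nat \<Rightarrow> real) \<Rightarrow> (complex \<Rightarrow> complex) \<Rightarrow> (complex \<Rightarrow> complex) \<Rightarrow> bool"
  where "kernel_functions M e E \<longleftrightarrow>
    (let \<omega> = growth_index M; S = sector 0 (\<omega> * pi) in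
      e holomorphic_on S \<and>
      (\<exists>t\<^sub>0>0. \<forall>z\<^sub>0\<in>S. \<exists>U. open U \<and> z\<^sub>0 \<in> U \<and> U \<subseteq> S \<and>
         (\<integral>\<^sup>+t\<in>{0<..<t\<^sub>0}. (SUP z\<in>U. ennreal (cmod (e (complex_of_real t / z)))) / ennreal t
            \<partial>lborel) < \<infinity>) \<and>
      (\<forall>\<epsilon>>0. \<exists>c>0. \<exists>k>0. \<forall>z\<in>sector 0 (\<omega> * pi - \<epsilon>).
         cmod (e z) \<le> c * exp (- assoc_fun M (cmod z / k))) \<and>
      (\<forall>x>0. e (complex_of_real x) \<in> \<real>) \<and>
      E holomorphic_on UNIV \<and>
      (\<exists>c>0. \<exists>k>0. \<forall>z. cmod (E z) \<le> c * exp (assoc_fun M (cmod z / k))) \<and>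
      (\<exists>\<beta>>0. \<forall>\<theta> R. 0 < \<theta> \<and> \<theta> < 2 * pi - \<omega> * pi \<and> 0 < R \<longrightarrow>
         (\<exists>c>0. \<forall>z\<in>sector pi \<theta> - ball 0 R. cmod (E z) \<le> c * cmod z powr (- \<beta>))) \<and>
      continuous_on {z. Re z \<ge> 0} (moment_fun e) \<and>
      moment_fun e holomorphic_on {z. Re z > 0} \<and>
      (\<forall>p. moment_fun e (of_nat p) \<noteq> 0) \<and>
      (\<forall>z. (\<lambda>p. z ^ p / moment_fun e (of_nat p)) sums E z))"

definition kernel_moments :: "(nat \<Rightarrow> real) \<Rightarrow> (nat \<Rightarrow> real) \<Rightarrow> bool"
  where "kernel_moments M m \<longleftrightarrow>
    strongly_regular M \<and> growth_index M < 2 \<and>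
    (\<exists>e E. kernel_functions M e E \<and>
       (\<forall>p. complex_of_real (m p) = moment_fun e (of_nat p)))"

definition moment_sequence :: "(nat \<Rightarrow> real) \<Rightarrow> bool"
  where "moment_sequence m \<longleftrightarrow> (\<exists>M. kernel_moments M m)"

text \<open>Moments of kernels for \<open>M\<close>-summability when \<open>growth_index M\<close> is arbitrary.  For
  \<open>growth_index M \<ge> 2\<close> one takes, as usual, ramified kernels \<open>e z = e' (z powr (1 / q)) / q\<close>
  with \<open>e'\<close> a kernel for the sequence \<open>M powr (1 / q)\<close>, whose index is \<open>growth_index M / q < 2\<close>.
  The substitution \<open>t = s ^ q\<close> turns the \<open>p\<close>-th moment of \<open>e\<close> into the \<open>q * p\<close>-th one
  of \<open>e'\<close>.\<close>

definition summation_moments :: "(nat \<Rightarrow> real) \<Rightarrow> (nat \<Rightarrow> real) \<Rightarrow> bool"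
  where "summation_moments M m \<longleftrightarrow>
    (if growth_index M < 2 then kernel_moments M m
     else (\<exists>q n. q > 0 \<and> kernel_moments (\<lambda>p. root q (M p)) n \<and> (\<forall>p. m p = n (q * p))))"


section \<open>Moment differentiation and summability\<close>

text \<open>With \<open>f = (\<Sum>p. u p / m p * z ^ p)\<close>, i.e. \<open>u p = m p * f $ p\<close>, the \<open>p\<close>-th coefficient
  of the derivative is \<open>u (p + 1) / m p\<close>.\<close>

definition moment_diff :: "(nat \<Rightarrow> real) \<Rightarrow> 'a::complex_banach fps \<Rightarrow> 'a fps"
  where "moment_diff m f =
    Abs_fps (\<lambda>p. (m (p + 1) *\<^sub>R fps_nth f (p + 1)) /\<^sub>R m p)"

text \<open>The Borel transform of \<open>f\<close> with respect to \<open>m\<close> extends to the union of the disc of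
  radius \<open>r\<close> and the sector \<open>log_sector d \<theta>\<close>, with growth controlled by \<open>M\<close>.
  A holomorphic function on this union is a pair consisting of \<open>F\<close> on the disc and \<open>G\<close>
  on the sector (the latter in the coordinate \<open>w = log z\<close>) that agree for \<open>0 < \<bar>z\<bar> < r\<close>.\<close>

definition borel_extendable ::
    "(nat \<Rightarrow> real) \<Rightarrow> (nat \<Rightarrow> real) \<Rightarrow> real \<Rightarrow> 'a::complex_banach fps \<Rightarrow> bool"
  where "borel_extendable M m d f \<longleftrightarrow>
    (\<exists>\<theta>>0. \<exists>r>0. \<exists>F G.
       F vec_holomorphic_on ball 0 r \<and>
       G vec_holomorphic_on log_sector d \<theta> \<and>
       (\<forall>w\<in>log_sector d \<theta>. exp w \<in> ball 0 r \<longrightarrow> G w = F (exp w)) \<and>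
       (\<exists>\<delta>>0. \<forall>z\<in>ball 0 \<delta>. (\<lambda>p. z ^ p *\<^sub>C (fps_nth f p /\<^sub>R m p)) sums F z) \<and>
       (\<forall>\<theta>' r'. 0 < \<theta>' \<and> \<theta>' < \<theta> \<and> 0 < r' \<and> r' < r \<longrightarrow>
          (\<exists>c>0. \<exists>k>0.
             (\<forall>z\<in>ball 0 r'. norm (F z) \<le> c * exp (assoc_fun M (cmod z / k))) \<and>
             (\<forall>w\<in>log_sector d \<theta>'. norm (G w) \<le> c * exp (assoc_fun M (cmod (exp w) / k))))))"

text \<open>The Borel transform is taken with respect to the moments of a kernel for
  \<open>M\<close>-summability (the choice of the kernel does not matter).  One cannot divide by an
  arbitrary strongly regular \<open>M p\<close> here: replacing a sequence by an equivalent one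
  need not preserve analytic continuability of the transform.\<close>

definition summable_series :: "(nat \<Rightarrow> real) \<Rightarrow> real \<Rightarrow> 'a::complex_banach fps set"
  where "summable_series M d = {f. \<exists>m. summation_moments M m \<and> borel_extendable M m d f}"

end

theory Submission
  imports Defs
begin

text \<open>Dividing by the moments turns moment differentiation into a multiplier: the Borel transform
  \<open>\<Sum>p. a p * z ^ p\<close> of the series is mapped to \<open>\<Sum>p. l p * a (p + 1) * z ^ p\<close>, where \<open>l\<close> is a product of
  quotients \<open>n (p + 1) / n p\<close> of kernel moments.  A quotient of this kind acts as a Hadamard product with
  \<open>K z = (\<Sum>p. n (p + 1) / n p * z ^ p) = (\<integral>\<xi>. E (z * \<xi>) * e \<xi>)\<close>.  Rotating the ray of integration inside
  the sector of decay of \<open>e\<close> continues \<open>K\<close> to the plane without the positive half-line, with a bound on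
  every closed subsector.  Hence the convolution integral of the transform against \<open>K (z / w) / w\<close> can be taken over a
  contour that follows a small circle, leaves it inside the sector, and closes beyond \<open>z\<close>; moving the
  outer edge to infinity with \<open>z\<close> (Cauchy's theorem) continues the product to the sector, and the growth is
  that of the transform up to a change of constants.  Ramified moments are treated by substituting \<open>z ^ q\<close>.\<close>

section \<open>Vector-valued holomorphic functions\<close>

text \<open>The series of \<open>K\<close> is only known to converge near 0, and nothing ties
  \<open>m\<^sub>e\<close> to \<open>M\<close>, so coefficient estimates alone give no continuation.
  What has to be shown is that \<open>K\<close> is singular at most along the positive half-line,
  with bounds that carry no growth of the sequence behind \<open>m\<^sub>e\<close>. This comes from
  the two halves of a kernel pair: \<open>1 / n p\<close> is a coefficient of \<open>E\<close>, and
  \<open>n (p + 1)\<close> is the integral of \<xi>^p \<open>e\<close> \<xi>. \<open>E\<close> is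
  bounded on closed subsectors around the direction pi of half-opening below pi - \<omega> pi / 2,
  and \<open>e\<close> decays within \<omega> pi / 2. The two half-openings add up to pi, so every
  argument strictly between 0 and 2 pi is served by some ray. Two quotients occur because
  coefficient p + 1, divided by \<open>m (p + 1)\<close> in the transform, is divided by
  \<open>m p\<close> after differentiation; the second quotient is m (p + 1) / m p. Everything is
  done in the coordinate w = log z: multiplicative convolution turns into a kernel at v - w with
  measure dw, sectors become strips, and points of the Riemann surface over the same z stay
  apart.\<close>

lemma bounded_bilinear_scaleC: "bounded_bilinear (scaleC :: complex \<Rightarrow> 'a::complex_banach \<Rightarrow> 'a)"
proof
  fix r :: real and a b :: complex and x y :: 'a
  show "(a + b) *\<^sub>C x = a *\<^sub>C x + b *\<^sub>C x" by (rule scaleC_add_left)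
  show "a *\<^sub>C (x + y) = a *\<^sub>C x + a *\<^sub>C y" by (rule scaleC_add_right)
  show "(r *\<^sub>R a) *\<^sub>C x = r *\<^sub>R (a *\<^sub>C x)"
    by (simp add: scaleR_eq_scaleC scaleC_scaleC scaleC_complex_def)
  show "a *\<^sub>C (r *\<^sub>R x) = r *\<^sub>R (a *\<^sub>C x)"
    by (simp add: scaleR_eq_scaleC scaleC_scaleC mult.commute)
  show "\<exists>K. \<forall>a (x::'a). norm (a *\<^sub>C x) \<le> norm a * norm x * K"
    by (intro exI[of _ 1]) (simp add: norm_scaleC)
qed

interpretation scaleC: bounded_bilinear "scaleC :: complex \<Rightarrow> 'a::complex_banach \<Rightarrow> 'a"
  by (rule bounded_bilinear_scaleC)

lemma scaleC_one [simp]: "1 *\<^sub>C x = (x::'a::complex_banach)"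
  using scaleR_eq_scaleC[of 1 x] by simp

lemma vec_holomorphic_on_open:
  assumes "open S"
  shows "f vec_holomorphic_on S \<longleftrightarrow> (\<forall>z\<in>S. \<exists>D. (f has_derivative (\<lambda>h. h *\<^sub>C D)) (at z))"
  unfolding vec_holomorphic_on_def using at_within_open[OF _ assms] by auto

lemma vec_holomorphic_on_subset:
  "f vec_holomorphic_on S \<Longrightarrow> T \<subseteq> S \<Longrightarrow> f vec_holomorphic_on T"
  unfolding vec_holomorphic_on_def by (meson has_derivative_subset subsetD)

lemma vec_holomorphic_on_imp_continuous_on:
  "f vec_holomorphic_on S \<Longrightarrow> continuous_on S f"
  unfolding vec_holomorphic_on_def
  by (meson continuous_on_eq_continuous_within has_derivative_continuous)

lemma vec_holomorphic_on_complex: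
  fixes f :: "complex \<Rightarrow> complex"
  shows "f vec_holomorphic_on S \<longleftrightarrow> f holomorphic_on S"
proof -
  have *: "(\<lambda>h. h *\<^sub>C D) = (*) D" for D :: complex
    by (auto simp: scaleC_complex_def mult.commute)
  show ?thesis
    by (simp add: vec_holomorphic_on_def holomorphic_on_def * field_differentiable_def
        has_field_derivative_def)
qed

lemma vec_holomorphic_on_cong:
  assumes "f vec_holomorphic_on S" "\<And>z. z \<in> S \<Longrightarrow> f z = g z"
  shows "g vec_holomorphic_on S"
  using assms unfolding vec_holomorphic_on_def
  by (metis has_derivative_transform)

lemma has_field_derivative_scaleC:
  fixes g :: "complex \<Rightarrow> 'a::complex_banach"
  assumes "(k has_field_derivative k') (at z within S)"
    and "(g has_derivative (\<lambda>h. h *\<^sub>C D)) (at z within S)"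
  shows "((\<lambda>z. k z *\<^sub>C g z) has_derivative (\<lambda>h. h *\<^sub>C (k z *\<^sub>C D + k' *\<^sub>C g z))) (at z within S)"
proof -
  have "(k has_derivative (\<lambda>h. k' * h)) (at z within S)"
    using assms(1) by (simp add: has_field_derivative_def)
  from scaleC.FDERIV[OF this assms(2)] show ?thesis
    by (rule has_derivative_eq_rhs)
      (simp add: fun_eq_iff scaleC_scaleC scaleC_add_right mult.commute)
qed

lemma vec_holomorphic_on_scaleC:
  assumes "k holomorphic_on S" "g vec_holomorphic_on S"
  shows "(\<lambda>z. k z *\<^sub>C g z) vec_holomorphic_on S"
  unfolding vec_holomorphic_on_def
proof
  fix z assume "z \<in> S"
  then obtain k' D where "(k has_field_derivative k') (at z within S)"
      "(g has_derivative (\<lambda>h. h *\<^sub>C D)) (at z within S)"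
    using assms unfolding holomorphic_on_def field_differentiable_def vec_holomorphic_on_def by blast
  from has_field_derivative_scaleC[OF this]
  show "\<exists>D. ((\<lambda>z. k z *\<^sub>C g z) has_derivative (\<lambda>h. h *\<^sub>C D)) (at z within S)" by blast
qed

lemma vec_holomorphic_on_const: "(\<lambda>_. c) vec_holomorphic_on S"
  unfolding vec_holomorphic_on_def by (intro ballI exI[of _ 0]) (simp add: scaleC.zero_right)

lemma vec_holomorphic_on_add:
  assumes "f vec_holomorphic_on S" "g vec_holomorphic_on S"
  shows "(\<lambda>z. f z + g z) vec_holomorphic_on S"
  unfolding vec_holomorphic_on_def
proof
  fix z assume "z \<in> S"
  then obtain D D' where "(f has_derivative (\<lambda>h. h *\<^sub>C D)) (at z within S)"
      "(g has_derivative (\<lambda>h. h *\<^sub>C D')) (at z within S)"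
    using assms unfolding vec_holomorphic_on_def by blast
  from has_derivative_add[OF this]
  show "\<exists>D. ((\<lambda>z. f z + g z) has_derivative (\<lambda>h. h *\<^sub>C D)) (at z within S)"
    by (auto simp: scaleC_add_right[symmetric])
qed

lemma vec_holomorphic_on_cmult:
  "f vec_holomorphic_on S \<Longrightarrow> (\<lambda>z. c *\<^sub>C f z) vec_holomorphic_on S"
  by (rule vec_holomorphic_on_scaleC) auto

lemma vec_holomorphic_on_diff:
  assumes "f vec_holomorphic_on S" "g vec_holomorphic_on S"
  shows "(\<lambda>z. f z - g z) vec_holomorphic_on S"
  using vec_holomorphic_on_add[OF assms(1) vec_holomorphic_on_cmult[OF assms(2), of "-1"]]
  by (simp add: scaleC.minus_left)

lemma vec_holomorphic_on_compose:
  assumes "g vec_holomorphic_on T" "k holomorphic_on S" "k ` S \<subseteq> T"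
  shows "(\<lambda>z. g (k z)) vec_holomorphic_on S"
  unfolding vec_holomorphic_on_def
proof
  fix z assume "z \<in> S"
  then obtain k' D where k: "(k has_derivative (*) k') (at z within S)"
    and g: "(g has_derivative (\<lambda>h. h *\<^sub>C D)) (at (k z) within T)"
    using assms unfolding holomorphic_on_def field_differentiable_def has_field_derivative_def
      vec_holomorphic_on_def by blast
  have "((\<lambda>z. g (k z)) has_derivative (\<lambda>h. (k' * h) *\<^sub>C D)) (at z within S)"
    using has_derivative_in_compose[OF k has_derivative_subset[OF g assms(3)]] by simp
  then show "\<exists>D. ((\<lambda>z. g (k z)) has_derivative (\<lambda>h. h *\<^sub>C D)) (at z within S)"
    by (intro exI[of _ "k' *\<^sub>C D"]) (simp add: scaleC_scaleC mult.commute)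
qed

text \<open>Differentiation under the integral sign. In the log coordinate every piece of the
  contour, and every truncated kernel integral, has this shape. The Leibniz rule yields an integral
  of linear maps h \<mapsto> h D(t); moving the integral inside \<open>scaleC.prod_left\<close>
  shows that the derivative is again complex linear.\<close>

lemma vec_holomorphic_on_convolution:
  fixes \<phi> :: "real \<Rightarrow> 'a::complex_banach"
  assumes "open D" "k holomorphic_on D" "open U"
    and "continuous_on {a..b} \<phi>" "continuous_on {a..b} \<gamma>"
    and "\<And>v t. v \<in> U \<Longrightarrow> t \<in> {a..b} \<Longrightarrow> v - \<gamma> t \<in> D"
  shows "(\<lambda>v. integral {a..b} (\<lambda>t. k (v - \<gamma> t) *\<^sub>C \<phi> t)) vec_holomorphic_on U"
  unfolding vec_holomorphic_on_open[OF assms(3)]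
proof
  fix v assume "v \<in> U"
  then obtain r where r: "r > 0" "ball v r \<subseteq> U" using \<open>open U\<close> openE by blast
  define V where "V = ball v r"
  have V: "w - \<gamma> t \<in> D" if "w \<in> V" "t \<in> {a..b}" for w t
    using assms(6) r that by (auto simp: V_def)
  have ck: "continuous_on D k" "continuous_on D (deriv k)"
    using assms by (auto intro: holomorphic_on_imp_continuous_on holomorphic_deriv)
  have dk: "(k has_field_derivative deriv k z) (at z)" if "z \<in> D" for z
    using assms that by (metis holomorphic_derivI)
  let ?f = "\<lambda>v t. k (v - \<gamma> t) *\<^sub>C \<phi> t"
  let ?d = "\<lambda>v t. scaleC.prod_left (deriv k (v - \<gamma> t) *\<^sub>C \<phi> t)"
  have c1: "continuous_on (V \<times> {a..b}) (\<lambda>(v,t). deriv k (v - \<gamma> t) *\<^sub>C \<phi> t)"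
    unfolding case_prod_beta
  proof (intro scaleC.continuous_on)
    show "continuous_on (V \<times> {a..b}) (\<lambda>x. deriv k (fst x - \<gamma> (snd x)))"
      by (rule continuous_on_compose2[OF ck(2)])
        (use V in \<open>auto intro!: continuous_intros continuous_on_compose2[OF assms(5)]\<close>)
    show "continuous_on (V \<times> {a..b}) (\<lambda>x. \<phi> (snd x))"
      by (auto intro!: continuous_intros continuous_on_compose2[OF assms(4)])
  qed
  have L: "((\<lambda>v. integral (cbox a b) (?f v)) has_derivative integral (cbox a b) (?d v)) (at v within V)"
  proof (rule leibniz_rule)
    fix w t assume w: "w \<in> V" "t \<in> cbox a b"
    have "((\<lambda>v. k (v - \<gamma> t)) has_field_derivative deriv k (w - \<gamma> t) * 1) (at w within V)"
      by (rule DERIV_chain2[OF dk]) (use V[of w t] w in \<open>auto intro!: derivative_eq_intros\<close>)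
    from has_field_derivative_scaleC[OF this, of "\<lambda>_. \<phi> t" 0]
    show "((\<lambda>x. k (x - \<gamma> t) *\<^sub>C \<phi> t) has_derivative
        blinfun_apply (scaleC.prod_left (deriv k (w - \<gamma> t) *\<^sub>C \<phi> t))) (at w within V)"
      by (simp add: scaleC.zero_right)
  next
    fix w assume w: "w \<in> V"
    show "?f w integrable_on cbox a b"
      by (intro integrable_continuous scaleC.continuous_on continuous_on_compose2[OF ck(1)])
        (use V w assms in \<open>auto intro!: continuous_intros\<close>)
  next
    show "continuous_on (V \<times> cbox a b) (\<lambda>(v,t). ?d v t)"
      using bounded_linear.continuous_on[OF scaleC.bounded_linear_prod_left c1]
      by (simp add: case_prod_beta)
  qed (use r in \<open>auto simp: V_def\<close>)
  have i: "(\<lambda>t. deriv k (v - \<gamma> t) *\<^sub>C \<phi> t) integrable_on cbox a b"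
    using V[of v] r assms unfolding V_def
    by (intro integrable_continuous scaleC.continuous_on continuous_on_compose2[OF ck(2)])
        (auto intro!: continuous_intros)
  have "integral (cbox a b) (?d v) = scaleC.prod_left (integral (cbox a b) (\<lambda>t. deriv k (v - \<gamma> t) *\<^sub>C \<phi> t))"
    using integral_linear[OF i scaleC.bounded_linear_prod_left] by (simp add: o_def)
  with L have "((\<lambda>v. integral {a..b} (?f v)) has_derivative
      (\<lambda>h. h *\<^sub>C integral (cbox a b) (\<lambda>t. deriv k (v - \<gamma> t) *\<^sub>C \<phi> t))) (at v)"
    using at_within_open[of v V] r by (auto simp: V_def scaleC.prod_left.rep_eq)
  then show "\<exists>D. ((\<lambda>v. integral {a..b} (\<lambda>t. k (v - \<gamma> t) *\<^sub>C \<phi> t)) has_derivative (\<lambda>h. h *\<^sub>C D)) (at v)"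
    by blast
qed

section \<open>Cauchy's theorem for rectangles\<close>

text \<open>Opposite edges are paired, so that constants drop out of the integrands.\<close>

definition rect_int :: "(complex \<Rightarrow> 'a::complex_banach) \<Rightarrow> real \<Rightarrow> real \<Rightarrow> real \<Rightarrow> real \<Rightarrow> 'a" where
  "rect_int g a b c d = integral {a..b} (\<lambda>x. g (Complex x c) - g (Complex x d))
     + \<i> *\<^sub>C integral {c..d} (\<lambda>y. g (Complex b y) - g (Complex a y))"

definition rect :: "real \<Rightarrow> real \<Rightarrow> real \<Rightarrow> real \<Rightarrow> complex set" where
  "rect a b c d = {z. a \<le> Re z \<and> Re z \<le> b \<and> c \<le> Im z \<and> Im z \<le> d}"

lemma rect_eq_cbox: "rect a b c d = cbox (Complex a c) (Complex b d)"
  by (auto simp: rect_def in_cbox_complex_iff)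

lemma continuous_on_Complex [continuous_intros]:
  "continuous_on S f \<Longrightarrow> continuous_on S g \<Longrightarrow> continuous_on S (\<lambda>x. Complex (f x) (g x))"
  by (simp add: Complex_eq continuous_intros)

lemma rect_edge_continuous:
  assumes "continuous_on (rect a b c d) g"
  shows "c \<le> y \<Longrightarrow> y \<le> d \<Longrightarrow> a \<le> s \<Longrightarrow> t \<le> b \<Longrightarrow> continuous_on {s..t} (\<lambda>x. g (Complex x y))"
    and "a \<le> x \<Longrightarrow> x \<le> b \<Longrightarrow> c \<le> s \<Longrightarrow> t \<le> d \<Longrightarrow> continuous_on {s..t} (\<lambda>y. g (Complex x y))"
  by (rule continuous_on_compose2[OF assms]; auto simp: rect_def intro!: continuous_intros)+

lemma rect_int_split:
  assumes g: "continuous_on (rect a b c d) g" and "a \<le> x" "x \<le> b" "c \<le> y" "y \<le> d"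
  shows "rect_int g a b c d = rect_int g a x c y + rect_int g x b c y
      + rect_int g a x y d + rect_int g x b y d"
proof -
  note ii = integrable_continuous_interval
  note c1 = rect_edge_continuous(1)[OF g] and c2 = rect_edge_continuous(2)[OF g]
  have h: "integral {s..t} (\<lambda>x. g (Complex x u) - g (Complex x v)) =
      integral {s..t} (\<lambda>x. g (Complex x u)) - integral {s..t} (\<lambda>x. g (Complex x v))"
    if "a \<le> s" "t \<le> b" "c \<le> u" "u \<le> d" "c \<le> v" "v \<le> d" for s t u v
    using that by (intro integral_diff ii c1) auto
  have v: "integral {s..t} (\<lambda>y. g (Complex u y) - g (Complex v y)) =
      integral {s..t} (\<lambda>y. g (Complex u y)) - integral {s..t} (\<lambda>y. g (Complex v y))"
    if "c \<le> s" "t \<le> d" "a \<le> u" "u \<le> b" "a \<le> v" "v \<le> b" for s t u v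
    using that by (intro integral_diff ii c2) auto
  have hh: "integral {a..b} (\<lambda>x. g (Complex x u)) =
      integral {a..x} (\<lambda>x. g (Complex x u)) + integral {x..b} (\<lambda>x. g (Complex x u))"
    if "c \<le> u" "u \<le> d" for u
    using that assms by (subst Henstock_Kurzweil_Integration.integral_combine) (auto intro!: ii c1)
  have vv: "integral {c..d} (\<lambda>y. g (Complex u y)) =
      integral {c..y} (\<lambda>y. g (Complex u y)) + integral {y..d} (\<lambda>y. g (Complex u y))"
    if "a \<le> u" "u \<le> b" for u
    using that assms by (subst Henstock_Kurzweil_Integration.integral_combine) (auto intro!: ii c2)
  show ?thesis
    using assms(2-5) unfolding rect_int_def
    by (simp add: h v hh vv scaleC.add_right scaleC.diff_right)
qed

text \<open>An affine function has no boundary integral: \<open>u\<close> cancels between opposite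
  edges, and the linear part contributes (b - a)(c - d) \<i> D from the horizontal edges and the
  opposite amount from the vertical ones. Only the remainder is left, twice per pair of
  edges.\<close>

lemma rect_int_near_affine:
  fixes g :: "complex \<Rightarrow> 'a::complex_banach"
  assumes g: "continuous_on (rect a b c d) g" and ab: "a \<le> b" "c \<le> d"
    and e: "\<And>z. z \<in> rect a b c d \<Longrightarrow> norm (g z - u - (z - p) *\<^sub>C D) \<le> e"
  shows "norm (rect_int g a b c d) \<le> 2 * e * ((b - a) + (d - c))"
proof -
  define r where "r z = g z - u - (z - p) *\<^sub>C D" for z
  have cr: "continuous_on (rect a b c d) r"
    unfolding r_def by (intro continuous_intros g scaleC.continuous_on)
  have gr: "g z - g w = r z - r w + (z - w) *\<^sub>C D" for z w
    by (simp add: r_def scaleC.diff_left)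
  note ii = integrable_continuous_interval
  have i1: "integral {a..b} (\<lambda>x. g (Complex x c) - g (Complex x d)) =
     integral {a..b} (\<lambda>x. r (Complex x c) - r (Complex x d)) + ((b - a) * (c - d)) *\<^sub>R \<i> *\<^sub>C D"
  proof -
    have *: "Complex x c - Complex x d = (c - d) *\<^sub>R \<i>" for x
      by (simp add: complex_eq_iff)
    show ?thesis unfolding gr *
      using ab by (subst integral_add)
        (auto simp: scaleC.scaleR_left intro!: ii continuous_intros rect_edge_continuous[OF cr])
  qed
  have i2: "integral {c..d} (\<lambda>y. g (Complex b y) - g (Complex a y)) =
     integral {c..d} (\<lambda>y. r (Complex b y) - r (Complex a y)) + ((d - c) * (b - a)) *\<^sub>R D"
  proof -
    have *: "Complex b y - Complex a y = complex_of_real (b - a)" for y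
      by (simp add: complex_eq_iff)
    show ?thesis unfolding gr * scaleR_eq_scaleC[symmetric]
      using ab by (subst integral_add)
        (auto intro!: ii continuous_intros rect_edge_continuous[OF cr])
  qed
  have eq: "rect_int g a b c d = rect_int r a b c d"
    unfolding rect_int_def i1 i2
    by (simp add: scaleC.add_right scaleC.scaleR_right flip: scaleR_add_left)
      (simp add: algebra_simps)
  have "norm (integral {a..b} (\<lambda>x. r (Complex x c) - r (Complex x d))) \<le> (2 * e) * (b - a)"
  proof (rule integral_bound)
    fix t assume t: "t \<in> {a..b}"
    have "norm (r (Complex t c) - r (Complex t d)) \<le> norm (r (Complex t c)) + norm (r (Complex t d))"
      by (rule norm_triangle_ineq4)
    also have "\<dots> \<le> e + e"
      using e[of "Complex t c"] e[of "Complex t d"] t ab by (intro add_mono) (auto simp: r_def rect_def)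
    finally show "norm (r (Complex t c) - r (Complex t d)) \<le> 2 * e" by simp
  qed (use ab in \<open>auto intro!: continuous_intros rect_edge_continuous[OF cr]\<close>)
  moreover have "norm (integral {c..d} (\<lambda>y. r (Complex b y) - r (Complex a y))) \<le> (2 * e) * (d - c)"
  proof (rule integral_bound)
    fix t assume t: "t \<in> {c..d}"
    have "norm (r (Complex b t) - r (Complex a t)) \<le> norm (r (Complex b t)) + norm (r (Complex a t))"
      by (rule norm_triangle_ineq4)
    also have "\<dots> \<le> e + e"
      using e[of "Complex b t"] e[of "Complex a t"] t ab by (intro add_mono) (auto simp: r_def rect_def)
    finally show "norm (r (Complex b t) - r (Complex a t)) \<le> 2 * e" by simp
  qed (use ab in \<open>auto intro!: continuous_intros rect_edge_continuous[OF cr]\<close>)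
  ultimately show ?thesis
    unfolding eq unfolding rect_int_def
    by (intro order.trans[OF norm_triangle_ineq]) (simp add: norm_scaleC algebra_simps)
qed

text \<open>Goursat's bisection argument: pointwise differentiability within the closed rectangle is
  enough, and Banach space values enter only through the norm.\<close>

theorem Goursat_rectangle:
  fixes g :: "complex \<Rightarrow> 'a::complex_banach"
  assumes g: "g vec_holomorphic_on rect a b c d" and ab: "a \<le> b" "c \<le> d"
  shows "rect_int g a b c d = 0"
proof (rule ccontr)
  assume nz: "rect_int g a b c d \<noteq> 0"
  define I where "I = norm (rect_int g a b c d)"
  have I: "I > 0" using nz by (simp add: I_def)
  have cg: "continuous_on (rect a b c d) g" by (rule vec_holomorphic_on_imp_continuous_on[OF g])
  define X Y where "X = (\<lambda>n::nat. (b - a) / 2 ^ n)" and "Y = (\<lambda>n::nat. (d - c) / 2 ^ n)"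
  define R where "R = (\<lambda>n p. rect (fst p) (fst p + X n) (snd p) (snd p + Y n))"
  \<comment> \<open>A stage is recorded by the lower left corner of a rectangle that keeps at least
    the fraction 4^-n of the boundary integral.\<close>
  define P where "P = (\<lambda>n p. R n p \<subseteq> rect a b c d \<and>
     norm (rect_int g (fst p) (fst p + X n) (snd p) (snd p + Y n)) \<ge> I / 4 ^ n)"
  have XY: "X n \<ge> 0" "Y n \<ge> 0" for n using ab by (auto simp: X_def Y_def)
  have XYS: "X n = 2 * X (Suc n)" "Y n = 2 * Y (Suc n)" for n by (simp_all add: X_def Y_def diff_divide_distrib)
  have "\<exists>f. \<forall>n. P n (f n) \<and> R (Suc n) (f (Suc n)) \<subseteq> R n (f n)"
  proof (rule dependent_nat_choice)
    show "\<exists>p. P 0 p"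
      by (rule exI[of _ "(a,c)"]) (auto simp: P_def R_def X_def Y_def I_def)
  next
    fix p n assume p: "P n p"
    obtain x y where pxy: "p = (x, y)" by force
    let ?x = "x + X (Suc n)" and ?y = "y + Y (Suc n)"
    let ?J = "\<lambda>p. rect_int g (fst p) (fst p + X (Suc n)) (snd p) (snd p + Y (Suc n))"
    have c: "continuous_on (rect x (x + X n) y (y + Y n)) g"
      using p cg continuous_on_subset by (auto simp: P_def R_def pxy)
    have sum: "rect_int g x (x + X n) y (y + Y n) = ?J (x,y) + ?J (?x,y) + ?J (x,?y) + ?J (?x,?y)"
      using rect_int_split[OF c, of ?x ?y] XYS[of n] XY[of "Suc n"] by (simp add: ac_simps)
    have "\<exists>q\<in>{(x,y), (?x,y), (x,?y), (?x,?y)}. norm (?J q) \<ge> I / 4 ^ Suc n"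
    proof (rule ccontr)
      assume "\<not> ?thesis"
      then have "norm (?J (x,y)) < I / 4 ^ Suc n" "norm (?J (?x,y)) < I / 4 ^ Suc n"
         "norm (?J (x,?y)) < I / 4 ^ Suc n" "norm (?J (?x,?y)) < I / 4 ^ Suc n" by auto
      then have "norm (rect_int g x (x + X n) y (y + Y n)) < I / 4 ^ n"
        unfolding sum
        by (intro le_less_trans[OF norm_triangle_le[OF add_mono[OF norm_triangle_le[OF
             add_mono[OF norm_triangle_ineq order.refl]] order.refl]]])
          (simp add: field_simps)
      with p show False by (simp add: P_def pxy)
    qed
    then obtain q where q: "q \<in> {(x,y), (?x,y), (x,?y), (?x,?y)}" "norm (?J q) \<ge> I / 4 ^ Suc n"
      by blast
    have "R (Suc n) q \<subseteq> R n p"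
      using q(1) XY[of "Suc n"] XYS[of n] by (auto simp: R_def rect_def pxy)
    then show "\<exists>q. P (Suc n) q \<and> R (Suc n) q \<subseteq> R n p"
      using q p by (intro exI[of _ q]) (auto simp: P_def)
  qed
  then obtain f where f: "\<And>n. P n (f n)" "\<And>n. R (Suc n) (f (Suc n)) \<subseteq> R n (f n)" by blast
  have "\<Inter>(range (\<lambda>n. R n (f n))) \<noteq> {}"
  proof (rule compact_nest)
    show "compact (R n (f n))" for n by (simp add: R_def rect_eq_cbox)
    show "R n (f n) \<noteq> {}" for n
      using XY[of n] by (auto simp: R_def rect_def intro!: exI[of _ "Complex (fst (f n)) (snd (f n))"])
    show "R n (f n) \<subseteq> R m (f m)" if "m \<le> n" for m n
      by (rule lift_Suc_antimono_le[of "\<lambda>n. R n (f n)", OF f(2) that])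
  qed
  then obtain z where z: "\<And>n. z \<in> R n (f n)" by blast
  have zr: "z \<in> rect a b c d" using z[of 0] f(1)[of 0] by (auto simp: P_def)
  with g obtain D where D: "(g has_derivative (\<lambda>h. h *\<^sub>C D)) (at z within rect a b c d)"
    unfolding vec_holomorphic_on_def by blast
  define K where "K = (b - a) + (d - c)"
  have "K \<noteq> 0"
  proof
    assume "K = 0"
    then have "a = b" "c = d" using ab by (auto simp: K_def)
    then show False using nz by (simp add: rect_int_def scaleC.zero_right)
  qed
  then have K: "K > 0" using ab by (simp add: K_def)
  \<comment> \<open>With this choice the final estimate 2 e K^2 / 4^n is half of I / 4^n.\<close>
  define e where "e = I / (4 * K\<^sup>2)"
  have e: "e > 0" using I K by (simp add: e_def)
  obtain \<delta> where \<delta>: "\<delta> > 0" "\<And>w. w \<in> rect a b c d \<Longrightarrow> norm (w - z) < \<delta> \<Longrightarrow>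
      norm (g w - g z - (w - z) *\<^sub>C D) \<le> e * norm (w - z)"
    using D e unfolding has_derivative_within_alt by blast
  have "(\<lambda>n. K / 2 ^ n) \<longlonglongrightarrow> 0"
    using LIMSEQ_divide_realpow_zero[of 2 K] by simp
  then have "eventually (\<lambda>n. K / 2 ^ n < \<delta>) sequentially"
    by (rule order_tendstoD) (rule \<delta>)
  then obtain n where n: "K / 2 ^ n < \<delta>" by (auto simp: eventually_sequentially)
  obtain x y where fn: "f n = (x, y)" by force
  have sub: "rect x (x + X n) y (y + Y n) \<subseteq> rect a b c d"
    using f(1)[of n] by (simp add: P_def R_def fn)
  have "norm (rect_int g x (x + X n) y (y + Y n)) \<le> 2 * (e * (K / 2 ^ n)) * ((x + X n - x) + (y + Y n - y))"
  proof (rule rect_int_near_affine)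
    fix w assume w: "w \<in> rect x (x + X n) y (y + Y n)"
    have "z \<in> rect x (x + X n) y (y + Y n)" using z[of n] by (simp add: R_def fn)
    then have "\<bar>Re (w - z)\<bar> \<le> X n" "\<bar>Im (w - z)\<bar> \<le> Y n" using w by (auto simp: rect_def)
    then have *: "norm (w - z) \<le> K / 2 ^ n"
      using cmod_le[of "w - z"] by (simp add: K_def X_def Y_def add_divide_distrib)
    then show "norm (g w - g z - (w - z) *\<^sub>C D) \<le> e * (K / 2 ^ n)"
      using \<delta>(2)[of w] n w sub e by (meson less_imp_le order.trans mult_left_mono le_less_trans subsetD)
  qed (use XY cg sub continuous_on_subset in auto)
  also have "\<dots> = (2 * e * K\<^sup>2) / 4 ^ n"
  proof -
    have "x + X n - x + (y + Y n - y) = K / 2 ^ n"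
      by (simp add: K_def X_def Y_def add_divide_distrib)
    moreover have "(4::real) ^ n = 2 ^ n * 2 ^ n" by (simp flip: power_mult_distrib)
    ultimately show ?thesis by (simp add: power2_eq_square)
  qed
  also have "\<dots> < I / 4 ^ n" using I K by (simp add: e_def field_simps)
  finally show False using f(1)[of n] by (simp add: P_def fn)
qed

section \<open>Strongly regular sequences\<close>

lemma
  assumes "strongly_regular M"
  shows strongly_regular_pos: "M p > 0"
    and strongly_regular_0: "M 0 = 1"
  using assms by (auto simp: strongly_regular_def)

lemma strongly_regular_mg:
  assumes "strongly_regular M"
  obtains A where "A > 0" "\<And>p q. M (p + q) \<le> A ^ (p + q) * M p * M q"
  using assms by (auto simp: strongly_regular_def)

lemma strongly_regular_quotient_mono:
  assumes "strongly_regular M" "p \<le> q"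
  shows "M (Suc p) / M p \<le> M (Suc q) / M q"
proof -
  have "M (Suc n) / M n \<le> M (Suc (Suc n)) / M (Suc n)" for n
  proof -
    have "(M (Suc n))\<^sup>2 \<le> M (Suc n - 1) * M (Suc n + 1)"
      using assms(1) unfolding strongly_regular_def by (metis le_add1 plus_1_eq_Suc)
    then show ?thesis
      using strongly_regular_pos[OF assms(1)] by (simp add: field_simps power2_eq_square)
  qed
  then show ?thesis by (rule lift_Suc_mono_le[of "\<lambda>n. M (Suc n) / M n"]) (rule assms(2))
qed

lemma strongly_regular_quotient_pos:
  "strongly_regular M \<Longrightarrow> M (Suc p) / M p > 0"
  by (simp add: strongly_regular_pos)

text \<open>A dyadic block \<open>[2\<^sup>i p, 2\<^sup>i\<^sup>+\<^sup>1 p)\<close> contributes at least \<open>1/2\<close> to the harmonic sum.\<close>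

lemma dyadic_harmonic_sum_ge:
  fixes m :: "nat \<Rightarrow> real"
  assumes "p \<ge> 1" "\<And>q. 0 < m q" "\<And>q. q < 2 ^ s * p \<Longrightarrow> m q \<le> B"
  shows "(\<Sum>q\<in>{p..<2 ^ s * p}. 1 / (real (q + 1) * m q)) \<ge> real s / (2 * B)"
  using assms(3)
proof (induction s)
  case (Suc s)
  let ?P = "2 ^ s * p"
  have B: "B > 0" using Suc.prems[of 0] assms(1) assms(2)[of 0] by (simp add: less_le_trans)
  have "(\<Sum>q\<in>{p..<2 ^ s * p}. 1 / (real (q + 1) * m q)) \<ge> real s / (2 * B)"
    by (rule Suc.IH, rule Suc.prems) (use assms(1) in \<open>auto intro: less_le_trans\<close>)
  moreover have "(\<Sum>q\<in>{?P..<2 * ?P}. 1 / (real (q + 1) * m q)) \<ge> 1 / (2 * B)"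
  proof -
    have "(\<Sum>q\<in>{?P..<2 * ?P}. 1 / (real (2 * ?P) * B)) \<le> (\<Sum>q\<in>{?P..<2 * ?P}. 1 / (real (q + 1) * m q))"
    proof (rule sum_mono, rule divide_left_mono)
      fix q assume q: "q \<in> {?P..<2 * ?P}"
      show "real (q + 1) * m q \<le> real (2 * ?P) * B"
        using q assms(2)[of q] Suc.prems[of q] by (intro mult_mono, intro of_nat_mono) auto
      show "0 < real (2 * ?P) * B * (real (q + 1) * m q)"
        using B assms(1,2) by simp
    qed simp
    moreover have "(\<Sum>q\<in>{?P..<2 * ?P}. 1 / (real (2 * ?P) * B)) = 1 / (2 * B)"
      using assms(1) by (simp add: field_simps)
    ultimately show ?thesis by simp
  qed
  moreover have "(\<Sum>q\<in>{p..<2 ^ Suc s * p}. 1 / (real (q + 1) * m q)) =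
     (\<Sum>q\<in>{p..<?P}. 1 / (real (q + 1) * m q)) + (\<Sum>q\<in>{?P..<2 * ?P}. 1 / (real (q + 1) * m q))"
    using sum.atLeastLessThan_concat[of p ?P "2 * ?P" "\<lambda>q. 1 / (real (q + 1) * m q)"] assms(1)
    by (simp add: mult.assoc)
  ultimately show ?case by (simp add: add_divide_distrib)
qed simp

text \<open>By monotonicity the quotients below index 2^s p are at most the one at 2^s p, so each of
  \<open>s\<close> dyadic blocks adds a fixed amount to the (snq) sum started at p. That sum is at
  most A / m p, hence a large \<open>s\<close> forces the quotient to double from p to 2^s p.
  Iterated from 1, the quotients grow at least like a positive power of the index.\<close>

lemma strongly_regular_quotient_growth:
  assumes "strongly_regular M"
  obtains s where "s \<ge> 1" "\<And>k. M (Suc ((2 ^ s) ^ k)) / M ((2 ^ s) ^ k) \<ge> 2 ^ k * (M 2 / M 1)"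
proof -
  define m where "m p = M (Suc p) / M p" for p
  have pos: "m p > 0" for p unfolding m_def by (rule strongly_regular_quotient_pos[OF assms])
  have mono: "p \<le> q \<Longrightarrow> m p \<le> m q" for p q
    unfolding m_def by (rule strongly_regular_quotient_mono[OF assms])
  define f where "f = (\<lambda>p j. M (p + j) / (real (p + j + 1) * M (p + j + 1)))"
  obtain A where A: "A > 0" "\<And>p. summable (f p) \<and> (\<Sum>j. f p j) \<le> A * (M p / M (p + 1))"
    using assms unfolding strongly_regular_def f_def by blast
  have f: "f p j = 1 / (real (p + j + 1) * m (p + j))" for p j
    using strongly_regular_pos[OF assms] by (simp add: f_def m_def)
  have fnn: "f p j \<ge> 0" for p j by (simp add: f pos less_imp_le)
  have A2: "(\<Sum>j. f p j) \<le> A / m p" for p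
    using A(2)[of p] by (simp add: m_def)
  \<comment> \<open>The comparison below reads s m(p) \<le> 2 A m(2^s p); s \<ge> 4 A turns it into
    doubling.\<close>
  define s where "s = nat \<lceil>4 * A\<rceil>"
  have s: "real s \<ge> 4 * A" by (simp add: s_def of_nat_ceiling)
  then have s1: "s \<ge> 1" using A(1) by (cases s) auto
  have step: "m (2 ^ s * p) \<ge> 2 * m p" if p: "p \<ge> 1" for p
  proof -
    have "real s / (2 * m (2 ^ s * p)) \<le> (\<Sum>q\<in>{p..<2 ^ s * p}. 1 / (real (q + 1) * m q))"
      by (rule dyadic_harmonic_sum_ge[OF p pos]) (auto intro: mono)
    also have "\<dots> = (\<Sum>j<2 ^ s * p - p. f p j)"
      using sum.shift_bounds_nat_ivl[of "\<lambda>q. 1 / (real (q + 1) * m q)" 0 p "2 ^ s * p - p"] p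
      by (simp add: f atLeast0LessThan add.commute)
    also have "\<dots> \<le> (\<Sum>j. f p j)"
      using A(2)[of p] fnn by (intro sum_le_suminf) auto
    also have "\<dots> \<le> A / m p" by (rule A2)
    finally have "real s * m p \<le> 2 * A * m (2 ^ s * p)"
      using pos[of p] pos[of "2 ^ s * p"] by (simp add: field_simps)
    moreover have "4 * A * m p \<le> real s * m p" using s pos[of p] by (intro mult_right_mono) auto
    ultimately have "2 * A * (2 * m p) \<le> 2 * A * m (2 ^ s * p)" by simp
    then show ?thesis using A(1) by simp
  qed
  have "m ((2 ^ s) ^ k) \<ge> 2 ^ k * m 1" for k
  proof (induction k)
    case (Suc k)
    have "2 * m ((2 ^ s) ^ k) \<le> m (2 ^ s * (2 ^ s) ^ k)" by (rule step) simp
    with Suc.IH show ?case by (simp add: ac_simps)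
  qed simp
  then show ?thesis using that[OF s1] by (simp add: m_def numeral_2_eq_2)
qed

lemma strongly_regular_power_div_le:
  assumes "strongly_regular M" "t > 0" "\<And>p. p \<ge> P \<Longrightarrow> t \<le> M (Suc p) / M p" "p \<ge> P"
  shows "t ^ p / M p \<le> t ^ P / M P"
  using assms(4)
proof (induction p rule: dec_induct)
  case (step n)
  have "t ^ Suc n / M (Suc n) = t ^ n / M n * (t / (M (Suc n) / M n))"
    using strongly_regular_pos[OF assms(1)] by (simp add: field_simps less_imp_neq[symmetric])
  also have "t / (M (Suc n) / M n) \<le> 1"
    using assms(3)[of n] step strongly_regular_quotient_pos[OF assms(1), of n]
    by (subst divide_le_eq_1_pos) auto
  then have "t ^ n / M n * (t / (M (Suc n) / M n)) \<le> t ^ n / M n * 1"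
    using assms(2) strongly_regular_pos[OF assms(1), of n] by (intro mult_left_mono) auto
  finally show ?case using step.IH by simp
qed simp

lemma strongly_regular_quotient_large:
  assumes "strongly_regular M"
  obtains P where "\<And>p. p \<ge> P \<Longrightarrow> t \<le> M (Suc p) / M p"
proof -
  obtain s where s: "\<And>k. M (Suc ((2 ^ s) ^ k)) / M ((2 ^ s) ^ k) \<ge> 2 ^ k * (M 2 / M 1)"
    using strongly_regular_quotient_growth[OF assms] by blast
  obtain k where "t / (M 2 / M 1) < 2 ^ k" using real_arch_pow[of 2] by auto
  moreover have "M 2 / M 1 > 0" using strongly_regular_pos[OF assms] by simp
  ultimately have "t \<le> 2 ^ k * (M 2 / M 1)" by (subst (asm) pos_divide_less_eq) auto
  with s[of k] have "t \<le> M (Suc ((2 ^ s) ^ k)) / M ((2 ^ s) ^ k)" by (rule order.trans[rotated])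
  then show ?thesis
    using that[of "(2 ^ s) ^ k"] strongly_regular_quotient_mono[OF assms] order.trans by blast
qed

section \<open>The associated function: finiteness, extremal radii, absorption of a factor t\<close>

lemma assoc_fun_bdd_above:
  assumes "strongly_regular M" "t > 0"
  shows "bdd_above (range (\<lambda>p. ln (t ^ p / M p)))"
proof -
  obtain P where P: "\<And>p. p \<ge> P \<Longrightarrow> t \<le> M (Suc p) / M p"
    using strongly_regular_quotient_large[OF assms(1)] by blast
  define C where "C = (\<Sum>q\<le>P. t ^ q / M q)"
  have nn: "t ^ q / M q > 0" for q using assms strongly_regular_pos[OF assms(1)] by simp
  have C: "t ^ q / M q \<le> C" if "q \<le> P" for q
    unfolding C_def using nn that by (intro member_le_sum) (auto intro: less_imp_le)
  have "t ^ p / M p \<le> C" for p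
  proof (cases "p \<le> P")
    case False
    then have "t ^ p / M p \<le> t ^ P / M P"
      by (intro strongly_regular_power_div_le[OF assms P]) auto
    then show ?thesis using C[of P] by simp
  qed (rule C)
  then have "ln (t ^ p / M p) \<le> ln C" for p
    using nn[of p] by (meson ln_mono less_le_trans)
  then show ?thesis by (intro bdd_aboveI[of _ "ln C"]) auto
qed

lemma assoc_fun_ge:
  assumes "strongly_regular M" "t > 0"
  shows "ln (t ^ p / M p) \<le> assoc_fun M t"
  using assms(2) cSUP_upper[OF UNIV_I assoc_fun_bdd_above[OF assms]] by (simp add: assoc_fun_def)

lemma assoc_fun_le:
  assumes "t > 0" "\<And>p. ln (t ^ p / M p) \<le> B"
  shows "assoc_fun M t \<le> B"
  using assms by (simp add: assoc_fun_def cSUP_least)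

lemma assoc_fun_nonneg: "strongly_regular M \<Longrightarrow> assoc_fun M t \<ge> 0"
  using assoc_fun_ge[of M t 0] by (cases "t > 0") (auto simp: strongly_regular_0 assoc_fun_def)

lemma power_le_exp_assoc_fun:
  assumes "strongly_regular M" "t > 0"
  shows "t ^ p / M p \<le> exp (assoc_fun M t)"
  using assoc_fun_ge[OF assms, of p] strongly_regular_pos[OF assms(1), of p] assms(2)
  by (metis exp_le_cancel_iff exp_ln divide_pos_pos zero_less_power)

lemma power_exp_minus_assoc_fun_le:
  assumes "strongly_regular M" "t > 0"
  shows "t ^ p * exp (- assoc_fun M t) \<le> M p"
  using power_le_exp_assoc_fun[OF assms, of p] strongly_regular_pos[OF assms(1), of p]
  by (simp add: exp_minus field_simps)

lemma assoc_fun_mono: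
  assumes "strongly_regular M" "0 < s" "s \<le> t"
  shows "assoc_fun M s \<le> assoc_fun M t"
proof (rule assoc_fun_le)
  fix p
  have "ln (s ^ p / M p) \<le> ln (t ^ p / M p)"
    using assms strongly_regular_pos[OF assms(1), of p]
    by (intro ln_mono divide_right_mono power_mono) auto
  also have "\<dots> \<le> assoc_fun M t" using assms by (intro assoc_fun_ge) auto
  finally show "ln (s ^ p / M p) \<le> assoc_fun M t" .
qed (rule assms)

text \<open>By logarithmic convexity the supremum defining the associated function at
  the quotient \<open>M (Suc p) / M p\<close> is attained at \<open>p\<close>.\<close>

lemma exp_assoc_fun_le_power:
  assumes "strongly_regular M"
  obtains r where "r > 0" "exp (assoc_fun M r) \<le> r ^ p / M p"
proof
  define r where "r = M (Suc p) / M p"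
  note pos = strongly_regular_pos[OF assms]
  show r: "r > 0" using pos by (simp add: r_def)
  have q: "r ^ q / M q \<le> r ^ p / M p" for q
  proof (cases "p \<le> q")
    case True
    show ?thesis
      by (rule strongly_regular_power_div_le[OF assms r _ True])
        (simp add: r_def strongly_regular_quotient_mono[OF assms])
  next
    case False
    then have "q \<le> p" by simp
    then show ?thesis
    proof (induction q rule: inc_induct)
      case (step n)
      have n: "M (Suc n) / M n \<le> r"
        unfolding r_def using step by (intro strongly_regular_quotient_mono[OF assms]) auto
      have "r ^ n / M n = r ^ Suc n / M (Suc n) * ((M (Suc n) / M n) / r)"
        using r pos by (simp add: field_simps less_imp_neq[symmetric])
      also have "M (Suc n) / M n / r \<le> 1"
        using n r by (subst divide_le_eq_1_pos) auto
      then have "r ^ Suc n / M (Suc n) * (M (Suc n) / M n / r) \<le> r ^ Suc n / M (Suc n) * 1"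
        using r pos[of "Suc n"] by (intro mult_left_mono) auto
      finally show ?case using step.IH by simp
    qed simp
  qed
  have "assoc_fun M r \<le> ln (r ^ p / M p)"
    using r q pos by (intro assoc_fun_le ln_mono) auto
  then show "exp (assoc_fun M r) \<le> r ^ p / M p"
    using r pos[of p] by (subst ln_ge_iff[symmetric]) auto
qed

text \<open>(mg) with q = 1 trades a factor t for a dilation of the argument: t t^p / M_p \<le> M_1
  (A t)^(p+1) / M_(p+1). This pays for the length of the contour later on.\<close>

lemma assoc_fun_absorb:
  assumes "strongly_regular M"
  obtains B C where "B > 0" "C > 0" "\<And>t. t > 0 \<Longrightarrow> t * exp (assoc_fun M t) \<le> C * exp (assoc_fun M (B * t))"
proof -
  obtain A where A: "A > 0" "\<And>p q. M (p + q) \<le> A ^ (p + q) * M p * M q"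
    using strongly_regular_mg[OF assms] by blast
  note pos = strongly_regular_pos[OF assms]
  have "t * exp (assoc_fun M t) \<le> M 1 * exp (assoc_fun M (A * t))" if t: "t > 0" for t
  proof -
    have "assoc_fun M t \<le> ln (M 1 * exp (assoc_fun M (A * t)) / t)"
    proof (rule assoc_fun_le[OF t])
      fix p
      have "M (p + 1) * t ^ p \<le> (A ^ (p + 1) * M p * M 1) * t ^ p"
        using A(2)[of p 1] t by (intro mult_right_mono) auto
      then have "t ^ p / M p \<le> M 1 * ((A * t) ^ (p + 1) / M (p + 1)) / t"
        using t pos[of p] pos[of "p + 1"] by (simp add: field_simps power_mult_distrib)
      also have "\<dots> \<le> M 1 * exp (assoc_fun M (A * t)) / t"
        using t A(1) pos[of 1] by (intro divide_right_mono mult_left_mono power_le_exp_assoc_fun[OF assms]) auto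
      finally show "ln (t ^ p / M p) \<le> ln (M 1 * exp (assoc_fun M (A * t)) / t)"
        using t pos[of p] by (intro ln_mono) auto
    qed
    then have "exp (assoc_fun M t) \<le> M 1 * exp (assoc_fun M (A * t)) / t"
      using t pos[of 1] by (subst ln_ge_iff[symmetric]) auto
    then show ?thesis using t by (simp add: field_simps)
  qed
  then show ?thesis using that A(1) pos[of 1] by blast
qed

section \<open>Power bounds for the associated function and positivity of the index\<close>

lemma ex_pow2_bounds:
  fixes x :: real
  assumes "x \<ge> 1" "b \<ge> 1"
  obtains k :: nat where "2 ^ (b * k) \<le> x" "x < 2 ^ (b * Suc k)"
proof -
  define P where "P j \<longleftrightarrow> x < 2 ^ (b * Suc j)" for j :: nat
  obtain n where n: "x < 2 ^ n" using real_arch_pow[of 2 x] by auto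
  have "(2::real) ^ n \<le> 2 ^ (b * Suc n)"
  proof (rule power_increasing)
    have "1 * n \<le> b * Suc n" using assms(2) by (intro mult_mono) auto
    then show "n \<le> b * Suc n" by simp
  qed simp
  with n have "P n" unfolding P_def by (rule less_le_trans)
  then have P: "P (LEAST j. P j)" by (rule LeastI)
  have "2 ^ (b * (LEAST j. P j)) \<le> x"
  proof (cases "LEAST j. P j")
    case (Suc j)
    then have "\<not> P j" by (metis lessI not_less_Least)
    then show ?thesis unfolding Suc by (simp add: P_def)
  qed (use assms in simp)
  with P show ?thesis using that by (simp add: P_def)
qed

text \<open>The terms t^p / M_p stop increasing once the quotients exceed t, and quotient growth
  puts this index below a power of t. Up to there the bound M_p \<ge> b^p costs only log (t / b) per
  index.\<close>

lemma assoc_fun_le_power: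
  assumes "strongly_regular M"
  obtains C s where "C \<ge> 1" "\<And>t. t \<ge> C \<Longrightarrow> assoc_fun M t \<le> C * t ^ s"
proof -
  note pos = strongly_regular_pos[OF assms]
  obtain s where s: "\<And>k. M (Suc ((2 ^ s) ^ k)) / M ((2 ^ s) ^ k) \<ge> 2 ^ k * (M 2 / M 1)"
    using strongly_regular_quotient_growth[OF assms] by blast
  define a b where "a = M 2 / M 1" and "b = M 1 / M 0"
  have ab: "a > 0" "b > 0" using pos by (auto simp: a_def b_def)
  have "assoc_fun M t \<le> (2 / a) ^ s / b * t ^ Suc s" if t: "t \<ge> a" "t \<ge> b" for t
  proof -
    have t0: "t > 0" using t ab by simp
    obtain k where k: "2 ^ (1 * k) \<le> t / a" "t / a < 2 ^ (1 * Suc k)"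
      using ex_pow2_bounds[of "t / a" 1] t ab by auto
    \<comment> \<open>At this index the quotient is at least 2^(k+1) a, which exceeds t, while P
      itself is at most (2 t / a)^s.\<close>
    define P where "P = ((2::nat) ^ s) ^ Suc k"
    have P: "t \<le> M (Suc p) / M p" if "p \<ge> P" for p
    proof -
      have "t \<le> 2 ^ Suc k * a" using k ab by (simp add: field_simps)
      also have "\<dots> \<le> M (Suc P) / M P" using s[of "Suc k"] by (simp add: P_def a_def)
      also have "\<dots> \<le> M (Suc p) / M p" by (rule strongly_regular_quotient_mono[OF assms that])
      finally show ?thesis .
    qed
    have M_ge: "b ^ p \<le> M p" for p
    proof (induction p)
      case (Suc p)
      have "b \<le> M (Suc p) / M p"
        using strongly_regular_quotient_mono[OF assms, of 0 p] by (simp add: b_def)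
      then have "b * M p \<le> M (Suc p)" using pos[of p] by (simp add: field_simps)
      moreover have "b * b ^ p \<le> b * M p" using Suc ab by simp
      ultimately show ?case by simp
    qed (simp add: strongly_regular_0[OF assms])
    have tb: "t ^ p / M p \<le> (t / b) ^ p" for p
      using M_ge[of p] pos[of p] t0 ab by (simp add: power_divide frac_le)
    have "t ^ p / M p \<le> (t / b) ^ P" for p
    proof (cases "p \<le> P")
      case True
      have "(t / b) ^ p \<le> (t / b) ^ P" using t ab True by (intro power_increasing) auto
      with tb[of p] show ?thesis by simp
    next
      case False
      then have "t ^ p / M p \<le> t ^ P / M P"
        by (intro strongly_regular_power_div_le[OF assms t0 P]) auto
      with tb[of P] show ?thesis by simp
    qed
    then have "assoc_fun M t \<le> ln ((t / b) ^ P)"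
      using t0 ab pos by (intro assoc_fun_le ln_mono) auto
    also have "\<dots> = real P * ln (t / b)" using t0 ab by (simp add: ln_realpow)
    also have "\<dots> \<le> (2 * (t / a)) ^ s * (t / b)"
    proof (rule mult_mono)
      have "real P = (2 * 2 ^ k) ^ s" by (simp add: P_def mult.commute flip: power_mult)
      also have "\<dots> \<le> (2 * (t / a)) ^ s" using k by (intro power_mono mult_left_mono) auto
      finally show "real P \<le> (2 * (t / a)) ^ s" .
      show "ln (t / b) \<le> t / b" using ln_le_minus_one[of "t / b"] t0 ab by simp
    qed (use t t0 ab in auto)
    also have "\<dots> = (2 / a) ^ s / b * t ^ Suc s" by (simp add: field_simps power_mult_distrib power_divide)
    finally show ?thesis .
  qed
  note bound = this
  define C where "C = max 1 (max (max a b) ((2 / a) ^ s / b))"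
  have C: "C \<ge> 1" "C \<ge> a" "C \<ge> b" "C \<ge> (2 / a) ^ s / b" by (auto simp: C_def)
  show ?thesis
  proof (rule that[of C "Suc s"])
    fix t assume t: "t \<ge> C"
    have "assoc_fun M t \<le> (2 / a) ^ s / b * t ^ Suc s" using t C by (intro bound) auto
    also have "\<dots> \<le> C * t ^ Suc s" using t C by (intro mult_right_mono) auto
    finally show "assoc_fun M t \<le> C * t ^ Suc s" .
  qed (rule C)
qed

text \<open>(mg) with p = q doubles the index, so M at 2^k is at most (2^(b k) M_1)^(2^k). Testing
  the supremum at the single index 2^k, with 2^(b k) comparable to t, gives a power of t from
  below.\<close>

lemma assoc_fun_ge_power:
  assumes "strongly_regular M"
  obtains C b where "C > 0" "b \<ge> 1" "\<And>t. t \<ge> C \<Longrightarrow> assoc_fun M t > 0 \<and>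
      ln (assoc_fun M t) \<ge> ln (t / C) / real b - ln 2"
proof -
  note pos = strongly_regular_pos[OF assms]
  obtain A where A: "A > 0" "\<And>p q. M (p + q) \<le> A ^ (p + q) * M p * M q"
    using strongly_regular_mg[OF assms] by blast
  obtain b where b0: "A < 2 ^ b" using real_arch_pow[of 2 A] by auto
  define b' where "b' = max 1 b"
  have "(2::real) ^ b \<le> 2 ^ b'" by (rule power_increasing) (auto simp: b'_def)
  with b0 have b: "A \<le> 2 ^ b'" "b' \<ge> 1" by (linarith, simp add: b'_def)
  have M: "M (2 ^ k) \<le> (2 ^ (b' * k) * M 1) ^ (2 ^ k)" for k
  proof (induction k)
    case (Suc k)
    have "M (2 ^ Suc k) \<le> A ^ (2 ^ Suc k) * M (2 ^ k) * M (2 ^ k)"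
      using A(2)[of "2 ^ k" "2 ^ k"] by (simp flip: mult_2)
    also have "\<dots> \<le> (2 ^ b') ^ (2 ^ Suc k) * (2 ^ (b' * k) * M 1) ^ (2 ^ k) * (2 ^ (b' * k) * M 1) ^ (2 ^ k)"
      using b A(1) Suc pos by (intro mult_mono power_mono) (auto simp: less_imp_le)
    also have "\<dots> = (2 ^ (b' * Suc k) * M 1) ^ (2 ^ Suc k)"
      by (simp add: power_add power_mult_distrib flip: power_mult)
        (simp add: mult_2 power_add power_mult_distrib distrib_left ac_simps)
    finally show ?case .
  qed simp
  \<comment> \<open>The factor e makes the base t / (2^(b k) M_1) at least e, so that the logarithm
    of its 2^k-th power is at least 2^k.\<close>
  define C where "C = exp 1 * M 1"
  have C: "C > 0" using pos[of 1] by (simp add: C_def)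
  have "assoc_fun M t > 0 \<and> ln (assoc_fun M t) \<ge> ln (t / C) / real b' - ln 2" if t: "t \<ge> C" for t
  proof -
    have t0: "t > 0" using t C by simp
    obtain k where k: "2 ^ (b' * k) \<le> t / C" "t / C < 2 ^ (b' * Suc k)"
      using ex_pow2_bounds[of "t / C" b'] t C b by (auto simp: field_simps)
    have e: "exp 1 \<le> t / (2 ^ (b' * k) * M 1)"
      using k C pos[of 1] by (simp add: C_def field_simps)
    have "(2::real) ^ k = ln (exp 1 ^ (2 ^ k))" by (simp add: ln_realpow)
    also have "\<dots> \<le> ln ((t / (2 ^ (b' * k) * M 1)) ^ (2 ^ k))"
      using e by (intro ln_mono power_mono) auto
    also have "\<dots> \<le> ln (t ^ (2 ^ k) / M (2 ^ k))"
      using M[of k] pos[of 1] pos[of "2 ^ k"] t0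
      by (intro ln_mono) (auto simp: power_divide intro!: divide_left_mono)
    also have "\<dots> \<le> assoc_fun M t" by (rule assoc_fun_ge[OF assms t0])
    finally have 1: "2 ^ k \<le> assoc_fun M t" .
    then have 2: "assoc_fun M t > 0" by (rule less_le_trans[rotated]) simp
    have "ln (t / C) \<le> ln (2 ^ (b' * Suc k))" using k t0 C by (intro ln_mono) auto
    also have "\<dots> = real b' * (real k * ln 2 + ln 2)" by (simp add: ln_realpow algebra_simps)
    finally have "ln (t / C) / real b' \<le> real k * ln 2 + ln 2" using b by (simp add: field_simps)
    moreover have "real k * ln 2 \<le> ln (assoc_fun M t)"
      using 1 by (subst ln_realpow[symmetric]) (auto intro: ln_mono)
    ultimately show ?thesis using 2 by simp
  qed
  then show ?thesis using that C b by blast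
qed

text \<open>\<open>growth_order\<close> is a real part of an extended real and
  \<open>growth_index\<close> a reciprocal, both of which default to 0 in the degenerate cases. The
  two power bounds make the upper limit finite and positive, so the sector on which \<open>e\<close>
  lives is not empty.\<close>

lemma growth_index_pos:
  assumes "strongly_regular M"
  shows "growth_index M > 0"
proof -
  define f where "f t = max 0 (ln (assoc_fun M t) / ln t)" for t
  define L where "L = Limsup at_top (\<lambda>t. ereal (f t))"
  obtain C s where C: "C \<ge> 1" "\<And>t. t \<ge> C \<Longrightarrow> assoc_fun M t \<le> C * t ^ s"
    using assoc_fun_le_power[OF assms] by blast
  obtain K b where K: "K > 0" "b \<ge> 1" "\<And>t. t \<ge> K \<Longrightarrow> assoc_fun M t > 0 \<and>
      ln (assoc_fun M t) \<ge> ln (t / K) / real b - ln 2"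
    using assoc_fun_ge_power[OF assms] by blast
  have ln_ev: "eventually (\<lambda>t. ln t \<ge> B) at_top" for B :: real
    using ln_at_top by (simp add: filterlim_at_top)
  have "eventually (\<lambda>t. f t \<le> real s + 1) at_top"
    using ln_ev[of "ln C"] ln_ev[of 1] eventually_ge_at_top[of C] eventually_ge_at_top[of K]
  proof eventually_elim
    case (elim t)
    have t: "t > 0" using elim C by linarith
    have "ln (assoc_fun M t) \<le> ln (C * t ^ s)"
      using C elim K by (intro ln_mono) auto
    also have "\<dots> = ln C + real s * ln t" using C t by (simp add: ln_mult ln_realpow)
    also have "\<dots> \<le> (real s + 1) * ln t" using elim by (simp add: algebra_simps)
    finally show ?case using elim by (simp add: f_def divide_le_eq)
  qed
  then have up: "L \<le> ereal (real s + 1)"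
    unfolding L_def by (intro Limsup_bounded) simp
  have "eventually (\<lambda>t. f t \<ge> 1 / (2 * real b)) at_top"
    using ln_ev[of "2 * (ln K + real b * ln 2)"] ln_ev[of 1] eventually_ge_at_top[of K]
  proof eventually_elim
    case (elim t)
    have t: "t > 0" using elim K by linarith
    have "1 / (2 * real b) * ln t \<le> (ln t - ln K - real b * ln 2) / real b"
      using elim K by (simp add: field_simps)
    also have "\<dots> = ln (t / K) / real b - ln 2" using t K by (simp add: ln_div field_simps)
    also have "\<dots> \<le> ln (assoc_fun M t)" using K(3)[of t] elim by simp
    finally have "1 / (2 * real b) \<le> ln (assoc_fun M t) / ln t"
      using elim by (simp add: le_divide_eq)
    then show ?case by (simp add: f_def)
  qed
  then have "ereal (1 / (2 * real b)) \<le> Liminf at_top (\<lambda>t. ereal (f t))"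
    by (intro Liminf_bounded) simp
  also have "\<dots> \<le> L" unfolding L_def by (rule Liminf_le_Limsup) simp
  finally have low: "ereal (1 / (2 * real b)) \<le> L" .
  obtain l where l: "L = ereal l" using up low by (cases L) auto
  have "l > 0" using low K(2) unfolding l by (simp, intro less_le_trans[of 0 "1 / (2 * real b)" l]) auto
  moreover have "growth_order M = l"
    using l unfolding L_def f_def growth_order_def by simp
  ultimately show ?thesis by (simp add: growth_index_def)
qed

section \<open>Power series and circle integrals\<close>

lemma
  fixes g :: "nat \<Rightarrow> real \<Rightarrow> 'a::banach"
  assumes "\<And>p. continuous_on {a..b} (g p)"
    and "\<And>p t. t \<in> {a..b} \<Longrightarrow> norm (g p t) \<le> c p" and "summable c"
  shows integral_sums_uniform: "(\<lambda>p. integral {a..b} (g p)) sums integral {a..b} (\<lambda>t. \<Sum>p. g p t)"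
    and continuous_on_suminf_uniform: "continuous_on {a..b} (\<lambda>t. \<Sum>p. g p t)"
proof -
  have u: "uniform_limit {a..b} (\<lambda>n t. \<Sum>p<n. g p t) (\<lambda>t. \<Sum>p. g p t) sequentially"
    by (rule Weierstrass_m_test) (use assms in auto)
  have c: "continuous_on {a..b} (\<lambda>t. \<Sum>p<n. g p t)" for n
    by (intro continuous_on_sum assms)
  show "continuous_on {a..b} (\<lambda>t. \<Sum>p. g p t)"
    by (rule uniform_limit_theorem[OF _ u]) (simp_all add: c)
  obtain I J where IJ: "\<And>n. ((\<lambda>t. \<Sum>p<n. g p t) has_integral I n) {a..b}"
      "((\<lambda>t. \<Sum>p. g p t) has_integral J) {a..b}" "I \<longlonglongrightarrow> J"
    using uniform_limit_integral[OF u c] by auto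
  have "I = (\<lambda>n. \<Sum>p<n. integral {a..b} (g p))"
  proof
    fix n show "I n = (\<Sum>p<n. integral {a..b} (g p))"
      using IJ(1)[of n] integral_sum[of "{..<n}" g "{a..b}"] assms(1)
      by (simp add: integrable_continuous_interval has_integral_iff)
  qed
  then show "(\<lambda>p. integral {a..b} (g p)) sums integral {a..b} (\<lambda>t. \<Sum>p. g p t)"
    using IJ(2,3) unfolding sums_def by (simp add: has_integral_iff)
qed

text \<open>A vector-valued power series is kept as its coefficient sequence \<open>a\<close>; the hypothesis
  \<open>norm (a p) * r ^ p \<le> C\<close> gives convergence for \<open>cmod z < r\<close>.\<close>

definition psum :: "(nat \<Rightarrow> 'a::complex_banach) \<Rightarrow> complex \<Rightarrow> 'a" where
  "psum a z = (\<Sum>p. z ^ p *\<^sub>C a p)"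

lemma psum_term_le:
  fixes a :: "nat \<Rightarrow> 'a::complex_banach"
  assumes "\<And>p. norm (a p) * r ^ p \<le> C" "r > 0" "cmod z \<le> s"
  shows "norm (z ^ p *\<^sub>C a p) \<le> C * (s / r) ^ p"
proof -
  have "norm (z ^ p *\<^sub>C a p) \<le> s ^ p * norm (a p)"
    using assms(3) by (simp add: norm_scaleC norm_power mult_right_mono power_mono)
  also have "\<dots> = (norm (a p) * r ^ p) * (s / r) ^ p"
    using assms(2) by (simp add: power_divide)
  also have "\<dots> \<le> C * (s / r) ^ p"
    using assms order.trans[OF norm_ge_zero assms(3)] by (intro mult_right_mono) auto
  finally show ?thesis .
qed

lemma
  fixes a :: "nat \<Rightarrow> 'a::complex_banach"
  assumes "\<And>p. norm (a p) * r ^ p \<le> C" "r > 0" "cmod z < r"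
  shows psum_sums: "(\<lambda>p. z ^ p *\<^sub>C a p) sums psum a z"
    and summable_norm_psum: "summable (\<lambda>p. norm (z ^ p *\<^sub>C a p))"
    and norm_psum_le: "norm (psum a z) \<le> C / (1 - cmod z / r)"
proof -
  have g: "(\<lambda>p. C * (cmod z / r) ^ p) sums (C / (1 - cmod z / r))"
    using sums_mult[OF geometric_sums[of "cmod z / r"], of C] assms by simp
  have le: "norm (z ^ p *\<^sub>C a p) \<le> C * (cmod z / r) ^ p" for p
    by (rule psum_term_le[OF assms(1,2)]) simp
  show s: "summable (\<lambda>p. norm (z ^ p *\<^sub>C a p))"
    by (rule summable_comparison_test'[OF sums_summable[OF g], of 0]) (use le in simp)
  show "(\<lambda>p. z ^ p *\<^sub>C a p) sums psum a z"
    unfolding psum_def by (rule summable_sums[OF summable_norm_cancel[OF s]])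
  have "norm (psum a z) \<le> (\<Sum>p. norm (z ^ p *\<^sub>C a p))"
    unfolding psum_def by (rule summable_norm[OF s])
  also have "\<dots> \<le> (\<Sum>p. C * (cmod z / r) ^ p)"
    by (rule suminf_le[OF le s sums_summable[OF g]])
  finally show "norm (psum a z) \<le> C / (1 - cmod z / r)"
    using sums_unique[OF g] by simp
qed

lemma vec_holomorphic_psum:
  fixes a :: "nat \<Rightarrow> 'a::complex_banach"
  assumes "\<And>p. norm (a p) * r ^ p \<le> C" "r > 0"
  shows "psum a vec_holomorphic_on ball 0 r"
  unfolding vec_holomorphic_on_open[OF open_ball]
proof
  fix z :: complex assume "z \<in> ball 0 r"
  then have z: "cmod z < r" by simp
  \<comment> \<open>A radius strictly between |z| and r, on whose disc the differentiated series
    converges uniformly.\<close>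
  define s where "s = (cmod z + r) / 2"
  have s: "cmod z < s" "s < r" "s > 0" using z assms(2) by (auto simp: s_def intro: add_nonneg_pos)
  define D where "D p w = (of_nat p * w ^ (p - 1)) *\<^sub>C a p" for p and w :: complex
  have Dle: "norm (D p w) \<le> C / r * (real p * (s / r) ^ (p - 1))" if w: "w \<in> ball 0 s" for p w
  proof (cases p)
    case (Suc q)
    have "norm (D p w) = real p * cmod w ^ q * norm (a p)"
      by (simp add: D_def norm_scaleC norm_mult norm_power Suc del: of_nat_Suc)
    also have "\<dots> \<le> real p * s ^ q * norm (a p)"
      using w by (intro mult_right_mono mult_left_mono power_mono) auto
    also have "\<dots> = (norm (a p) * r ^ p) / r * (real p * (s / r) ^ q)"
      using assms(2) by (simp add: power_divide Suc)
    also have "\<dots> \<le> C / r * (real p * (s / r) ^ q)"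
      using assms s by (intro mult_right_mono divide_right_mono) auto
    finally show ?thesis by (simp add: Suc)
  qed (simp add: D_def scaleC.zero_left)
  have sm: "summable (\<lambda>p. C / r * (real p * (s / r) ^ (p - 1)))"
    using geometric_deriv_sums[of "s / r"] s assms(2)
    by (intro summable_mult, subst summable_Suc_iff[symmetric]) (auto simp: sums_iff)
  have ul: "uniform_limit (ball 0 s) (\<lambda>n w. \<Sum>p<n. D p w) (\<lambda>w. \<Sum>p. D p w) sequentially"
    by (rule Weierstrass_m_test[OF Dle sm])
  have "\<exists>g. \<forall>x\<in>ball 0 s. (\<lambda>n. x ^ n *\<^sub>C a n) sums (g x) \<and>
      (g has_derivative (\<lambda>h. h *\<^sub>C (\<Sum>p. D p x))) (at x within ball 0 s)"
  proof (rule has_derivative_series)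
    fix n :: nat and x :: complex assume "x \<in> ball 0 s"
    have "((\<lambda>x. x ^ n) has_field_derivative (of_nat n * x ^ (n - 1))) (at x within ball 0 s)"
      by (auto intro!: derivative_eq_intros)
    from has_field_derivative_scaleC[OF this, of "\<lambda>_. a n" 0]
    show "((\<lambda>x. x ^ n *\<^sub>C a n) has_derivative (\<lambda>h. h *\<^sub>C D n x)) (at x within ball 0 s)"
      by (simp add: D_def scaleC.zero_right)
  next
    fix e :: real assume "e > 0"
    with ul have "\<forall>\<^sub>F n in sequentially. \<forall>x\<in>ball 0 s. dist (\<Sum>p<n. D p x) (\<Sum>p. D p x) < e"
      unfolding uniform_limit_iff by blast
    then show "\<forall>\<^sub>F n in sequentially. \<forall>x\<in>ball 0 s. \<forall>h.
        norm ((\<Sum>i<n. h *\<^sub>C D i x) - h *\<^sub>C (\<Sum>p. D p x)) \<le> e * norm h"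
    proof eventually_elim
      case (elim n)
      have "norm ((\<Sum>i<n. h *\<^sub>C D i x) - h *\<^sub>C (\<Sum>p. D p x)) \<le> e * norm h" if "x \<in> ball 0 s" for x h
      proof -
        have "(\<Sum>i<n. h *\<^sub>C D i x) - h *\<^sub>C (\<Sum>p. D p x) = h *\<^sub>C ((\<Sum>i<n. D i x) - (\<Sum>p. D p x))"
          by (simp add: scaleC.sum_right scaleC.diff_right)
        moreover have "cmod h * norm ((\<Sum>i<n. D i x) - (\<Sum>p. D p x)) \<le> cmod h * e"
          using elim that by (intro mult_left_mono) (auto simp: dist_norm less_imp_le)
        ultimately show ?thesis by (simp add: norm_scaleC mult.commute)
      qed
      then show ?case by blast
    qed
  next
    show "z \<in> ball 0 s" using s by simp
    show "(\<lambda>n. z ^ n *\<^sub>C a n) sums psum a z" by (rule psum_sums[OF assms z])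
  qed simp
  then obtain g where g: "\<And>x. x \<in> ball 0 s \<Longrightarrow> (\<lambda>n. x ^ n *\<^sub>C a n) sums (g x)"
      "\<And>x. x \<in> ball 0 s \<Longrightarrow> (g has_derivative (\<lambda>h. h *\<^sub>C (\<Sum>p. D p x))) (at x within ball 0 s)"
    by blast
  have zs: "z \<in> ball 0 s" using s by simp
  have gp: "g x = psum a x" if "x \<in> ball 0 s" for x
    using g(1)[OF that] by (simp add: psum_def sums_iff)
  have "(psum a has_derivative (\<lambda>h. h *\<^sub>C (\<Sum>p. D p z))) (at z within ball 0 s)"
    by (rule has_derivative_transform[OF zs _ g(2)[OF zs]]) (simp add: gp)
  then show "\<exists>E. (psum a has_derivative (\<lambda>h. h *\<^sub>C E)) (at z)"
    using at_within_open[OF zs open_ball] by auto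
qed

section \<open>Cauchy's coefficient formula and Hadamard products on circles\<close>

lemma integral_exp_circle:
  fixes k :: int
  shows "integral {c..c + 2 * pi} (\<lambda>y. exp (of_int k * Complex \<rho> y)) = (if k = 0 then of_real (2 * pi) else 0)"
proof (cases "k = 0")
  case False
  define P where "P y = exp (of_int k * Complex \<rho> y) / (of_int k * \<i>)" for y
  have "((\<lambda>y. exp (of_int k * Complex \<rho> y)) has_integral (P (c + 2 * pi) - P c)) {c..c + 2 * pi}"
  proof (rule fundamental_theorem_of_calculus)
    fix y
    have "((\<lambda>z. exp (of_int k * (of_real \<rho> + \<i> * z)) / (of_int k * \<i>)) has_field_derivative
        exp (of_int k * (of_real \<rho> + \<i> * of_real y))) (at (of_real y))"
      using False by (auto intro!: derivative_eq_intros)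
    from has_vector_derivative_real_field[OF this]
    show "(P has_vector_derivative exp (of_int k * Complex \<rho> y)) (at y within {c..c + 2 * pi})"
      unfolding P_def Complex_eq by (rule has_vector_derivative_at_within)
  qed simp
  moreover have "P (c + 2 * pi) = P c"
  proof -
    have "exp (of_int k * Complex \<rho> (c + 2 * pi)) = exp (of_int k * Complex \<rho> c + (2 * of_int k * of_real pi) * \<i>)"
      by (simp add: Complex_eq algebra_simps)
    also have "\<dots> = exp (of_int k * Complex \<rho> c)" using exp_integer_2pi[of "of_int k"] by (simp add: exp_add)
    finally show ?thesis by (simp add: P_def)
  qed
  ultimately show ?thesis using False by (simp add: integral_unique)
qed (simp add: scaleR_conv_of_real)

lemma psum_exp_continuous:
  fixes a :: "nat \<Rightarrow> 'a::complex_banach"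
  assumes "\<And>p. norm (a p) * r ^ p \<le> C" "r > 0" "exp \<rho> < r"
  shows "continuous_on S (\<lambda>y. psum a (exp (Complex \<rho> y)))"
  by (rule continuous_on_compose2[OF vec_holomorphic_on_imp_continuous_on[OF vec_holomorphic_psum[OF assms(1,2)]]])
    (use assms(3) in \<open>auto simp: Complex_eq intro!: continuous_intros\<close>)

text \<open>Orthogonality of the exponentials after termwise integration. The initial argument
  \<open>c\<close> is left free because the contour is cut at the edge of a sector, not at
  0.\<close>

lemma psum_coefficient:
  fixes a :: "nat \<Rightarrow> 'a::complex_banach"
  assumes "\<And>p. norm (a p) * r ^ p \<le> C" "r > 0" "exp \<rho> < r"
  shows "integral {c..c + 2 * pi} (\<lambda>y. exp (- of_nat q * Complex \<rho> y) *\<^sub>C psum a (exp (Complex \<rho> y)))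
     = (2 * pi) *\<^sub>R a q"
proof -
  let ?g = "\<lambda>p y. exp (of_int (int p - int q) * Complex \<rho> y) *\<^sub>C a p"
  have g: "?g p y = exp (- of_nat q * Complex \<rho> y) *\<^sub>C exp (Complex \<rho> y) ^ p *\<^sub>C a p" for p y
    by (simp add: scaleC_scaleC exp_of_nat_mult[symmetric] flip: exp_add) (simp add: algebra_simps)
  have "(\<lambda>p. integral {c..c + 2 * pi} (?g p)) sums integral {c..c + 2 * pi} (\<lambda>t. \<Sum>p. ?g p t)"
  proof (rule integral_sums_uniform)
    show "continuous_on {c..c + 2 * pi} (?g p)" for p
      by (intro scaleC.continuous_on continuous_intros)
    show "norm (?g p y) \<le> exp (- real q * \<rho>) * (C * (exp \<rho> / r) ^ p)" for p y
    proof -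
      have "norm (?g p y) = exp (- real q * \<rho>) * norm (exp (Complex \<rho> y) ^ p *\<^sub>C a p)"
        unfolding g by (simp add: norm_scaleC)
      also have "\<dots> \<le> exp (- real q * \<rho>) * (C * (exp \<rho> / r) ^ p)"
        by (intro mult_left_mono psum_term_le[OF assms(1,2)]) auto
      finally show ?thesis .
    qed
    show "summable (\<lambda>p. exp (- real q * \<rho>) * (C * (exp \<rho> / r) ^ p))"
      using assms by (intro summable_mult summable_geometric) auto
  qed
  also have "(\<lambda>p. integral {c..c + 2 * pi} (?g p)) = (\<lambda>p. if p = q then (2 * pi) *\<^sub>R a q else 0)"
  proof
    fix p
    have "integral {c..c + 2 * pi} (?g p) =
        integral {c..c + 2 * pi} (\<lambda>y. exp (of_int (int p - int q) * Complex \<rho> y)) *\<^sub>C a p"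
      using integral_linear[OF _ scaleC.bounded_linear_left, of "\<lambda>y. exp (of_int (int p - int q) * Complex \<rho> y)"
          "{c..c + 2 * pi}" "a p"]
      by (simp add: o_def Complex_eq integrable_continuous_interval continuous_intros)
    also have "\<dots> = (if p = q then (2 * pi) *\<^sub>R a q else 0)"
      unfolding integral_exp_circle by (auto simp: scaleC.zero_left scaleR_eq_scaleC)
    finally show "integral {c..c + 2 * pi} (?g p) = (if p = q then (2 * pi) *\<^sub>R a q else 0)" .
  qed
  also have "(\<lambda>t. \<Sum>p. ?g p t) = (\<lambda>y. exp (- of_nat q * Complex \<rho> y) *\<^sub>C psum a (exp (Complex \<rho> y)))"
  proof
    fix y
    have "(\<lambda>p. exp (Complex \<rho> y) ^ p *\<^sub>C a p) sums psum a (exp (Complex \<rho> y))"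
      by (rule psum_sums[OF assms(1,2)]) (use assms(3) in simp)
    from bounded_linear.sums[OF scaleC.bounded_linear_right this]
    show "(\<Sum>p. ?g p y) = exp (- of_nat q * Complex \<rho> y) *\<^sub>C psum a (exp (Complex \<rho> y))"
      unfolding g by (rule sums_unique[symmetric])
  qed
  finally have "(\<lambda>p. if p = q then (2 * pi) *\<^sub>R a q else 0) sums
    integral {c..c + 2 * pi} (\<lambda>y. exp (- of_nat q * Complex \<rho> y) *\<^sub>C psum a (exp (Complex \<rho> y)))" .
  from sums_unique2[OF this sums_single[of q "\<lambda>_. (2 * pi) *\<^sub>R a q"]] show ?thesis .
qed

text \<open>Hadamard's product formula: expand only the \<open>l\<close>-series under the integral
  and read off each coefficient of \<open>a\<close> from the circle |w| = exp \<rho>. That circle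
  must lie inside the disc of \<open>a\<close> and satisfy |z / w| < s for the point z = exp
  v.\<close>

lemma psum_circle_convolution:
  fixes a :: "nat \<Rightarrow> 'a::complex_banach" and l :: "nat \<Rightarrow> complex"
  assumes a: "\<And>p. norm (a p) * r ^ p \<le> C" "r > 0" "exp \<rho> < r"
    and l: "\<And>p. norm (l p) * s ^ p \<le> B" "s > 0" "exp (Re v - \<rho>) < s"
  shows "(\<lambda>q. exp v ^ q *\<^sub>C l q *\<^sub>C a q) sums
     ((1 / (2 * pi)) *\<^sub>R integral {c..c + 2 * pi}
        (\<lambda>y. psum l (exp (v - Complex \<rho> y)) *\<^sub>C psum a (exp (Complex \<rho> y))))"
proof -
  define P where "P y = psum a (exp (Complex \<rho> y))" for y
  define g where "g q y = (exp (v - Complex \<rho> y) ^ q * l q) *\<^sub>C P y" for q y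
  have P: "continuous_on {c..c + 2 * pi} P" unfolding P_def by (rule psum_exp_continuous[OF a])
  define A where "A = C / (1 - exp \<rho> / r)"
  have PA: "norm (P y) \<le> A" for y
    using norm_psum_le[OF a(1,2), of "exp (Complex \<rho> y)"] a(3) by (simp add: P_def A_def)
  have B: "B \<ge> 0" using order.trans[OF mult_nonneg_nonneg[OF norm_ge_zero zero_le_power] l(1)[of 0]] l(2) by simp
  have "(\<lambda>q. integral {c..c + 2 * pi} (g q)) sums integral {c..c + 2 * pi} (\<lambda>t. \<Sum>q. g q t)"
  proof (rule integral_sums_uniform)
    show "continuous_on {c..c + 2 * pi} (g q)" for q
      unfolding g_def
      by (intro scaleC.continuous_on P) (auto simp: Complex_eq intro!: continuous_intros)
    show "norm (g q y) \<le> B * (exp (Re v - \<rho>) / s) ^ q * A" for q y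
    proof -
      have "norm (exp (v - Complex \<rho> y) ^ q *\<^sub>C l q) \<le> B * (exp (Re v - \<rho>) / s) ^ q"
        by (rule psum_term_le[OF l(1,2)]) simp
      then show ?thesis unfolding g_def norm_scaleC
        using PA B l(2) by (intro mult_mono) (auto simp: scaleC_complex_def norm_mult)
    qed
    show "summable (\<lambda>q. B * (exp (Re v - \<rho>) / s) ^ q * A)"
      using l by (intro summable_mult2 summable_mult summable_geometric) auto
  qed
  also have "(\<lambda>q. integral {c..c + 2 * pi} (g q)) = (\<lambda>q. (2 * pi) *\<^sub>R exp v ^ q *\<^sub>C l q *\<^sub>C a q)"
  proof
    fix q
    have e2: "exp (v - w) ^ q = exp v ^ q * exp (- of_nat q * w)" for w
      by (simp flip: exp_of_nat_mult exp_add) (simp add: algebra_simps)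
    have "g q = (\<lambda>y. (exp v ^ q * l q) *\<^sub>C exp (- of_nat q * Complex \<rho> y) *\<^sub>C P y)"
      by (simp add: fun_eq_iff g_def e2 scaleC_scaleC ac_simps)
    moreover have "(\<lambda>y. exp (- of_nat q * Complex \<rho> y) *\<^sub>C P y) integrable_on {c..c + 2 * pi}"
      by (intro integrable_continuous_interval scaleC.continuous_on P)
        (auto simp: Complex_eq intro!: continuous_intros)
    ultimately have "integral {c..c + 2 * pi} (g q) = (exp v ^ q * l q) *\<^sub>C
        integral {c..c + 2 * pi} (\<lambda>y. exp (- of_nat q * Complex \<rho> y) *\<^sub>C P y)"
      using integral_linear[OF _ scaleC.bounded_linear_right] by (simp add: o_def)
    also have "\<dots> = (2 * pi) *\<^sub>R exp v ^ q *\<^sub>C l q *\<^sub>C a q"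
      unfolding P_def psum_coefficient[OF a] by (simp add: scaleC.scaleR_right scaleC_scaleC)
    finally show "integral {c..c + 2 * pi} (g q) = (2 * pi) *\<^sub>R exp v ^ q *\<^sub>C l q *\<^sub>C a q" .
  qed
  also have "(\<lambda>t. \<Sum>q. g q t) = (\<lambda>y. psum l (exp (v - Complex \<rho> y)) *\<^sub>C P y)"
  proof
    fix y
    have "(\<lambda>q. exp (v - Complex \<rho> y) ^ q *\<^sub>C l q) sums psum l (exp (v - Complex \<rho> y))"
      by (rule psum_sums[OF l(1,2)]) (use l(3) in simp)
    from bounded_linear.sums[OF scaleC.bounded_linear_left this]
    show "(\<Sum>q. g q y) = psum l (exp (v - Complex \<rho> y)) *\<^sub>C P y"
      unfolding g_def by (auto simp: scaleC_complex_def sums_iff)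
  qed
  finally have "(\<lambda>q. (1 / (2 * pi)) *\<^sub>R (2 * pi) *\<^sub>R exp v ^ q *\<^sub>C l q *\<^sub>C a q) sums
    ((1 / (2 * pi)) *\<^sub>R integral {c..c + 2 * pi} (\<lambda>y. psum l (exp (v - Complex \<rho> y)) *\<^sub>C P y))"
    by (rule sums_scaleR_right)
  then show ?thesis by (simp add: P_def)
qed

section \<open>Kernel functions and their Hadamard kernel\<close>

text \<open>Here \<open>M\<close> is the sequence behind the moments \<open>n\<close>; it need not
  be the sequence that measures summability.\<close>

locale moment_kernel =
  fixes M n :: "nat \<Rightarrow> real" and e E :: "complex \<Rightarrow> complex"
  assumes sr: "strongly_regular M" and index_less: "growth_index M < 2"
    and kernel: "kernel_functions M e E"
    and moments: "\<And>p. complex_of_real (n p) = moment_fun e (of_nat p)"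
begin

abbreviation \<omega> where "\<omega> \<equiv> growth_index M"

lemma \<omega>_pos: "\<omega> > 0" by (rule growth_index_pos[OF sr])

lemmas kernel' = kernel[unfolded kernel_functions_def Let_def]
lemmas e_holomorphic = kernel'[THEN conjunct1]
lemmas kernel_conj3 = kernel'[THEN conjunct2, THEN conjunct2]
lemmas kernel_conj5 = kernel_conj3[THEN conjunct2, THEN conjunct2]

lemma e_bound:
  assumes "\<tau> < \<omega> * pi / 2"
  obtains c k where "c > 0" "k > 0"
    "\<And>x. \<bar>Im x\<bar> \<le> \<tau> \<Longrightarrow> cmod (e (exp x)) \<le> c * exp (- assoc_fun M (exp (Re x) / k))"
proof -
  \<comment> \<open>Half of the slack in the opening, so that the closed strip of height \<tau> fits
    into the smaller open sector.\<close>
  define \<epsilon> where "\<epsilon> = (\<omega> * pi - 2 * \<tau>) / 2"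
  have \<epsilon>: "\<epsilon> > 0" using assms by (simp add: \<epsilon>_def)
  obtain c k where ck: "c > 0" "k > 0"
      "\<And>z. z \<in> sector 0 (\<omega> * pi - \<epsilon>) \<Longrightarrow> cmod (e z) \<le> c * exp (- assoc_fun M (cmod z / k))"
    using kernel_conj3[THEN conjunct1, rule_format, OF \<epsilon>] by blast
  show ?thesis
  proof (rule that[OF ck(1,2)])
    fix x assume "\<bar>Im x\<bar> \<le> \<tau>"
    then have "exp x \<in> sector 0 (\<omega> * pi - \<epsilon>)"
      using assms by (auto simp: sector_def log_sector_def \<epsilon>_def field_simps)
    from ck(3)[OF this] show "cmod (e (exp x)) \<le> c * exp (- assoc_fun M (exp (Re x) / k))" by simp
  qed
qed

lemma E_holomorphic: "E holomorphic_on A"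
  by (rule holomorphic_on_subset[OF kernel_conj5[THEN conjunct1]]) simp

lemma E_growth:
  obtains c k where "c > 0" "k > 0" "\<And>z. cmod (E z) \<le> c * exp (assoc_fun M (cmod z / k))"
  using kernel_conj5[THEN conjunct2, THEN conjunct1] by blast

lemma n_nonzero: "n p \<noteq> 0"
  using kernel_conj5[THEN conjunct2, THEN conjunct2, THEN conjunct2, THEN conjunct2, THEN conjunct2, THEN conjunct1]
    moments[of p] by (metis of_real_0)

lemma E_sums: "(\<lambda>p. z ^ p / of_real (n p)) sums E z"
  using kernel_conj5[THEN conjunct2, THEN conjunct2, THEN conjunct2, THEN conjunct2, THEN conjunct2, THEN conjunct2]
  by (simp add: moments)

text \<open>Outside the unit disc the decay of \<open>E\<close> is weakened to boundedness, inside
  it compactness is used. Boundedness suffices, since \<open>e\<close> alone makes the integrals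
  converge.\<close>

lemma E_bounded:
  assumes "0 \<le> \<eta>" "\<eta> < pi - \<omega> * pi / 2"
  obtains B where "B \<ge> 0" "\<And>w. \<bar>Im w - pi\<bar> \<le> \<eta> \<Longrightarrow> cmod (E (exp w)) \<le> B"
proof -
  define \<theta> where "\<theta> = (2 * \<eta> + (2 * pi - \<omega> * pi)) / 2"
  have \<theta>: "0 < \<theta>" "\<theta> < 2 * pi - \<omega> * pi" "2 * \<eta> < \<theta>"
    using assms by (auto simp: \<theta>_def field_simps)
  obtain \<beta> where \<beta>: "\<beta> > 0" and
      H: "\<And>\<theta> R. 0 < \<theta> \<and> \<theta> < 2 * pi - \<omega> * pi \<and> 0 < R \<Longrightarrow>
         \<exists>c>0. \<forall>z\<in>sector pi \<theta> - ball 0 R. cmod (E z) \<le> c * cmod z powr (- \<beta>)"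
    using kernel_conj5[THEN conjunct2, THEN conjunct2, THEN conjunct1] by metis
  obtain c where c: "c > 0"
      "\<And>z. z \<in> sector pi \<theta> - ball 0 1 \<Longrightarrow> cmod (E z) \<le> c * cmod z powr (- \<beta>)"
    using H[of \<theta> 1] \<theta> by auto
  have "bounded (E ` cball 0 1)"
    by (intro compact_imp_bounded compact_continuous_image holomorphic_on_imp_continuous_on E_holomorphic) simp
  then obtain b where b: "\<And>z. cmod z \<le> 1 \<Longrightarrow> cmod (E z) \<le> b"
    unfolding bounded_iff by fastforce
  show ?thesis
  proof (rule that[of "max b c"])
    show "0 \<le> max b c" using c by simp
    fix w assume w: "\<bar>Im w - pi\<bar> \<le> \<eta>"
    show "cmod (E (exp w)) \<le> max b c"
    proof (cases "cmod (exp w) \<le> 1")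
      case True
      then show ?thesis using b[of "exp w"] by simp
    next
      case False
      have "exp w \<in> sector pi \<theta>" using w \<theta> by (auto simp: sector_def log_sector_def)
      with False have "cmod (E (exp w)) \<le> c * cmod (exp w) powr (- \<beta>)" by (intro c) auto
      also have "cmod (exp w) powr (- \<beta>) \<le> cmod (exp w) powr 0"
        using False \<beta> by (intro powr_mono) auto
      then have "c * cmod (exp w) powr (- \<beta>) \<le> c * 1" using c by (intro mult_left_mono) auto
      finally show ?thesis by simp
    qed
  qed
qed

text \<open>The form \<open>e\<close> \<xi> d\<xi> in the coordinate \<xi> = exp x; the factor
  \<open>exp x\<close> is the Jacobian.\<close>

definition eh :: "complex \<Rightarrow> complex" where "eh x = e (exp x) * exp x"

definition estrip :: "complex set" where "estrip = {x. \<bar>Im x\<bar> < \<omega> * pi / 2}"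

lemma open_estrip: "open estrip" and convex_estrip: "convex estrip"
proof -
  have *: "estrip = {x. Im x < \<omega> * pi / 2} \<inter> {x. Im x > - (\<omega> * pi / 2)}"
    by (auto simp: estrip_def)
  show "open estrip" unfolding * by (intro open_Int open_halfspace_Im_lt open_halfspace_Im_gt)
  show "convex estrip" unfolding * by (intro convex_Int convex_halfspace_Im_lt convex_halfspace_Im_gt)
qed

lemma eh_holomorphic: "eh holomorphic_on estrip"
  unfolding eh_def
  by (intro holomorphic_intros holomorphic_on_compose_gen[OF _ e_holomorphic, unfolded o_def])
    (auto simp: sector_def log_sector_def estrip_def intro!: holomorphic_intros)

text \<open>Together with the Jacobian the exponent of exp x is p + 1. Spending the p-th power
  against the decay of \<open>e\<close> leaves exp (Re x), good on the left half; spending the (p +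
  2)-nd leaves exp (- Re x), good on the right half.\<close>

lemma eh_bound:
  assumes "\<tau> < \<omega> * pi / 2"
  obtains c k where "c > 0" "k > 0"
    "\<And>x p. \<bar>Im x\<bar> \<le> \<tau> \<Longrightarrow> cmod (eh x * exp (of_nat p * x))
       \<le> c * (k ^ p * M p + k ^ (p + 2) * M (p + 2)) * exp (- \<bar>Re x\<bar>)"
proof -
  obtain c k where ck: "c > 0" "k > 0"
    "\<And>x. \<bar>Im x\<bar> \<le> \<tau> \<Longrightarrow> cmod (e (exp x)) \<le> c * exp (- assoc_fun M (exp (Re x) / k))"
    using e_bound[OF assms] by blast
  have pw: "cmod (e (exp x)) * exp (Re x) ^ p \<le> c * (k ^ p * M p)" if x: "\<bar>Im x\<bar> \<le> \<tau>" for x p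
  proof -
    have "cmod (e (exp x)) * exp (Re x) ^ p \<le>
        (c * exp (- assoc_fun M (exp (Re x) / k))) * exp (Re x) ^ p"
      by (intro mult_right_mono ck(3) x) simp
    also have "\<dots> = c * (k ^ p * ((exp (Re x) / k) ^ p * exp (- assoc_fun M (exp (Re x) / k))))"
      using ck(2) by (simp add: power_divide)
    also have "\<dots> \<le> c * (k ^ p * M p)"
      using ck by (intro mult_left_mono power_exp_minus_assoc_fun_le[OF sr]) auto
    finally show ?thesis .
  qed
  note pos = strongly_regular_pos[OF sr]
  show ?thesis
  proof (rule that[OF ck(1,2)])
    fix x p assume x: "\<bar>Im x\<bar> \<le> \<tau>"
    have eq: "cmod (eh x * exp (of_nat p * x)) = cmod (e (exp x)) * exp (Re x) ^ p * exp (Re x)"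
      by (simp add: eh_def norm_mult exp_of_nat_mult norm_power)
    show "cmod (eh x * exp (of_nat p * x))
       \<le> c * (k ^ p * M p + k ^ (p + 2) * M (p + 2)) * exp (- \<bar>Re x\<bar>)"
    proof (cases "Re x \<le> 0")
      case True
      have "cmod (eh x * exp (of_nat p * x)) \<le> c * (k ^ p * M p) * exp (Re x)"
        unfolding eq by (intro mult_right_mono pw x) simp
      also have "\<dots> \<le> c * (k ^ p * M p + k ^ (p + 2) * M (p + 2)) * exp (- \<bar>Re x\<bar>)"
        using True ck pos[of "p + 2"] by (intro mult_mono mult_left_mono) (auto simp: less_imp_le pos)
      finally show ?thesis .
    next
      case False
      have "cmod (eh x * exp (of_nat p * x)) = cmod (e (exp x)) * exp (Re x) ^ (p + 2) * exp (- Re x)"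
        unfolding eq by (simp add: exp_minus field_simps)
      also have "\<dots> \<le> c * (k ^ (p + 2) * M (p + 2)) * exp (- Re x)"
        by (intro mult_right_mono pw x) simp
      also have "\<dots> \<le> c * (k ^ p * M p + k ^ (p + 2) * M (p + 2)) * exp (- \<bar>Re x\<bar>)"
        using False ck pos[of p] pos[of "p + 2"] by (intro mult_mono mult_left_mono) (auto simp: less_imp_le)
      finally show ?thesis .
    qed
  qed
qed

text \<open>Cauchy's estimate for the entire function \<open>E\<close>, at the radius k r where r is
  an extremal radius for index p: there exp (\<open>assoc_fun M r\<close>) is at most r^p / M_p, so
  the growth bound of \<open>E\<close> gives back exactly M_p up to a geometric factor.\<close>

lemma inverse_moment_bound:
  obtains c k where "c > 0" "k > 0" "\<And>p. 1 / \<bar>n p\<bar> \<le> c / (k ^ p * M p)"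
proof -
  obtain c k where ck: "c > 0" "k > 0" "\<And>z. cmod (E z) \<le> c * exp (assoc_fun M (cmod z / k))"
    using E_growth by blast
  define a where "a p = complex_of_real (1 / n p)" for p
  have as: "(\<lambda>p. z ^ p *\<^sub>C a p) sums E z" for z
    using E_sums[of z] by (simp add: a_def scaleC_complex_def divide_inverse)
  then have psE: "psum a z = E z" for z by (simp add: psum_def sums_iff)
  have "1 / \<bar>n p\<bar> \<le> c / (k ^ p * M p)" for p
  proof -
    obtain r where r: "r > 0" "exp (assoc_fun M r) \<le> r ^ p / M p"
      using exp_assoc_fun_le_power[OF sr] by blast
    define R where "R = k * r"
    have R: "R > 0" using ck r by (simp add: R_def)
    \<comment> \<open>Boundedness of the terms at radius 2 R puts the circle of radius
      \<open>R\<close> strictly inside the disc of convergence required by the coefficient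
      formula.\<close>
    have "(\<lambda>p. of_real (2 * R) ^ p *\<^sub>C a p) \<longlonglongrightarrow> 0"
      by (rule summable_LIMSEQ_zero[OF sums_summable[OF as]])
    then have "Bseq (\<lambda>p. of_real (2 * R) ^ p *\<^sub>C a p)" by (simp add: convergent_imp_Bseq convergentI)
    then obtain C where C: "\<And>p. norm (of_real (2 * R) ^ p *\<^sub>C a p) \<le> C"
      by (auto simp: Bseq_def)
    have C': "norm (a p) * (2 * R) ^ p \<le> C" for p
      using C[of p] R by (simp add: norm_scaleC norm_power norm_mult mult.commute)
    have lR: "exp (ln R) < 2 * R" using R by simp
    have nR: "cmod (exp (Complex (ln R) y)) = R" for y using R by simp
    have "norm (integral {0..0 + 2 * pi} (\<lambda>y. exp (- of_nat p * Complex (ln R) y) *\<^sub>C psum a (exp (Complex (ln R) y))))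
        \<le> (c * exp (assoc_fun M r) / R ^ p) * (0 + 2 * pi - 0)"
    proof (rule integral_bound)
      show "continuous_on {0..0 + 2 * pi} (\<lambda>y. exp (- of_nat p * Complex (ln R) y) *\<^sub>C psum a (exp (Complex (ln R) y)))"
        by (intro scaleC.continuous_on psum_exp_continuous[OF C' _ lR]) (use R in \<open>auto intro!: continuous_intros\<close>)
      fix y
      have "cmod (exp (- of_nat p * Complex (ln R) y)) = 1 / R ^ p"
        using R by (simp add: exp_minus exp_of_nat_mult divide_inverse norm_inverse norm_power)
      moreover have "norm (psum a (exp (Complex (ln R) y))) \<le> c * exp (assoc_fun M r)"
        using ck(3)[of "exp (Complex (ln R) y)"] ck(2) unfolding psE nR by (simp add: R_def)
      ultimately show "norm (exp (- of_nat p * Complex (ln R) y) *\<^sub>C psum a (exp (Complex (ln R) y)))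
          \<le> c * exp (assoc_fun M r) / R ^ p"
        unfolding norm_scaleC using R by (simp add: divide_right_mono)
    qed simp
    also have "integral {0..0 + 2 * pi} (\<lambda>y. exp (- of_nat p * Complex (ln R) y) *\<^sub>C psum a (exp (Complex (ln R) y)))
        = (2 * pi) *\<^sub>R a p"
      by (rule psum_coefficient[OF C' _ lR]) (use R in simp)
    finally have "2 * pi * (1 / \<bar>n p\<bar>) \<le> 2 * pi * (c * exp (assoc_fun M r) / R ^ p)"
      by (simp add: a_def norm_divide mult.commute)
    then have "1 / \<bar>n p\<bar> \<le> c * exp (assoc_fun M r) / R ^ p"
      by (rule mult_left_le_imp_le) simp
    also have "\<dots> \<le> c * (r ^ p / M p) / R ^ p"
      using ck R r by (intro divide_right_mono mult_left_mono) auto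
    also have "\<dots> = c / (k ^ p * M p)"
      using r ck by (simp add: R_def power_mult_distrib field_simps)
    finally show ?thesis .
  qed
  then show ?thesis using that ck by blast
qed

end

text \<open>Improper integrals over the line are handled as limits over [-N, N]. Each step adds two
  unit intervals on which the integrand is at most C exp (- N), so the increments are dominated by a
  geometric series; this feeds the Weierstrass test below.\<close>

lemma
  fixes f :: "real \<Rightarrow> complex"
  assumes cont: "continuous_on UNIV f" and bound: "\<And>x. cmod (f x) \<le> C * exp (- \<bar>x\<bar>)"
  shows symmetric_integral_step: "cmod (integral {- real (Suc N)..real (Suc N)} f - integral {- real N..real N} f)
      \<le> 2 * C * exp (-1) ^ N"
    and symmetric_integral_bound: "cmod (integral {- real N..real N} f) \<le> 2 * C / (1 - exp (-1))"
proof -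
  define F where "F N = integral {- real N..real N} f" for N
  have i: "f integrable_on {a..b}" for a b
    by (intro integrable_continuous_interval continuous_on_subset[OF cont]) simp
  have C: "C \<ge> 0" using order.trans[OF norm_ge_zero bound[of 0]] by simp
  have step: "cmod (F (Suc N) - F N) \<le> 2 * C * exp (-1) ^ N" for N
  proof -
    have e: "exp (-1) ^ N = exp (- real N)" by (simp flip: exp_of_nat_mult)
    have "F (Suc N) = integral {- real (Suc N)..- real N} f + integral {- real N..real (Suc N)} f"
      unfolding F_def by (rule Henstock_Kurzweil_Integration.integral_combine[symmetric]) (auto simp: i)
    also have "integral {- real N..real (Suc N)} f = F N + integral {real N..real (Suc N)} f"
      unfolding F_def by (rule Henstock_Kurzweil_Integration.integral_combine[symmetric]) (auto simp: i)
    finally have "F (Suc N) - F N = integral {- real (Suc N)..- real N} f + integral {real N..real (Suc N)} f"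
      by simp
    moreover have "cmod (integral {- real (Suc N)..- real N} f) \<le> C * exp (- real N) * (- real N - (- real (Suc N)))"
    proof (rule integral_bound)
      fix t assume "t \<in> {- real (Suc N)..- real N}"
      then have "C * exp (- \<bar>t\<bar>) \<le> C * exp (- real N)" using C by (intro mult_left_mono) auto
      with bound[of t] show "cmod (f t) \<le> C * exp (- real N)" by simp
    qed (auto intro: continuous_on_subset[OF cont])
    moreover have "cmod (integral {real N..real (Suc N)} f) \<le> C * exp (- real N) * (real (Suc N) - real N)"
    proof (rule integral_bound)
      fix t assume "t \<in> {real N..real (Suc N)}"
      then have "C * exp (- \<bar>t\<bar>) \<le> C * exp (- real N)" using C by (intro mult_left_mono) auto
      with bound[of t] show "cmod (f t) \<le> C * exp (- real N)" by simp
    qed (auto intro: continuous_on_subset[OF cont])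
    ultimately have "cmod (F (Suc N) - F N) \<le> C * exp (- real N) + C * exp (- real N)"
      using norm_triangle_ineq[of "integral {- real (Suc N)..- real N} f" "integral {real N..real (Suc N)} f"]
      by simp
    then show ?thesis unfolding e by simp
  qed
  then show "cmod (integral {- real (Suc N)..real (Suc N)} f - integral {- real N..real N} f)
      \<le> 2 * C * exp (-1) ^ N" unfolding F_def .
  have g: "(\<lambda>i. 2 * C * exp (-1) ^ i) sums (2 * C * (1 / (1 - exp (-1))))"
    by (intro sums_mult geometric_sums) simp
  have "F N = (\<Sum>i<N. F (Suc i) - F i)"
    by (subst sum_lessThan_telescope) (simp add: F_def)
  then have "cmod (F N) \<le> (\<Sum>i<N. 2 * C * exp (-1) ^ i)"
    using sum_norm_le[of "{..<N}" "\<lambda>i. F (Suc i) - F i" "\<lambda>i. 2 * C * exp (-1) ^ i"] step by simp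
  also have "\<dots> \<le> (\<Sum>i. 2 * C * exp (-1) ^ i)"
    using C by (intro sum_le_suminf sums_summable[OF g]) auto
  also have "\<dots> = 2 * C / (1 - exp (-1))" using sums_unique[OF g] by simp
  finally show "cmod (integral {- real N..real N} f) \<le> 2 * C / (1 - exp (-1))" by (simp add: F_def)
qed

section \<open>Moments as integrals along rotated rays\<close>

context moment_kernel
begin

lemma eh_ray_continuous: "\<bar>\<tau>\<bar> < \<omega> * pi / 2 \<Longrightarrow> continuous_on S (\<lambda>x. eh (Complex x \<tau>))"
  by (rule continuous_on_compose2[OF holomorphic_on_imp_continuous_on[OF eh_holomorphic]])
    (auto simp: estrip_def intro!: continuous_intros)

text \<open>The moment is expressed by boundary values of a primitive, because these can be compared
  with the boundary values on another ray.\<close>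

lemma moment_limit:
  assumes P: "\<And>z. z \<in> estrip \<Longrightarrow> (P has_field_derivative eh z * exp (of_nat p * z)) (at z)"
  shows "(\<lambda>N. P (of_nat N) - P (- of_nat N)) \<longlonglongrightarrow> of_real (n (Suc p))"
proof -
  define f where "f t = complex_of_real t powr (of_nat (Suc p) - 1) * e (complex_of_real t)" for t :: real
  define A where "A N = {exp (- real N)..exp (real N)}" for N :: nat
  have n: "of_real (n (Suc p)) = (LINT t:{0<..}|lborel. f t)"
    unfolding moments moment_fun_def f_def ..
  \<comment> \<open>The Lebesgue integral of a non-integrable function is 0 by convention, so a
    nonzero moment already forces integrability.\<close>
  then have int: "set_integrable lborel {0<..} f"
    using n_nonzero[of "Suc p"] not_integrable_integral_eq
    unfolding set_integrable_def set_lebesgue_integral_def by (metis of_real_eq_0_iff)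
  have U: "(\<Union>N. A N) = {0<..}"
  proof (intro equalityI subsetI)
    fix t :: real assume t: "t \<in> {0<..}"
    obtain N where N: "\<bar>ln t\<bar> \<le> real N" using real_arch_simple by blast
    then have "exp (- real N) \<le> exp (ln t)" "exp (ln t) \<le> exp (real N)" by auto
    with t show "t \<in> (\<Union>N. A N)" by (auto simp: A_def)
  qed (auto simp: A_def intro: less_le_trans[OF exp_gt_zero])
  have "(\<lambda>N. LINT t:A N|lborel. f t) \<longlonglongrightarrow> (LINT t:(\<Union>N. A N)|lborel. f t)"
  proof (rule set_integral_cont_up)
    show "incseq A" unfolding A_def by (intro monoI) auto
    show "set_integrable lborel (\<Union>N. A N) f" unfolding U by (rule int)
  qed (simp add: A_def)
  also have "(\<lambda>N. LINT t:A N|lborel. f t) = (\<lambda>N. P (of_nat N) - P (- of_nat N))"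
  proof
    fix N
    have "set_integrable lborel (A N) f"
      by (rule set_integrable_subset[OF int]) (auto simp: A_def intro: less_le_trans[OF exp_gt_zero])
    then have "(LINT t:A N|lborel. f t) = integral (A N) f"
      by (rule set_borel_integral_eq_integral)
    also have "\<dots> = P (of_real (ln (exp (real N)))) - P (of_real (ln (exp (- real N))))"
      unfolding A_def
    proof (rule integral_unique, rule fundamental_theorem_of_calculus)
      fix t :: real assume "t \<in> {exp (- real N)..exp (real N)}"
      then have t: "t > 0" by (auto intro: less_le_trans[OF exp_gt_zero])
      have "of_real (ln t) \<in> estrip" using \<omega>_pos by (simp add: estrip_def)
      note P' = P[OF this]
      have "eh (of_real (ln t)) * exp (of_nat p * of_real (ln t)) = of_real t ^ Suc p * e (of_real t)"
        using t by (simp add: eh_def exp_of_nat_mult exp_of_real ac_simps)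
      moreover have "complex_of_real t powr of_nat p = of_real t ^ p"
        using t by (simp add: powr_nat')
      ultimately have f: "(1 / t) *\<^sub>R (eh (of_real (ln t)) * exp (of_nat p * of_real (ln t))) = f t"
        using t by (simp add: f_def scaleR_conv_of_real)
      have "((\<lambda>x. P (of_real x)) has_vector_derivative (eh (of_real (ln t)) * exp (of_nat p * of_real (ln t)))) (at (ln t))"
        by (rule has_vector_derivative_real_field[OF P'])
      moreover have "(ln has_vector_derivative (1 / t)) (at t)"
        using t by (simp add: has_real_derivative_iff_has_vector_derivative[symmetric] DERIV_ln_divide)
      ultimately have "((\<lambda>x. P (of_real x)) \<circ> ln has_vector_derivative
          (1 / t) *\<^sub>R (eh (of_real (ln t)) * exp (of_nat p * of_real (ln t)))) (at t)"
        by (intro vector_diff_chain_at)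
      then show "((\<lambda>t. P (of_real (ln t))) has_vector_derivative f t) (at t within {exp (- real N)..exp (real N)})"
        unfolding f o_def by (rule has_vector_derivative_at_within)
    qed simp
    also have "\<dots> = P (of_nat N) - P (- of_nat N)" by simp
    finally show "(LINT t:A N|lborel. f t) = P (of_nat N) - P (- of_nat N)" .
  qed
  finally show ?thesis unfolding U n .
qed

text \<open>Rotation of the ray: a primitive exists on the convex strip, so the integral at height
  \<tau> and the one at height 0 differ only by boundary terms, which tend to 0.\<close>

lemma ray_moment:
  assumes "\<bar>\<tau>\<bar> < \<omega> * pi / 2"
  shows "(\<lambda>N. integral {- real N..real N} (\<lambda>x. eh (Complex x \<tau>) * exp (of_nat p * Complex x \<tau>)))
    \<longlonglongrightarrow> of_real (n (Suc p))"
proof -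
  define g where "g z = eh z * exp (of_nat p * z)" for z
  have "g holomorphic_on estrip"
    unfolding g_def by (intro holomorphic_intros eh_holomorphic)
  then obtain P where P: "\<And>z. z \<in> estrip \<Longrightarrow> (P has_field_derivative g z) (at z)"
    using holomorphic_convex_primitive'[OF convex_estrip open_estrip, of g] at_within_open[OF _ open_estrip]
    by metis
  obtain c k where ck: "c > 0" "k > 0" "\<And>x p. \<bar>Im x\<bar> \<le> \<bar>\<tau>\<bar> \<Longrightarrow> cmod (eh x * exp (of_nat p * x))
       \<le> c * (k ^ p * M p + k ^ (p + 2) * M (p + 2)) * exp (- \<bar>Re x\<bar>)"
    using eh_bound[OF assms] by blast
  define C where "C = c * (k ^ p * M p + k ^ (p + 2) * M (p + 2))"
  have gC: "cmod (g x) \<le> C * exp (- \<bar>Re x\<bar>)" if "\<bar>Im x\<bar> \<le> \<bar>\<tau>\<bar>" for x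
    using ck(3)[OF that, of p] by (simp add: g_def C_def)
  have J: "integral {- real N..real N} (\<lambda>x. g (Complex x \<tau>)) = P (Complex N \<tau>) - P (Complex (- real N) \<tau>)" for N :: nat
  proof (rule integral_unique, rule fundamental_theorem_of_calculus)
    fix x
    have "((\<lambda>z. P (z + \<i> * of_real \<tau>)) has_field_derivative g (of_real x + \<i> * of_real \<tau>) * 1) (at (of_real x))"
      using assms by (intro DERIV_chain2[OF P]) (auto simp: estrip_def intro!: derivative_eq_intros)
    from has_vector_derivative_real_field[OF this]
    show "((\<lambda>x. P (Complex x \<tau>)) has_vector_derivative g (Complex x \<tau>)) (at x within {- real N..real N})"
      unfolding Complex_eq mult_1_right by (rule has_vector_derivative_at_within)
  qed simp
  \<comment> \<open>The mean value bound on the vertical segment from the real axis to height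
    \<tau>, where the integrand is already of size exp (- |X|).\<close>
  have close: "cmod (P (Complex X \<tau>) - P (of_real X)) \<le> C * \<bar>\<tau>\<bar> * exp (- \<bar>X\<bar>)" for X
  proof -
    have s: "closed_segment (Complex X \<tau>) (of_real X) \<subseteq> {z. Re z = X \<and> \<bar>Im z\<bar> \<le> \<bar>\<tau>\<bar>}"
    proof (rule closed_segment_subset)
      have "{z. Re z = X \<and> \<bar>Im z\<bar> \<le> \<bar>\<tau>\<bar>} = cbox (Complex X (- \<bar>\<tau>\<bar>)) (Complex X \<bar>\<tau>\<bar>)"
        by (auto simp: in_cbox_complex_iff)
      then show "convex {z. Re z = X \<and> \<bar>Im z\<bar> \<le> \<bar>\<tau>\<bar>}" by simp
    qed auto
    have "cmod (P (Complex X \<tau>) - P (of_real X)) \<le> (C * exp (- \<bar>X\<bar>)) * cmod (Complex X \<tau> - of_real X)"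
    proof (rule field_differentiable_bound[OF convex_closed_segment])
      fix z assume "z \<in> closed_segment (Complex X \<tau>) (of_real X)"
      with s have z: "Re z = X" "\<bar>Im z\<bar> \<le> \<bar>\<tau>\<bar>" by auto
      then have "z \<in> estrip" using assms by (simp add: estrip_def)
      from P[OF this] show "(P has_field_derivative g z) (at z within closed_segment (Complex X \<tau>) (of_real X))"
        by (rule has_field_derivative_at_within)
      show "cmod (g z) \<le> C * exp (- \<bar>X\<bar>)" using gC[OF z(2)] z by simp
    qed auto
    also have "cmod (Complex X \<tau> - of_real X) = \<bar>\<tau>\<bar>" by (simp add: cmod_def)
    finally show ?thesis by (simp add: ac_simps)
  qed
  have "(\<lambda>N. exp (- real N)) \<longlonglongrightarrow> 0"
    using filterlim_compose[OF exp_at_bot filterlim_compose[OF filterlim_uminus_at_bot_at_top filterlim_real_sequentially]] .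
  then have e0: "(\<lambda>N. C * \<bar>\<tau>\<bar> * exp (- real N)) \<longlonglongrightarrow> 0"
    by (rule tendsto_mult_right_zero)
  have l1: "(\<lambda>N. P (Complex (real N) \<tau>) - P (of_nat N)) \<longlonglongrightarrow> 0"
    by (rule Lim_null_comparison[OF _ e0]) (use close[of "real _"] in auto)
  have l2: "(\<lambda>N. P (Complex (- real N) \<tau>) - P (- of_nat N)) \<longlonglongrightarrow> 0"
    by (rule Lim_null_comparison[OF _ e0]) (use close[of "- real _"] in auto)
  have l3: "(\<lambda>N. P (of_nat N) - P (- of_nat N)) \<longlonglongrightarrow> of_real (n (Suc p))"
    by (rule moment_limit) (use P in \<open>simp add: g_def\<close>)
  have "(\<lambda>N. (P (Complex (real N) \<tau>) - P (of_nat N)) - (P (Complex (- real N) \<tau>) - P (- of_nat N)) +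
      (P (of_nat N) - P (- of_nat N))) \<longlonglongrightarrow> 0 - 0 + of_real (n (Suc p))"
    by (intro tendsto_intros l1 l2 l3)
  then show ?thesis unfolding g_def[symmetric] J by (simp add: algebra_simps)
qed

text \<open>(mg) compares M_(p+2) with M_p, which then cancels against the bound for
  \<open>1 / n p\<close>; what remains is geometric in p. This is the source of a positive radius of
  convergence for the series of \<open>K\<close>.\<close>

lemma ray_moment_bound:
  assumes "\<bar>\<tau>\<bar> < \<omega> * pi / 2"
  obtains B Q where "B > 0" "Q > 0"
    "\<And>p x. cmod (eh (Complex x \<tau>) * exp (of_nat p * Complex x \<tau>)) / \<bar>n p\<bar> \<le> B * Q ^ p * exp (- \<bar>x\<bar>)"
proof -
  obtain c k where ck: "c > 0" "k > 0" "\<And>x p. \<bar>Im x\<bar> \<le> \<bar>\<tau>\<bar> \<Longrightarrow> cmod (eh x * exp (of_nat p * x))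
       \<le> c * (k ^ p * M p + k ^ (p + 2) * M (p + 2)) * exp (- \<bar>Re x\<bar>)"
    using eh_bound[OF assms] by blast
  obtain c' k' where ck': "c' > 0" "k' > 0" "\<And>p. 1 / \<bar>n p\<bar> \<le> c' / (k' ^ p * M p)"
    using inverse_moment_bound by blast
  obtain A where A: "A > 0" "\<And>p q. M (p + q) \<le> A ^ (p + q) * M p * M q"
    using strongly_regular_mg[OF sr] by blast
  note pos = strongly_regular_pos[OF sr]
  \<comment> \<open>Raising the constant to at least 1 lets the summand without a factor A^p be
    multiplied by A'^p as well.\<close>
  define A' where "A' = max 1 A"
  have A': "A' \<ge> 1" "A \<le> A'" by (auto simp: A'_def)
  define B where "B = c * c' * (1 + k\<^sup>2 * A\<^sup>2 * M 2)"
  define Q where "Q = k / k' * A'"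
  have le: "c * (k ^ p * M p + k ^ (p + 2) * M (p + 2)) * (c' / (k' ^ p * M p)) \<le> B * Q ^ p" for p
  proof -
    have pA: "A ^ (p + 2) \<le> A' ^ p * A\<^sup>2"
      unfolding power_add using A A' by (intro mult_right_mono power_mono) auto
    have "k ^ p * M p + k ^ (p + 2) * M (p + 2) \<le> k ^ p * M p * A' ^ p + k ^ (p + 2) * (A ^ (p + 2) * M p * M 2)"
      using A(2)[of p 2] pos[of p] ck A' by (intro add_mono mult_left_mono) auto
    also have "\<dots> \<le> k ^ p * M p * A' ^ p + k ^ (p + 2) * ((A' ^ p * A\<^sup>2) * M p * M 2)"
      using pA A A' pos[of p] pos[of 2] ck by (intro add_mono mult_left_mono mult_right_mono order.refl) auto
    also have "\<dots> = (k * A') ^ p * M p * (1 + k\<^sup>2 * A\<^sup>2 * M 2)"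
      by (simp add: power_add power_mult_distrib algebra_simps power2_eq_square)
    finally have "c * (k ^ p * M p + k ^ (p + 2) * M (p + 2)) * (c' / (k' ^ p * M p)) \<le>
        c * ((k * A') ^ p * M p * (1 + k\<^sup>2 * A\<^sup>2 * M 2)) * (c' / (k' ^ p * M p))"
      using ck ck' pos[of p] by (intro mult_right_mono mult_left_mono) auto
    also have "\<dots> = B * Q ^ p"
      using pos[of p] ck' by (simp add: B_def Q_def power_mult_distrib power_divide field_simps)
    finally show ?thesis .
  qed
  show ?thesis
  proof (rule that)
    show "B > 0" using ck ck' A pos[of 2] by (simp add: B_def add_pos_pos)
    show "Q > 0" using ck ck' A' by (simp add: Q_def)
    fix p x
    have "cmod (eh (Complex x \<tau>) * exp (of_nat p * Complex x \<tau>)) / \<bar>n p\<bar> =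
      cmod (eh (Complex x \<tau>) * exp (of_nat p * Complex x \<tau>)) * (1 / \<bar>n p\<bar>)" by simp
    also have "\<dots> \<le> (c * (k ^ p * M p + k ^ (p + 2) * M (p + 2)) * exp (- \<bar>x\<bar>)) * (c' / (k' ^ p * M p))"
      using ck(3)[of "Complex x \<tau>" p] ck ck' pos[of p] pos[of "p + 2"] by (intro mult_mono) (auto simp: less_imp_le add_nonneg_nonneg)
    also have "\<dots> \<le> B * Q ^ p * exp (- \<bar>x\<bar>)"
      using mult_right_mono[OF le[of p], of "exp (- \<bar>x\<bar>)"] by (simp add: ac_simps)
    finally show "cmod (eh (Complex x \<tau>) * exp (of_nat p * Complex x \<tau>)) / \<bar>n p\<bar> \<le> B * Q ^ p * exp (- \<bar>x\<bar>)" .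
  qed
qed

end

text \<open>The identity theorem in the log coordinate, where a punctured neighbourhood of 0 appears
  as a left half-plane. Convexity of \<open>A\<close> stands for connectedness.\<close>

lemma holomorphic_eq_on_half_strip:
  assumes "f holomorphic_on A" "g holomorphic_on A" "open A" "convex A"
    and "\<And>u. u \<in> A \<Longrightarrow> Re u < R \<Longrightarrow> f u = g u"
    and "w \<in> A" "Re w < R" "z \<in> A"
  shows "f z = g z"
proof (rule analytic_continuation_open[where f=f and g=g])
  show "open (A \<inter> {u. Re u < R})" by (intro open_Int assms open_halfspace_Re_lt)
  show "A \<inter> {u. Re u < R} \<noteq> {}" using assms by auto
qed (use assms in \<open>auto intro: convex_connected\<close>)

lemma abs_Im_less_strip:
  "open {u. \<bar>Im u + c\<bar> < r}" "convex {u. \<bar>Im u + c\<bar> < r}"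
proof -
  have *: "{u. \<bar>Im u + c\<bar> < r} = {u. Im u < r - c} \<inter> {u. Im u > - r - c}" by auto
  show "open {u. \<bar>Im u + c\<bar> < r}" unfolding * by (intro open_Int open_halfspace_Im_lt open_halfspace_Im_gt)
  show "convex {u. \<bar>Im u + c\<bar> < r}" unfolding * by (intro convex_Int convex_halfspace_Im_lt convex_halfspace_Im_gt)
qed

section \<open>Continuation of the Hadamard kernel to the slit plane\<close>

context moment_kernel
begin

text \<open>Supremum of the half-openings around the direction pi on which \<open>E\<close> is
  bounded.\<close>

definition \<delta> :: real where "\<delta> = pi - \<omega> * pi / 2"

text \<open>With z = exp u and \<xi> = exp (x + \<i> \<tau>) this is the integral of E (z \<xi>) e
  \<xi> d\<xi> over a piece of the ray of argument \<tau>.\<close>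

definition kN :: "real \<Rightarrow> nat \<Rightarrow> complex \<Rightarrow> complex" where
  "kN \<tau> N u = integral {- real N..real N} (\<lambda>x. E (exp (u + Complex x \<tau>)) * eh (Complex x \<tau>))"

text \<open>The limit of \<open>kN \<tau> N\<close> for N to infinity, written as a telescoping
  series so that the M-test applies.\<close>

definition kap :: "real \<Rightarrow> complex \<Rightarrow> complex" where
  "kap \<tau> u = (\<Sum>N. kN \<tau> (Suc N) u - kN \<tau> N u)"

definition l :: "nat \<Rightarrow> complex" where "l p = of_real (n (Suc p) / n p)"

lemma E_exp_holomorphic: "(\<lambda>z. E (exp z)) holomorphic_on A"
  using holomorphic_on_compose_gen[OF holomorphic_on_exp E_holomorphic[of UNIV], of A]
  by (simp add: o_def)

lemma integrand_continuous:
  assumes "\<bar>\<tau>\<bar> < \<omega> * pi / 2"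
  shows "continuous_on S (\<lambda>x. E (exp (u + Complex x \<tau>)) * eh (Complex x \<tau>))"
  by (intro continuous_intros eh_ray_continuous[OF assms]
      continuous_on_compose2[OF holomorphic_on_imp_continuous_on[OF E_exp_holomorphic[of UNIV]]]) auto

lemma kN_holomorphic:
  assumes "\<bar>\<tau>\<bar> < \<omega> * pi / 2"
  shows "kN \<tau> N holomorphic_on A"
proof -
  have "(\<lambda>v. integral {- real N..real N} (\<lambda>t. E (exp (v - (- Complex t \<tau>))) *\<^sub>C eh (Complex t \<tau>)))
     vec_holomorphic_on UNIV"
    by (rule vec_holomorphic_on_convolution[OF open_UNIV E_exp_holomorphic])
      (auto intro!: continuous_intros eh_ray_continuous[OF assms])
  then have "kN \<tau> N holomorphic_on UNIV"
    by (simp add: vec_holomorphic_on_complex scaleC_complex_def kN_def[abs_def])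
  then show ?thesis by (rule holomorphic_on_subset) simp
qed

text \<open>The argument of z \<xi> is Im u + \<tau>, so \<open>E\<close> is bounded on the ray
  exactly under the condition on Im u + \<tau> - pi. One \<open>C\<close> serves all directions up
  to \<tau>_m: the final kernel changes its ray with u and still needs a uniform bound.\<close>

lemma kap_uniform_limit:
  assumes "\<tau>\<^sub>m < \<omega> * pi / 2" "0 \<le> \<eta>" "\<eta> < \<delta>"
  obtains C where
    "\<And>\<tau>. \<bar>\<tau>\<bar> \<le> \<tau>\<^sub>m \<Longrightarrow> uniform_limit {u. \<bar>Im u + \<tau> - pi\<bar> \<le> \<eta>} (kN \<tau>) (kap \<tau>) sequentially"
    "\<And>\<tau> u. \<bar>\<tau>\<bar> \<le> \<tau>\<^sub>m \<Longrightarrow> \<bar>Im u + \<tau> - pi\<bar> \<le> \<eta> \<Longrightarrow> cmod (kap \<tau> u) \<le> C"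
proof -
  obtain B where B: "B \<ge> 0" "\<And>w. \<bar>Im w - pi\<bar> \<le> \<eta> \<Longrightarrow> cmod (E (exp w)) \<le> B"
    using E_bounded[OF assms(2)] assms(3) unfolding \<delta>_def by blast
  obtain c k where ck: "c > 0" "k > 0" "\<And>x p. \<bar>Im x\<bar> \<le> \<tau>\<^sub>m \<Longrightarrow> cmod (eh x * exp (of_nat p * x))
       \<le> c * (k ^ p * M p + k ^ (p + 2) * M (p + 2)) * exp (- \<bar>Re x\<bar>)"
    using eh_bound[OF assms(1)] by blast
  define C0 where "C0 = c * (k ^ 0 * M 0 + k ^ (0 + 2) * M (0 + 2))"
  have C0: "cmod (eh x) \<le> C0 * exp (- \<bar>Re x\<bar>)" if "\<bar>Im x\<bar> \<le> \<tau>\<^sub>m" for x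
    using ck(3)[OF that, of 0] by (simp add: C0_def)
  let ?f = "\<lambda>\<tau> u x. E (exp (u + Complex x \<tau>)) * eh (Complex x \<tau>)"
  have f: "cmod (?f \<tau> u x) \<le> B * C0 * exp (- \<bar>x\<bar>)" if "\<bar>\<tau>\<bar> \<le> \<tau>\<^sub>m" "\<bar>Im u + \<tau> - pi\<bar> \<le> \<eta>" for \<tau> u x
    unfolding norm_mult mult.assoc
    using B(2)[of "u + Complex x \<tau>"] C0[of "Complex x \<tau>"] that B(1) by (intro mult_mono) auto
  define C where "C = 2 * (B * C0) / (1 - exp (-1))"
  have g: "summable (\<lambda>i. 2 * (B * C0) * exp (-1) ^ i)"
    by (intro summable_mult summable_geometric) simp
  have ul: "uniform_limit {u. \<bar>Im u + \<tau> - pi\<bar> \<le> \<eta>} (kN \<tau>) (kap \<tau>) sequentially" if t: "\<bar>\<tau>\<bar> \<le> \<tau>\<^sub>m" for \<tau>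
  proof -
    have t': "\<bar>\<tau>\<bar> < \<omega> * pi / 2" using t assms by simp
    have "uniform_limit {u. \<bar>Im u + \<tau> - pi\<bar> \<le> \<eta>} (\<lambda>N u. \<Sum>i<N. kN \<tau> (Suc i) u - kN \<tau> i u)
      (\<lambda>u. \<Sum>i. kN \<tau> (Suc i) u - kN \<tau> i u) sequentially"
    proof (rule Weierstrass_m_test[OF _ g])
      fix N u assume "u \<in> {u. \<bar>Im u + \<tau> - pi\<bar> \<le> \<eta>}"
      then show "cmod (kN \<tau> (Suc N) u - kN \<tau> N u) \<le> 2 * (B * C0) * exp (-1) ^ N"
        unfolding kN_def by (intro symmetric_integral_step integrand_continuous[OF t'] f[OF t]) simp
    qed
    also have "(\<lambda>N u. \<Sum>i<N. kN \<tau> (Suc i) u - kN \<tau> i u) = kN \<tau>"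
    proof (intro ext)
      fix N u
      have "kN \<tau> 0 u = 0" by (simp add: kN_def)
      then show "(\<Sum>i<N. kN \<tau> (Suc i) u - kN \<tau> i u) = kN \<tau> N u"
        using sum_lessThan_telescope[of "\<lambda>i. kN \<tau> i u" N] by simp
    qed
    finally show ?thesis unfolding kap_def[abs_def] .
  qed
  show ?thesis
  proof (rule that[of C, OF ul])
    fix \<tau> u assume t: "\<bar>\<tau>\<bar> \<le> \<tau>\<^sub>m" "\<bar>Im u + \<tau> - pi\<bar> \<le> \<eta>"
    then have t': "\<bar>\<tau>\<bar> < \<omega> * pi / 2" using assms by simp
    have "(\<lambda>N. kN \<tau> N u) \<longlonglongrightarrow> kap \<tau> u"
      by (rule tendsto_uniform_limitI[OF ul[OF t(1)]]) (use t in simp)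
    then have "(\<lambda>N. cmod (kN \<tau> N u)) \<longlonglongrightarrow> cmod (kap \<tau> u)" by (rule tendsto_norm)
    then show "cmod (kap \<tau> u) \<le> C"
    proof (rule LIMSEQ_le_const2, intro exI allI impI)
      fix N show "cmod (kN \<tau> N u) \<le> C"
        unfolding kN_def C_def by (intro symmetric_integral_bound integrand_continuous[OF t'] f[OF t])
    qed
  qed simp_all
qed

lemma kN_tendsto_kap:
  assumes "\<bar>\<tau>\<bar> < \<omega> * pi / 2" "\<bar>Im u + \<tau> - pi\<bar> < \<delta>"
  shows "(\<lambda>N. kN \<tau> N u) \<longlonglongrightarrow> kap \<tau> u"
proof -
  have "uniform_limit {v. \<bar>Im v + \<tau> - pi\<bar> \<le> \<bar>Im u + \<tau> - pi\<bar>} (kN \<tau>) (kap \<tau>) sequentially"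
    by (rule kap_uniform_limit[of "\<bar>\<tau>\<bar>" "\<bar>Im u + \<tau> - pi\<bar>"]) (use assms in auto)
  then show ?thesis by (rule tendsto_uniform_limitI) simp
qed

lemma kap_holomorphic:
  assumes "\<bar>\<tau>\<bar> < \<omega> * pi / 2"
  shows "kap \<tau> holomorphic_on {u. \<bar>Im u + (\<tau> - pi)\<bar> < \<delta>}"
proof (rule holomorphic_uniform_sequence[OF abs_Im_less_strip(1)])
  show "kN \<tau> N holomorphic_on {u. \<bar>Im u + (\<tau> - pi)\<bar> < \<delta>}" for N by (rule kN_holomorphic[OF assms])
  fix u assume u: "u \<in> {u. \<bar>Im u + (\<tau> - pi)\<bar> < \<delta>}"
  define d where "d = (\<delta> - \<bar>Im u + \<tau> - pi\<bar>) / 2"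
  have d: "d > 0" "d < \<delta>" using u by (auto simp: d_def)
  have sub: "cball u d \<subseteq> {v. \<bar>Im v + \<tau> - pi\<bar> \<le> \<delta> - d}"
  proof
    fix v assume "v \<in> cball u d"
    then have "\<bar>Im (u - v)\<bar> \<le> d" using abs_Im_le_cmod[of "u - v"] by (simp add: dist_norm)
    moreover have "\<bar>Im v + \<tau> - pi\<bar> \<le> \<bar>Im u + \<tau> - pi\<bar> + \<bar>Im (u - v)\<bar>" by (simp add: abs_if)
    moreover have "\<bar>Im u + \<tau> - pi\<bar> = \<delta> - 2 * d" unfolding d_def by (simp add: field_simps)
    ultimately have "\<bar>Im v + \<tau> - pi\<bar> \<le> \<delta> - d" by linarith
    then show "v \<in> {v. \<bar>Im v + \<tau> - pi\<bar> \<le> \<delta> - d}" by simp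
  qed
  have "uniform_limit {v. \<bar>Im v + \<tau> - pi\<bar> \<le> \<delta> - d} (kN \<tau>) (kap \<tau>) sequentially"
    by (rule kap_uniform_limit[of "\<bar>\<tau>\<bar>" "\<delta> - d"]) (use assms d in auto)
  then have "uniform_limit (cball u d) (kN \<tau>) (kap \<tau>) sequentially"
    by (rule uniform_limit_on_subset) (rule sub)
  then show "\<exists>d>0. cball u d \<subseteq> {u. \<bar>Im u + (\<tau> - pi)\<bar> < \<delta>} \<and> uniform_limit (cball u d) (kN \<tau>) (kap \<tau>) sequentially"
    using d sub by (intro exI[of _ d]) auto
qed

text \<open>For a truncated ray the expansion of \<open>E\<close> may be integrated term by term,
  which replaces the moments by truncated ones; the truncation is then removed inside the
  sum.\<close>

lemma kap_eq_psum:
  assumes t: "\<bar>\<tau>\<bar> < \<omega> * pi / 2"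
  obtains s B where "s > 0" "\<And>p. cmod (l p) * s ^ p \<le> B"
    "\<And>u. exp (Re u) < s \<Longrightarrow> \<bar>Im u + \<tau> - pi\<bar> < \<delta> \<Longrightarrow> kap \<tau> u = psum l (exp u)"
proof -
  obtain B Q where BQ: "B > 0" "Q > 0"
    "\<And>p x. cmod (eh (Complex x \<tau>) * exp (of_nat p * Complex x \<tau>)) / \<bar>n p\<bar> \<le> B * Q ^ p * exp (- \<bar>x\<bar>)"
    using ray_moment_bound[OF t] by blast
  define K where "K = 2 * B / (1 - exp (-1))"
  define h where "h p x = eh (Complex x \<tau>) * exp (of_nat p * Complex x \<tau>) / of_real (n p)" for p x
  define J where "J p N = integral {- real N..real N} (h p)" for p N
  have hc: "continuous_on S (h p)" for S p
    unfolding h_def using n_nonzero by (intro continuous_intros eh_ray_continuous[OF t]) auto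
  have hb: "cmod (h p x) \<le> B * Q ^ p * exp (- \<bar>x\<bar>)" for p x
    using BQ(3)[where p=p and x=x] by (simp add: h_def norm_divide)
  have Jb: "cmod (J p N) \<le> K * Q ^ p" for p N
    unfolding J_def
    by (rule order.trans[OF symmetric_integral_bound[OF hc[of _ p] hb[of p]]]) (simp add: K_def ac_simps)
  have Jl: "J p \<longlonglongrightarrow> l p" for p
    unfolding J_def[abs_def] h_def l_def of_real_divide integral_divide
    using n_nonzero by (intro tendsto_divide ray_moment[OF t] tendsto_const) auto
  have lb: "cmod (l p) \<le> K * Q ^ p" for p
    by (rule LIMSEQ_le_const2[OF tendsto_norm[OF Jl]]) (use Jb in blast)
  show ?thesis
  proof (rule that[of "1 / Q" K])
    show "1 / Q > 0" using BQ by simp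
    show "cmod (l p) * (1 / Q) ^ p \<le> K" for p
      using lb[of p] BQ by (simp add: power_divide field_simps)
    fix u assume u: "exp (Re u) < 1 / Q" "\<bar>Im u + \<tau> - pi\<bar> < \<delta>"
    define q where "q = exp (Re u) * Q"
    have q: "0 \<le> q" "q < 1" using u BQ by (auto simp: q_def field_simps)
    have eu: "cmod (exp u ^ p) * Q ^ p = q ^ p" for p by (simp add: norm_power q_def power_mult_distrib)
    have kN: "(\<lambda>p. exp u ^ p * J p N) sums kN \<tau> N u" for N
    proof -
      let ?g = "\<lambda>p x. exp u ^ p * h p x"
      have "(\<lambda>p. integral {- real N..real N} (?g p)) sums integral {- real N..real N} (\<lambda>x. \<Sum>p. ?g p x)"
      proof (rule integral_sums_uniform)
        show "continuous_on {- real N..real N} (?g p)" for p by (intro continuous_intros hc)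
        show "norm (?g p x) \<le> B * q ^ p" for p x
        proof -
          have "cmod (h p x) \<le> B * Q ^ p * 1"
            using BQ by (intro order.trans[OF hb] mult_left_mono) auto
          then have "cmod (exp u ^ p) * cmod (h p x) \<le> cmod (exp u ^ p) * (B * Q ^ p * 1)"
            by (rule mult_left_mono) simp
          also have "\<dots> = B * q ^ p" using eu[of p] by (simp add: ac_simps)
          finally show ?thesis by (simp add: norm_mult)
        qed
        show "summable (\<lambda>p. B * q ^ p)" using q by (intro summable_mult summable_geometric) auto
      qed
      also have "(\<lambda>x. \<Sum>p. ?g p x) = (\<lambda>x. E (exp (u + Complex x \<tau>)) * eh (Complex x \<tau>))"
      proof
        fix x
        have "?g p x = exp (u + Complex x \<tau>) ^ p / of_real (n p) * eh (Complex x \<tau>)" for p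
          by (simp add: h_def exp_add power_mult_distrib exp_of_nat_mult)
        then show "(\<Sum>p. ?g p x) = E (exp (u + Complex x \<tau>)) * eh (Complex x \<tau>)"
          using sums_mult2[OF E_sums[of "exp (u + Complex x \<tau>)"], of "eh (Complex x \<tau>)"]
          by (simp add: sums_iff)
      qed
      finally show ?thesis by (simp add: J_def kN_def integral_mult_right)
    qed
    \<comment> \<open>Tannery's theorem: the truncated quotients are dominated by K Q^p uniformly in
      N, and q = |exp u| Q < 1.\<close>
    have "(\<lambda>N. \<Sum>p. exp u ^ p * J p N) \<longlonglongrightarrow> (\<Sum>p. exp u ^ p * l p)"
    proof (rule tannerys_theorem[THEN conjunct2, THEN conjunct2])
      show "((\<lambda>N. exp u ^ p * J p N) \<longlonglongrightarrow> exp u ^ p * l p)" for p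
        by (intro tendsto_intros Jl)
      show "\<forall>\<^sub>F (p, N) in at_top \<times>\<^sub>F sequentially. norm (exp u ^ p * J p N) \<le> K * q ^ p"
      proof (rule always_eventually, clarify)
        fix p N
        have "cmod (exp u ^ p) * cmod (J p N) \<le> cmod (exp u ^ p) * (K * Q ^ p)"
          by (rule mult_left_mono[OF Jb]) simp
        also have "\<dots> = K * q ^ p" using eu[of p] by (simp add: ac_simps)
        finally show "norm (exp u ^ p * J p N) \<le> K * q ^ p" by (simp add: norm_mult)
      qed
      show "summable (\<lambda>p. K * q ^ p)" using q by (intro summable_mult summable_geometric) auto
    qed simp
    moreover have "(\<Sum>p. exp u ^ p * J p N) = kN \<tau> N u" for N using kN[of N] by (simp add: sums_iff)
    ultimately have "(\<lambda>N. kN \<tau> N u) \<longlonglongrightarrow> psum l (exp u)"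
      by (simp add: psum_def scaleC_complex_def)
    with kN_tendsto_kap[OF t u(2)] show "kap \<tau> u = psum l (exp u)" by (rule LIMSEQ_unique)
  qed
qed

text \<open>Near z = 0 both rays give the same power series, and the common domain is an
  intersection of two strips, hence convex.\<close>

lemma kap_cong:
  assumes "\<bar>\<tau>\<bar> < \<omega> * pi / 2" "\<bar>\<tau>'\<bar> < \<omega> * pi / 2"
    and u: "\<bar>Im u + \<tau> - pi\<bar> < \<delta>" "\<bar>Im u + \<tau>' - pi\<bar> < \<delta>"
  shows "kap \<tau> u = kap \<tau>' u"
proof -
  obtain s where s: "s > 0" "\<And>u. exp (Re u) < s \<Longrightarrow> \<bar>Im u + \<tau> - pi\<bar> < \<delta> \<Longrightarrow> kap \<tau> u = psum l (exp u)"
    using kap_eq_psum[OF assms(1)] by metis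
  obtain s' where s': "s' > 0" "\<And>u. exp (Re u) < s' \<Longrightarrow> \<bar>Im u + \<tau>' - pi\<bar> < \<delta> \<Longrightarrow> kap \<tau>' u = psum l (exp u)"
    using kap_eq_psum[OF assms(2)] by metis
  define R where "R = ln (min s s')"
  have R: "exp R = min s s'" using s(1) s'(1) by (simp add: R_def)
  define A where "A = {u. \<bar>Im u + (\<tau> - pi)\<bar> < \<delta>} \<inter> {u. \<bar>Im u + (\<tau>' - pi)\<bar> < \<delta>}"
  show ?thesis
  proof (rule holomorphic_eq_on_half_strip[where f="kap \<tau>" and g="kap \<tau>'" and z=u and A=A and R=R and w="Complex (R - 1) (Im u)"])
    show "kap \<tau> holomorphic_on A"
      by (rule holomorphic_on_subset[OF kap_holomorphic[OF assms(1)]]) (simp add: A_def)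
    show "kap \<tau>' holomorphic_on A"
      by (rule holomorphic_on_subset[OF kap_holomorphic[OF assms(2)]]) (simp add: A_def)
    show "open A" unfolding A_def by (intro open_Int abs_Im_less_strip)
    show "convex A" unfolding A_def by (intro convex_Int abs_Im_less_strip)
    show "u \<in> A" "Complex (R - 1) (Im u) \<in> A" using u by (auto simp: A_def algebra_simps)
    fix v assume v: "v \<in> A" "Re v < R"
    then have "exp (Re v) < min s s'" unfolding R[symmetric] by simp
    then show "kap \<tau> v = kap \<tau>' v"
      using s(2)[of v] s'(2)[of v] v(1) by (simp add: A_def algebra_simps)
  qed simp
qed

text \<open>The integrals along different rays are glued: \<kappa> uses a ray that depends on Im u,
  yet near each point it coincides with the integral over one fixed ray, and is therefore
  holomorphic.\<close>

theorem summation_kernel: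
  obtains \<kappa> s B where "s > 0" "\<And>p. cmod (l p) * s ^ p \<le> B"
    "\<kappa> holomorphic_on {u. 0 < Im u \<and> Im u < 2 * pi}"
    "\<And>u. 0 < Im u \<Longrightarrow> Im u < 2 * pi \<Longrightarrow> exp (Re u) < s \<Longrightarrow> \<kappa> u = psum l (exp u)"
    "\<And>\<epsilon>. \<epsilon> > 0 \<Longrightarrow> \<exists>C. \<forall>u. \<epsilon> \<le> Im u \<and> Im u \<le> 2 * pi - \<epsilon> \<longrightarrow> cmod (\<kappa> u) \<le> C"
proof -
  \<comment> \<open>The rotation divides the deviation of the argument from pi in the ratio of the
    two available half-openings \<omega> pi / 2 and (1 - \<omega> / 2) pi. Both constraints are then
    violated only at the ends 0 and 2 pi.\<close>
  define T where "T y = (\<omega> / 2) * (pi - y)" for y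
  have T1: "\<bar>T y\<bar> = \<omega> / 2 * \<bar>y - pi\<bar>" for y
    using \<omega>_pos by (simp add: T_def abs_mult abs_minus_commute)
  have T2: "\<bar>y + T y - pi\<bar> = (1 - \<omega> / 2) * \<bar>y - pi\<bar>" for y
  proof -
    have "y + T y - pi = (1 - \<omega> / 2) * (y - pi)" by (simp add: T_def field_simps)
    then show ?thesis using index_less by (simp add: abs_mult)
  qed
  have \<delta>: "\<delta> = (1 - \<omega> / 2) * pi" by (simp add: \<delta>_def algebra_simps)
  have T: "\<bar>T y\<bar> < \<omega> * pi / 2" "\<bar>y + T y - pi\<bar> < \<delta>" if "0 < y" "y < 2 * pi" for y
  proof -
    have y: "\<bar>y - pi\<bar> < pi" using that by auto
    show "\<bar>T y\<bar> < \<omega> * pi / 2" unfolding T1 using y \<omega>_pos by simp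
    show "\<bar>y + T y - pi\<bar> < \<delta>" unfolding T2 \<delta> using y index_less by simp
  qed
  define \<kappa> where "\<kappa> u = kap (T (Im u)) u" for u
  \<comment> \<open>The radius is taken from the unrotated ray. Other rays may only yield a smaller
    radius, which is repaired below by the identity theorem on Re u < ln s.\<close>
  obtain s B where s: "s > 0" "\<And>p. cmod (l p) * s ^ p \<le> B"
    using kap_eq_psum[of 0] zero_less_mult_iff[of \<omega> pi] \<omega>_pos pi_gt_zero by (metis abs_zero half_gt_zero)
  show ?thesis
  proof (rule that[OF s])
    let ?S = "{u. 0 < Im u \<and> Im u < 2 * pi}"
    have S: "?S = {u. \<bar>Im u + (- pi)\<bar> < pi}" by auto
    have oS: "open ?S" unfolding S by (rule abs_Im_less_strip)
    show "\<kappa> holomorphic_on ?S"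
      unfolding holomorphic_on_open[OF oS]
    proof
      fix u assume u: "u \<in> ?S"
      define \<tau> where "\<tau> = T (Im u)"
      have \<tau>: "\<bar>\<tau>\<bar> < \<omega> * pi / 2" "\<bar>Im u + \<tau> - pi\<bar> < \<delta>" unfolding \<tau>_def using T[of "Im u"] u by auto
      let ?V = "{v. \<bar>Im v + (\<tau> - pi)\<bar> < \<delta>}"
      have uV: "u \<in> ?V" using \<tau> by (simp add: algebra_simps)
      have "(kap \<tau> has_field_derivative deriv (kap \<tau>) u) (at u)"
        by (rule holomorphic_derivI[OF kap_holomorphic[OF \<tau>(1)] abs_Im_less_strip(1) uV])
      then have "(\<kappa> has_field_derivative deriv (kap \<tau>) u) (at u)"
      proof (rule has_field_derivative_transform_within_open)
        show "open (?V \<inter> ?S)" by (intro open_Int oS abs_Im_less_strip)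
        show "u \<in> ?V \<inter> ?S" using u uV by simp
        fix v assume v: "v \<in> ?V \<inter> ?S"
        show "kap \<tau> v = \<kappa> v"
          unfolding \<kappa>_def by (rule kap_cong[OF \<tau>(1) T(1) _ T(2)]) (use v in \<open>auto simp: algebra_simps\<close>)
      qed
      then show "\<exists>f'. (\<kappa> has_field_derivative f') (at u)" ..
    qed
  next
    fix u assume u: "0 < Im u" "Im u < 2 * pi" "exp (Re u) < s"
    define \<tau> where "\<tau> = T (Im u)"
    have \<tau>: "\<bar>\<tau>\<bar> < \<omega> * pi / 2" "\<bar>Im u + \<tau> - pi\<bar> < \<delta>" unfolding \<tau>_def using T[OF u(1,2)] by auto
    obtain s' where s': "s' > 0" "\<And>u. exp (Re u) < s' \<Longrightarrow> \<bar>Im u + \<tau> - pi\<bar> < \<delta> \<Longrightarrow> kap \<tau> u = psum l (exp u)"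
      using kap_eq_psum[OF \<tau>(1)] by metis
    define A where "A = {u. \<bar>Im u + (\<tau> - pi)\<bar> < \<delta>} \<inter> {u. Re u < ln s}"
    define R where "R = min (ln s') (ln s)"
    have A: "exp (Re v) < s" if "v \<in> A" for v
    proof -
      have "exp (Re v) < exp (ln s)" using that by (simp add: A_def)
      then show ?thesis using s(1) by simp
    qed
    have "Re u < ln s" using u(3) s(1) by (metis exp_less_cancel_iff exp_ln)
    then have uA: "u \<in> A" using \<tau>(2) by (simp add: A_def algebra_simps)
    show "\<kappa> u = psum l (exp u)"
      unfolding \<kappa>_def \<tau>_def[symmetric]
    proof (rule holomorphic_eq_on_half_strip[where f="kap \<tau>" and g="\<lambda>u. psum l (exp u)" and z=u and A=A and R=R
          and w="Complex (R - 1) (Im u)"])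
      show "kap \<tau> holomorphic_on A"
        by (rule holomorphic_on_subset[OF kap_holomorphic[OF \<tau>(1)]]) (simp add: A_def)
      have "psum l holomorphic_on ball 0 s"
        using vec_holomorphic_psum[OF s(2,1)] by (simp add: vec_holomorphic_on_complex)
      moreover have "exp ` A \<subseteq> ball 0 s" using A by auto
      ultimately have "(psum l \<circ> exp) holomorphic_on A"
        by (rule holomorphic_on_compose_gen[OF holomorphic_on_exp])
      then show "(\<lambda>u. psum l (exp u)) holomorphic_on A" by (simp add: o_def)
      show "open A" unfolding A_def by (intro open_Int abs_Im_less_strip open_halfspace_Re_lt)
      show "convex A" unfolding A_def by (intro convex_Int abs_Im_less_strip convex_halfspace_Re_lt)
      show "Complex (R - 1) (Im u) \<in> A" using uA by (auto simp: A_def R_def)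
      show "u \<in> A" by (rule uA)
      fix v assume v: "v \<in> A" "Re v < R"
      then have "exp (Re v) < exp (ln s')" by (simp add: R_def)
      then show "kap \<tau> v = psum l (exp v)"
        using s' v(1) by (intro s'(2)) (auto simp: A_def algebra_simps)
    qed simp
  next
    fix \<epsilon> :: real assume \<epsilon>: "\<epsilon> > 0"
    \<comment> \<open>The greatest deviation of Im u from pi in the given closed strip; the maximum
      with 0 covers an \<epsilon> for which that strip is empty.\<close>
    define b where "b = max 0 (pi - \<epsilon>)"
    have b: "0 \<le> b" "b < pi" using \<epsilon> by (auto simp: b_def)
    have "\<omega> / 2 * b < \<omega> * pi / 2" "0 \<le> (1 - \<omega> / 2) * b" "(1 - \<omega> / 2) * b < \<delta>"
      using b \<omega>_pos index_less unfolding \<delta> by auto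
    then obtain C where C: "\<And>\<tau> u. \<bar>\<tau>\<bar> \<le> \<omega> / 2 * b \<Longrightarrow> \<bar>Im u + \<tau> - pi\<bar> \<le> (1 - \<omega> / 2) * b \<Longrightarrow> cmod (kap \<tau> u) \<le> C"
      using kap_uniform_limit by metis
    show "\<exists>C. \<forall>u. \<epsilon> \<le> Im u \<and> Im u \<le> 2 * pi - \<epsilon> \<longrightarrow> cmod (\<kappa> u) \<le> C"
    proof (intro exI[of _ C] allI impI)
      fix u assume "\<epsilon> \<le> Im u \<and> Im u \<le> 2 * pi - \<epsilon>"
      then have "\<bar>Im u - pi\<bar> \<le> b" by (auto simp: b_def)
      then show "cmod (\<kappa> u) \<le> C"
        unfolding \<kappa>_def using \<omega>_pos index_less by (intro C) (auto simp: T1 T2 intro!: mult_left_mono)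
    qed
  qed
qed

end

section \<open>Convolution along a contour entering the sector\<close>

text \<open>Only the properties of the continued kernel \<kappa> and of the transform (series
  \<open>a\<close> in the disc, \<open>G\<close> in the sector) are kept. No growth of
  \<open>G\<close> is assumed: bounds enter later as a hypothesis on the part of the sector reached
  by the contour.\<close>

locale contour_convolution =
  fixes \<kappa> :: "complex \<Rightarrow> complex" and l :: "nat \<Rightarrow> complex" and s B :: real
    and a :: "nat \<Rightarrow> 'a::complex_banach" and r K :: real and G :: "complex \<Rightarrow> 'a" and d \<theta> :: real
  assumes s: "s > 0" and l: "\<And>p. cmod (l p) * s ^ p \<le> B"
    and \<kappa>: "\<kappa> holomorphic_on {u. 0 < Im u \<and> Im u < 2 * pi}"
    and \<kappa>_psum: "\<And>u. 0 < Im u \<Longrightarrow> Im u < 2 * pi \<Longrightarrow> exp (Re u) < s \<Longrightarrow> \<kappa> u = psum l (exp u)"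
    and \<kappa>_bound: "\<And>\<epsilon>. \<epsilon> > 0 \<Longrightarrow> \<exists>C. \<forall>u. \<epsilon> \<le> Im u \<and> Im u \<le> 2 * pi - \<epsilon> \<longrightarrow> cmod (\<kappa> u) \<le> C"
    and r: "r > 0" and a: "\<And>p. norm (a p) * r ^ p \<le> K" and \<theta>: "\<theta> > 0"
    and G: "G vec_holomorphic_on log_sector d \<theta>"
    and G_psum: "\<And>w. w \<in> log_sector d \<theta> \<Longrightarrow> exp (Re w) < r \<Longrightarrow> G w = psum a (exp w)"
begin

text \<open>The edges lie at the arguments d - \<alpha> and d + \<alpha>, strictly inside the
  sector; the cap pi / 2 leaves a genuine arc outside it and keeps the arguments of z / w inside the
  domain of \<kappa>.\<close>

definition \<alpha> where "\<alpha> = min (\<theta> / 4) (pi / 2)"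
definition \<rho> where "\<rho> = ln (r / 2)"
definition \<sigma> where "\<sigma> = ln s"

lemma \<alpha>: "0 < \<alpha>" "\<alpha> < \<theta> / 2" "\<alpha> \<le> pi / 2" "\<alpha> < pi"
  using \<theta> pi_gt_zero by (auto simp: \<alpha>_def min_def)

lemma \<rho>: "exp \<rho> = r / 2" and \<sigma>: "exp \<sigma> = s"
  using r s by (auto simp: \<rho>_def \<sigma>_def)

lemma exp_less_s: "x < \<sigma> \<Longrightarrow> exp x < s"
  using exp_less_cancel_iff[of x \<sigma>] by (simp add: \<sigma>)

text \<open>In the coordinate \<open>w\<close> the contour consists of an arc of \<open>Re w = \<rho>\<close> avoiding the sector, two
  horizontal edges inside the sector and a vertical edge \<open>Re w = L\<close> closing it to the right of \<open>v\<close>.\<close>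

definition I1 where "I1 v = integral {d + \<alpha>..d + 2 * pi - \<alpha>}
  (\<lambda>y. \<kappa> (v - (Complex \<rho> y - 2 * of_real pi * \<i>)) *\<^sub>C (\<i> *\<^sub>C psum a (exp (Complex \<rho> y))))"

definition I2 where "I2 L v = integral {\<rho>..L} (\<lambda>x. \<kappa> (v - Complex x (d - \<alpha>)) *\<^sub>C G (Complex x (d - \<alpha>)))"

text \<open>On the upper edge the argument of w exceeds that of v, so v - w lies below the real
  axis; replacing w by w - 2 pi \<i> selects the representative of z / w in the strip where \<kappa>
  is defined. The arc in \<open>I1\<close> is shifted for the same reason.\<close>

definition I3 where "I3 L v = integral {\<rho>..L}
  (\<lambda>x. \<kappa> (v - (Complex x (d + \<alpha>) - 2 * of_real pi * \<i>)) *\<^sub>C G (Complex x (d + \<alpha>)))"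

definition I4 where "I4 L v = integral {d - \<alpha>..d + \<alpha>}
  (\<lambda>y. psum l (exp (v - Complex L y)) *\<^sub>C (\<i> *\<^sub>C G (Complex L y)))"

text \<open>Cauchy's normalisation for the closed contour: arc, lower edge outwards, outer edge
  upwards, upper edge inwards (hence the minus sign).\<close>

definition H where "H L v = (1 / (2 * of_real pi * \<i>)) *\<^sub>C (I1 v + I2 L v - I3 L v + I4 L v)"

text \<open>Half the angle \<alpha> keeps v - w at distance \<alpha> / 2 from the boundary of the
  strip of \<kappa>, and Re v < L + \<sigma> expresses |z / w| < s on the outer edge.\<close>

definition V where "V L = {v. \<bar>Im v - d\<bar> < \<alpha> / 2 \<and> Re v < L + \<sigma>}"

lemma open_V: "open (V L)"
proof -
  have "V L = {v. \<bar>Im v + (- d)\<bar> < \<alpha> / 2} \<inter> {v. Re v < L + \<sigma>}"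
    unfolding V_def by auto
  then show ?thesis by (simp only:) (intro open_Int abs_Im_less_strip open_halfspace_Re_lt)
qed

lemma open_strip: "open {u. 0 < Im u \<and> Im u < 2 * pi}"
  unfolding Collect_conj_eq by (intro open_Int open_halfspace_Im_lt open_halfspace_Im_gt)

lemma in_log_sector: "\<bar>y - d\<bar> \<le> \<alpha> \<Longrightarrow> Complex x y \<in> log_sector d \<theta>"
  using \<alpha> by (auto simp: log_sector_def)

lemma G_continuous:
  "\<bar>y - d\<bar> \<le> \<alpha> \<Longrightarrow> continuous_on S (\<lambda>x. G (Complex x y))"
  "(\<And>y. y \<in> S \<Longrightarrow> \<bar>y - d\<bar> \<le> \<alpha>) \<Longrightarrow> continuous_on S (\<lambda>y. G (Complex x y))"
proof -
  note * = continuous_on_compose2[OF vec_holomorphic_on_imp_continuous_on[OF G]]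
  show "continuous_on S (\<lambda>x. G (Complex x y))" if "\<bar>y - d\<bar> \<le> \<alpha>"
    by (rule *) (use in_log_sector[OF that] in \<open>auto intro!: continuous_intros\<close>)
  show "continuous_on S (\<lambda>y. G (Complex x y))" if "\<And>y. y \<in> S \<Longrightarrow> \<bar>y - d\<bar> \<le> \<alpha>"
    by (rule *) (use in_log_sector[OF that] in \<open>auto intro!: continuous_intros\<close>)
qed

lemma psum_a_continuous: "continuous_on S (\<lambda>y. psum a (exp (Complex \<rho> y)))"
  by (rule psum_exp_continuous[OF a r]) (use r in \<open>simp add: \<rho>\<close>)

lemma psum_l_exp: "(\<lambda>u. psum l (exp u)) holomorphic_on {u. Re u < \<sigma>}"
proof -
  have "psum l holomorphic_on ball 0 s"
    using vec_holomorphic_psum[OF l s] by (simp add: vec_holomorphic_on_complex)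
  moreover have "exp ` {u. Re u < \<sigma>} \<subseteq> ball 0 s" using exp_less_s by auto
  ultimately have "(psum l \<circ> exp) holomorphic_on {u. Re u < \<sigma>}"
    by (rule holomorphic_on_compose_gen[OF holomorphic_on_exp])
  then show ?thesis by (simp add: o_def)
qed

lemma arc_strip:
  assumes "\<bar>Im v - d\<bar> < \<alpha> / 2" "y \<in> {d + \<alpha>..d + 2 * pi - \<alpha>}"
  shows "\<alpha> / 2 \<le> Im (v - (Complex x y - 2 * of_real pi * \<i>))" "Im (v - (Complex x y - 2 * of_real pi * \<i>)) \<le> 2 * pi - \<alpha> / 2"
proof -
  have *: "Im (v - (Complex x y - 2 * of_real pi * \<i>)) = Im v - y + 2 * pi" by simp
  note ** = abs_less_iff[THEN iffD1, OF assms(1)]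
  show "\<alpha> / 2 \<le> Im (v - (Complex x y - 2 * of_real pi * \<i>))" "Im (v - (Complex x y - 2 * of_real pi * \<i>)) \<le> 2 * pi - \<alpha> / 2"
    unfolding * using ** assms(2) by simp_all
qed

lemma upper_strip:
  assumes "\<bar>Im v - d\<bar> < \<alpha> / 2"
  shows "\<alpha> / 2 \<le> Im (v - (Complex x (d + \<alpha>) - 2 * of_real pi * \<i>))" "Im (v - (Complex x (d + \<alpha>) - 2 * of_real pi * \<i>)) \<le> 2 * pi - \<alpha> / 2"
proof -
  have *: "Im (v - (Complex x (d + \<alpha>) - 2 * of_real pi * \<i>)) = Im v - (d + \<alpha>) + 2 * pi" by simp
  note ** = abs_less_iff[THEN iffD1, OF assms]
  show "\<alpha> / 2 \<le> Im (v - (Complex x (d + \<alpha>) - 2 * of_real pi * \<i>))"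
    "Im (v - (Complex x (d + \<alpha>) - 2 * of_real pi * \<i>)) \<le> 2 * pi - \<alpha> / 2"
    unfolding * using ** \<alpha> by linarith+
qed

lemma lower_strip:
  assumes "\<bar>Im v - d\<bar> < \<alpha> / 2"
  shows "\<alpha> / 2 \<le> Im (v - Complex x (d - \<alpha>))" "Im (v - Complex x (d - \<alpha>)) \<le> 2 * pi - \<alpha> / 2"
proof -
  have *: "Im (v - Complex x (d - \<alpha>)) = Im v - (d - \<alpha>)" by simp
  note ** = abs_less_iff[THEN iffD1, OF assms]
  show "\<alpha> / 2 \<le> Im (v - Complex x (d - \<alpha>))" "Im (v - Complex x (d - \<alpha>)) \<le> 2 * pi - \<alpha> / 2"
    unfolding * using ** \<alpha> by linarith+
qed

lemma stripI: "\<alpha> / 2 \<le> Im u \<Longrightarrow> Im u \<le> 2 * pi - \<alpha> / 2 \<Longrightarrow> u \<in> {u. 0 < Im u \<and> Im u < 2 * pi}"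
  using \<alpha>(1) by simp

lemma vec_holomorphic_H: "H L vec_holomorphic_on V L"
proof -
  have d1: "\<bar>d - \<alpha> - d\<bar> \<le> \<alpha>" "\<bar>d + \<alpha> - d\<bar> \<le> \<alpha>" using \<alpha> by auto
  have "I1 vec_holomorphic_on V L"
    unfolding I1_def[abs_def]
  proof (rule vec_holomorphic_on_convolution[OF open_strip \<kappa> open_V])
    show "v - (Complex \<rho> y - 2 * of_real pi * \<i>) \<in> {u. 0 < Im u \<and> Im u < 2 * pi}"
      if "v \<in> V L" "y \<in> {d + \<alpha>..d + 2 * pi - \<alpha>}" for v y
      using that by (intro stripI arc_strip) (auto simp: V_def)
  qed (intro continuous_intros scaleC.continuous_on psum_a_continuous)+
  moreover have "I2 L vec_holomorphic_on V L"
    unfolding I2_def[abs_def]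
  proof (rule vec_holomorphic_on_convolution[OF open_strip \<kappa> open_V])
    show "v - Complex x (d - \<alpha>) \<in> {u. 0 < Im u \<and> Im u < 2 * pi}" if "v \<in> V L" for v x
      using that by (intro stripI lower_strip) (auto simp: V_def)
  qed (intro continuous_intros G_continuous d1)+
  moreover have "I3 L vec_holomorphic_on V L"
    unfolding I3_def[abs_def]
  proof (rule vec_holomorphic_on_convolution[OF open_strip \<kappa> open_V])
    show "v - (Complex x (d + \<alpha>) - 2 * of_real pi * \<i>) \<in> {u. 0 < Im u \<and> Im u < 2 * pi}" if "v \<in> V L" for v x
      using that by (intro stripI upper_strip) (auto simp: V_def)
  qed (intro continuous_intros G_continuous d1)+
  moreover have "I4 L vec_holomorphic_on V L"
    unfolding I4_def[abs_def]
  proof (rule vec_holomorphic_on_convolution[OF open_halfspace_Re_lt psum_l_exp open_V])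
    show "continuous_on {d - \<alpha>..d + \<alpha>} (\<lambda>y. \<i> *\<^sub>C G (Complex L y))"
      by (intro scaleC.continuous_on continuous_on_const G_continuous) auto
  qed (auto intro!: continuous_intros simp: V_def)
  ultimately show ?thesis
    unfolding H_def[abs_def]
    by (intro vec_holomorphic_on_cmult vec_holomorphic_on_add vec_holomorphic_on_diff)
qed

section \<open>Independence of the outer edge, and the continuation of the Hadamard product\<close>

lemma \<kappa>_eq:
  assumes "\<alpha> / 2 \<le> Im u" "Im u \<le> 2 * pi - \<alpha> / 2" "Re u < \<sigma>"
  shows "\<kappa> u = psum l (exp u)"
proof (rule \<kappa>_psum)
  show "0 < Im u" "Im u < 2 * pi" using assms(1,2) \<alpha>(1) by linarith+
  show "exp (Re u) < s" by (rule exp_less_s) (rule assms(3))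
qed

lemma exp_shift: "exp (v - (w - 2 * of_real pi * \<i>)) = exp (v - w)"
proof -
  have "v - (w - 2 * of_real pi * \<i>) = (v - w) + 2 * of_real pi * \<i>" by simp
  then show ?thesis by (simp only: exp_add exp_two_pi_i mult_1_right)
qed

lemma integrand_integrable:
  assumes "\<bar>Im v - d\<bar> < \<alpha> / 2"
  shows "(\<lambda>x. \<kappa> (v - Complex x (d - \<alpha>)) *\<^sub>C G (Complex x (d - \<alpha>))) integrable_on {b..c}"
    and "(\<lambda>x. \<kappa> (v - (Complex x (d + \<alpha>) - 2 * of_real pi * \<i>)) *\<^sub>C G (Complex x (d + \<alpha>))) integrable_on {b..c}"
proof -
  have d1: "\<bar>d - \<alpha> - d\<bar> \<le> \<alpha>" "\<bar>d + \<alpha> - d\<bar> \<le> \<alpha>" using \<alpha> by auto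
  note * = continuous_on_compose2[OF holomorphic_on_imp_continuous_on[OF \<kappa>]]
  show "(\<lambda>x. \<kappa> (v - Complex x (d - \<alpha>)) *\<^sub>C G (Complex x (d - \<alpha>))) integrable_on {b..c}"
    by (intro integrable_continuous_interval scaleC.continuous_on G_continuous d1 *)
      (intro continuous_intros, intro image_subsetI stripI lower_strip[OF assms])
  show "(\<lambda>x. \<kappa> (v - (Complex x (d + \<alpha>) - 2 * of_real pi * \<i>)) *\<^sub>C G (Complex x (d + \<alpha>))) integrable_on {b..c}"
    by (intro integrable_continuous_interval scaleC.continuous_on G_continuous d1 *)
      (intro continuous_intros, intro image_subsetI stripI upper_strip[OF assms])
qed

text \<open>Beyond \<open>L\<close> one has |z / w| < s, so \<kappa> is the power series there and
  has period 2 pi \<i>: the shift on the upper edge disappears. The change from \<open>L\<close> to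
  \<open>L'\<close> is then the boundary integral of one holomorphic function over a
  rectangle.\<close>

lemma H_independent_aux:
  assumes v: "v \<in> V L" and L: "\<rho> \<le> L" "L \<le> L'"
  shows "H L v = H L' v"
proof -
  define g where "g w = psum l (exp (v - w)) *\<^sub>C G w" for w
  have vd: "\<bar>Im v - d\<bar> < \<alpha> / 2" and vL: "Re v < L + \<sigma>" using v by (auto simp: V_def)
  have gh: "g vec_holomorphic_on rect L L' (d - \<alpha>) (d + \<alpha>)"
    unfolding g_def
  proof (rule vec_holomorphic_on_scaleC)
    have "(\<lambda>w. v - w) ` rect L L' (d - \<alpha>) (d + \<alpha>) \<subseteq> {u. Re u < \<sigma>}"
      using vL by (auto simp: rect_def)
    then have "((\<lambda>u. psum l (exp u)) \<circ> (\<lambda>w. v - w)) holomorphic_on rect L L' (d - \<alpha>) (d + \<alpha>)"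
      by (intro holomorphic_on_compose_gen[OF _ psum_l_exp] holomorphic_intros)
    then show "(\<lambda>w. psum l (exp (v - w))) holomorphic_on rect L L' (d - \<alpha>) (d + \<alpha>)"
      by (simp add: o_def)
    show "G vec_holomorphic_on rect L L' (d - \<alpha>) (d + \<alpha>)"
    proof (rule vec_holomorphic_on_subset[OF G], rule subsetI)
      fix w assume "w \<in> rect L L' (d - \<alpha>) (d + \<alpha>)"
      then have "\<bar>Im w - d\<bar> \<le> \<alpha>" by (auto simp: rect_def abs_le_iff)
      from in_log_sector[OF this, of "Re w"] show "w \<in> log_sector d \<theta>" by simp
    qed
  qed
  note gc = rect_edge_continuous[OF vec_holomorphic_on_imp_continuous_on[OF gh]]
  have 2: "I2 L' v = I2 L v + integral {L..L'} (\<lambda>x. g (Complex x (d - \<alpha>)))"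
  proof -
    have "integral {L..L'} (\<lambda>x. \<kappa> (v - Complex x (d - \<alpha>)) *\<^sub>C G (Complex x (d - \<alpha>)))
       = integral {L..L'} (\<lambda>x. g (Complex x (d - \<alpha>)))"
    proof (rule integral_cong)
      fix x assume "x \<in> {L..L'}"
      then have "\<kappa> (v - Complex x (d - \<alpha>)) = psum l (exp (v - Complex x (d - \<alpha>)))"
        using vL by (intro \<kappa>_eq lower_strip[OF vd]) simp
      then show "\<kappa> (v - Complex x (d - \<alpha>)) *\<^sub>C G (Complex x (d - \<alpha>)) = g (Complex x (d - \<alpha>))"
        by (simp only: g_def)
    qed
    then show ?thesis
      unfolding I2_def using L
      by (subst Henstock_Kurzweil_Integration.integral_combine[of \<rho> L L', symmetric]) (auto intro: integrand_integrable[OF vd])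
  qed
  have 3: "I3 L' v = I3 L v + integral {L..L'} (\<lambda>x. g (Complex x (d + \<alpha>)))"
  proof -
    have "integral {L..L'} (\<lambda>x. \<kappa> (v - (Complex x (d + \<alpha>) - 2 * of_real pi * \<i>)) *\<^sub>C G (Complex x (d + \<alpha>)))
       = integral {L..L'} (\<lambda>x. g (Complex x (d + \<alpha>)))"
    proof (rule integral_cong)
      fix x assume "x \<in> {L..L'}"
      then have "\<kappa> (v - (Complex x (d + \<alpha>) - 2 * of_real pi * \<i>)) =
          psum l (exp (v - (Complex x (d + \<alpha>) - 2 * of_real pi * \<i>)))"
        using vL by (intro \<kappa>_eq upper_strip[OF vd]) simp
      then show "\<kappa> (v - (Complex x (d + \<alpha>) - 2 * of_real pi * \<i>)) *\<^sub>C G (Complex x (d + \<alpha>)) =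
          g (Complex x (d + \<alpha>))"
        by (simp only: g_def exp_shift)
    qed
    then show ?thesis
      unfolding I3_def using L
      by (subst Henstock_Kurzweil_Integration.integral_combine[of \<rho> L L', symmetric]) (auto intro: integrand_integrable[OF vd])
  qed
  have 4: "I4 l' v = \<i> *\<^sub>C integral {d - \<alpha>..d + \<alpha>} (\<lambda>y. g (Complex l' y))" if "l' \<in> {L..L'}" for l'
  proof -
    have "(\<lambda>y. g (Complex l' y)) integrable_on {d - \<alpha>..d + \<alpha>}"
      using that by (intro integrable_continuous_interval gc) auto
    from integral_linear[OF this scaleC.bounded_linear_right[of \<i>]]
    show ?thesis by (simp add: I4_def g_def o_def scaleC_scaleC mult.commute)
  qed
  have "rect_int g L L' (d - \<alpha>) (d + \<alpha>) = 0"
    by (rule Goursat_rectangle[OF gh]) (use L \<alpha> in auto)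
  also have "rect_int g L L' (d - \<alpha>) (d + \<alpha>) =
     (integral {L..L'} (\<lambda>x. g (Complex x (d - \<alpha>))) - integral {L..L'} (\<lambda>x. g (Complex x (d + \<alpha>))))
      + \<i> *\<^sub>C (integral {d - \<alpha>..d + \<alpha>} (\<lambda>y. g (Complex L' y)) - integral {d - \<alpha>..d + \<alpha>} (\<lambda>y. g (Complex L y)))"
    unfolding rect_int_def using \<alpha> L
    by (subst (1 2) integral_diff) (auto intro!: integrable_continuous_interval gc)
  finally show ?thesis
    using L unfolding H_def 2 3 by (simp add: 4 scaleC.diff_right algebra_simps)
qed

lemma H_independent:
  assumes "v \<in> V L" "v \<in> V L'" "\<rho> \<le> L" "\<rho> \<le> L'"
  shows "H L v = H L' v"
proof (cases "L \<le> L'")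
  case True
  show ?thesis by (rule H_independent_aux[OF assms(1,3) True])
next
  case False
  then show ?thesis by (intro H_independent_aux[OF assms(2,4), symmetric]) simp
qed

text \<open>With the outer edge at \<rho> the horizontal edges collapse, and \<open>G\<close> is the
  series of \<open>a\<close> on the closing arc. The contour becomes a full circle starting at
  argument d - \<alpha>.\<close>

lemma H_psum:
  assumes v: "v \<in> V \<rho>"
  shows "H \<rho> v = psum (\<lambda>p. l p *\<^sub>C a p) (exp v)"
proof -
  have vd: "\<bar>Im v - d\<bar> < \<alpha> / 2" and vL: "Re v < \<rho> + \<sigma>" using v by (auto simp: V_def)
  define g where "g y = psum l (exp (v - Complex \<rho> y)) *\<^sub>C psum a (exp (Complex \<rho> y))" for y
  have gc: "continuous_on S g" for S
    unfolding g_def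
    by (intro scaleC.continuous_on psum_a_continuous continuous_on_compose2[OF holomorphic_on_imp_continuous_on[OF psum_l_exp]])
      (use vL in \<open>auto intro!: continuous_intros\<close>)
  have gi: "g integrable_on {b..c}" for b c by (rule integrable_continuous_interval[OF gc])
  have i: "integral {b..c} (\<lambda>y. \<i> *\<^sub>C g y) = \<i> *\<^sub>C integral {b..c} g" for b c
    using integral_linear[OF gi scaleC.bounded_linear_right[of \<i>]] by (simp add: o_def)
  have "I1 v = \<i> *\<^sub>C integral {d + \<alpha>..d + 2 * pi - \<alpha>} g"
    unfolding i[symmetric] I1_def
  proof (rule integral_cong)
    fix y assume y: "y \<in> {d + \<alpha>..d + 2 * pi - \<alpha>}"
    have "\<kappa> (v - (Complex \<rho> y - 2 * of_real pi * \<i>)) = psum l (exp (v - (Complex \<rho> y - 2 * of_real pi * \<i>)))"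
      using vL by (intro \<kappa>_eq arc_strip[OF vd y]) auto
    then show "\<kappa> (v - (Complex \<rho> y - 2 * of_real pi * \<i>)) *\<^sub>C (\<i> *\<^sub>C psum a (exp (Complex \<rho> y))) = \<i> *\<^sub>C g y"
      by (simp only: g_def exp_shift scaleC_scaleC) (simp only: mult.commute)
  qed
  moreover have "I4 \<rho> v = \<i> *\<^sub>C integral {d - \<alpha>..d + \<alpha>} g"
    unfolding i[symmetric] I4_def
  proof (rule integral_cong)
    fix y assume y: "y \<in> {d - \<alpha>..d + \<alpha>}"
    have "\<bar>y - d\<bar> \<le> \<alpha>" using y by (simp add: abs_le_iff)
    then have "G (Complex \<rho> y) = psum a (exp (Complex \<rho> y))"
      using r by (intro G_psum in_log_sector) (simp_all add: \<rho>)
    then show "psum l (exp (v - Complex \<rho> y)) *\<^sub>C (\<i> *\<^sub>C G (Complex \<rho> y)) = \<i> *\<^sub>C g y"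
      by (simp add: g_def scaleC_scaleC mult.commute)
  qed
  moreover have "integral {d - \<alpha>..d + \<alpha>} g + integral {d + \<alpha>..d + 2 * pi - \<alpha>} g = integral {d - \<alpha>..(d - \<alpha>) + 2 * pi} g"
    using \<alpha> Henstock_Kurzweil_Integration.integral_combine[OF _ _ gi, of "d - \<alpha>" "d + \<alpha>" "d + 2 * pi - \<alpha>"]
    by (simp add: algebra_simps)
  moreover have "I2 \<rho> v = 0" "I3 \<rho> v = 0" by (simp_all add: I2_def I3_def)
  ultimately have "H \<rho> v = (1 / (2 * of_real pi * \<i>)) *\<^sub>C \<i> *\<^sub>C integral {d - \<alpha>..(d - \<alpha>) + 2 * pi} g"
    by (simp add: H_def scaleC.add_right[symmetric] add.commute)
  also have "\<dots> = (1 / (2 * pi)) *\<^sub>R integral {d - \<alpha>..(d - \<alpha>) + 2 * pi} g"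
    by (simp add: scaleC_scaleC scaleR_eq_scaleC)
  finally have "H \<rho> v = (1 / (2 * pi)) *\<^sub>R integral {d - \<alpha>..(d - \<alpha>) + 2 * pi} g" .
  moreover have "(\<lambda>q. exp v ^ q *\<^sub>C l q *\<^sub>C a q) sums ((1 / (2 * pi)) *\<^sub>R integral {d - \<alpha>..(d - \<alpha>) + 2 * pi} g)"
    unfolding g_def using r vL by (intro psum_circle_convolution[OF a r _ l s] exp_less_s) (auto simp: \<rho>)
  ultimately show ?thesis by (simp add: psum_def sums_iff)
qed

text \<open>The position \<Lambda> of the outer edge may be any admissible function of v, even a
  discontinuous one: near a given point it can be frozen by independence of
  \<open>L\<close>.\<close>

lemma vec_holomorphic_continuation:
  assumes "\<And>v. \<bar>Im v - d\<bar> < \<alpha> / 2 \<Longrightarrow> \<rho> \<le> \<Lambda> v \<and> Re v < \<Lambda> v + \<sigma>"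
  shows "(\<lambda>v. H (\<Lambda> v) v) vec_holomorphic_on log_sector d \<alpha>"
    and "\<And>v. v \<in> V \<rho> \<Longrightarrow> H (\<Lambda> v) v = psum (\<lambda>p. l p *\<^sub>C a p) (exp v)"
proof -
  have \<Lambda>: "v \<in> V (\<Lambda> v)" "\<rho> \<le> \<Lambda> v" if "\<bar>Im v - d\<bar> < \<alpha> / 2" for v
    using assms[OF that] that by (auto simp: V_def)
  have eq: "H L v = H (\<Lambda> v) v" if "v \<in> V L" "\<rho> \<le> L" for v L
    using that by (intro H_independent \<Lambda>) (auto simp: V_def)
  show "H (\<Lambda> v) v = psum (\<lambda>p. l p *\<^sub>C a p) (exp v)" if "v \<in> V \<rho>" for v
    using eq[OF that] H_psum[OF that] by simp
  show "(\<lambda>v. H (\<Lambda> v) v) vec_holomorphic_on log_sector d \<alpha>"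
    unfolding vec_holomorphic_on_def
  proof
    fix v assume v: "v \<in> log_sector d \<alpha>"
    then have vd: "\<bar>Im v - d\<bar> < \<alpha> / 2" by (simp add: log_sector_def)
    have "(\<lambda>w. H (\<Lambda> w) w) vec_holomorphic_on V (\<Lambda> v)"
      by (rule vec_holomorphic_on_cong[OF vec_holomorphic_H[of "\<Lambda> v"]]) (rule eq[OF _ \<Lambda>(2)[OF vd]])
    then obtain D where "((\<lambda>w. H (\<Lambda> w) w) has_derivative (\<lambda>h. h *\<^sub>C D)) (at v)"
      using \<Lambda>(1)[OF vd] unfolding vec_holomorphic_on_open[OF open_V] by blast
    then show "\<exists>D. ((\<lambda>w. H (\<Lambda> w) w) has_derivative (\<lambda>h. h *\<^sub>C D)) (at v within log_sector d \<alpha>)"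
      by (blast intro: has_derivative_at_withinI)
  qed
qed

text \<open>\<open>Y\<close> need only bound \<open>G\<close> up to modulus exp L, the reach of the
  contour; the summand 1 accounts for the arc, which sees only the series. The factor exp L is a
  crude bound for the edge lengths.\<close>

lemma norm_H_le:
  obtains C where "C > 0"
    "\<And>v L Y. v \<in> V L \<Longrightarrow> \<rho> \<le> L \<Longrightarrow> Re v \<le> L + \<sigma> - 1 \<Longrightarrow>
      (\<And>w. w \<in> log_sector d \<theta> \<Longrightarrow> \<rho> \<le> Re w \<Longrightarrow> Re w \<le> L \<Longrightarrow> norm (G w) \<le> Y) \<Longrightarrow>
      norm (H L v) \<le> C * (1 + Y) * exp L"
proof -
  obtain A where A: "\<And>u. \<alpha> / 2 \<le> Im u \<Longrightarrow> Im u \<le> 2 * pi - \<alpha> / 2 \<Longrightarrow> cmod (\<kappa> u) \<le> A"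
    using \<kappa>_bound[of "\<alpha> / 2"] \<alpha>(1) by (metis half_gt_zero)
  have A0: "A \<ge> 0" 
    by (rule order.trans[OF norm_ge_zero A[of "Complex 0 pi"]]) (use \<alpha> in simp_all)
  \<comment> \<open>The margin 1 in Re v \<le> L + \<sigma> - 1 keeps |z / w| / s below exp (-1), so
    the geometric bound of the series is uniform.\<close>
  define A' where "A' = B / (1 - exp (-1))"
  have A': "cmod (psum l (exp u)) \<le> A'" if "Re u \<le> \<sigma> - 1" for u
  proof -
    have e: "cmod (exp u) / s \<le> exp (-1)"
    proof -
      have "cmod (exp u) / s = exp (Re u - \<sigma>)" by (simp add: exp_diff \<sigma>)
      also have "\<dots> \<le> exp (-1)" using that by simp
      finally show ?thesis .
    qed
    have e1: "exp (-1::real) < 1" by simp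
    have B0: "B \<ge> 0" using order.trans[OF mult_nonneg_nonneg[OF norm_ge_zero zero_le_power] l[of 0]] s by simp
    have "cmod (psum l (exp u)) \<le> B / (1 - cmod (exp u) / s)"
      by (rule norm_psum_le[OF l s]) (use e e1 s in \<open>metis divide_less_eq_1_pos le_less_trans\<close>)
    also have "\<dots> \<le> A'" unfolding A'_def using e e1 B0 by (intro divide_left_mono mult_pos_pos) linarith+
    finally show ?thesis .
  qed
  have A'0: "A' \<ge> 0" 
    by (rule order.trans[OF norm_ge_zero A'[of "of_real (\<sigma> - 1)"]]) simp
  have K0: "K \<ge> 0" using order.trans[OF mult_nonneg_nonneg[OF norm_ge_zero zero_le_power] a[of 0]] r by simp
  have Pa: "norm (psum a (exp (Complex \<rho> y))) \<le> 2 * K" for y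
    using norm_psum_le[OF a r, of "exp (Complex \<rho> y)"] r by (simp add: \<rho>)
  define C1 where "C1 = A * (2 * K) * (2 * pi) + 2 * A + A' * (2 * \<alpha>)"
  define C where "C = (C1 + 1) * exp (- \<rho>)"
  have C1: "C1 \<ge> 0" using A0 A'0 K0 \<alpha>(1) by (simp add: C1_def)
  have "norm (H L v) \<le> C * (1 + Y) * exp L"
    if v: "v \<in> V L" and L: "\<rho> \<le> L" "Re v \<le> L + \<sigma> - 1"
      and Y: "\<And>w. w \<in> log_sector d \<theta> \<Longrightarrow> \<rho> \<le> Re w \<Longrightarrow> Re w \<le> L \<Longrightarrow> norm (G w) \<le> Y" for v L Y
  proof -
    have vd: "\<bar>Im v - d\<bar> < \<alpha> / 2" using v by (simp add: V_def)
    have dd: "\<bar>(d - \<alpha>) - d\<bar> \<le> \<alpha>" "\<bar>(d + \<alpha>) - d\<bar> \<le> \<alpha>" using \<alpha> by auto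
    have Yc: "norm (G (Complex x y)) \<le> Y" if "\<rho> \<le> x" "x \<le> L" "\<bar>y - d\<bar> \<le> \<alpha>" for x y
      by (rule Y[OF in_log_sector[OF that(3)]]) (use that in simp_all)
    have Y0: "Y \<ge> 0" 
      by (rule order.trans[OF norm_ge_zero Yc[of \<rho> d]]) (use L(1) \<alpha>(1) in simp_all)
    note ck = continuous_on_compose2[OF holomorphic_on_imp_continuous_on[OF \<kappa>]]
    have i1: "norm (I1 v) \<le> (A * (2 * K)) * ((d + 2 * pi - \<alpha>) - (d + \<alpha>))"
      unfolding I1_def
    proof (rule integral_bound)
      show "continuous_on {d + \<alpha>..d + 2 * pi - \<alpha>}
          (\<lambda>y. \<kappa> (v - (Complex \<rho> y - 2 * of_real pi * \<i>)) *\<^sub>C (\<i> *\<^sub>C psum a (exp (Complex \<rho> y))))"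
        by (intro scaleC.continuous_on continuous_on_const psum_a_continuous ck)
          (intro continuous_intros, intro image_subsetI stripI arc_strip[OF vd])
      fix y assume y: "y \<in> {d + \<alpha>..d + 2 * pi - \<alpha>}"
      show "norm (\<kappa> (v - (Complex \<rho> y - 2 * of_real pi * \<i>)) *\<^sub>C (\<i> *\<^sub>C psum a (exp (Complex \<rho> y)))) \<le> A * (2 * K)"
        unfolding norm_scaleC norm_ii mult_1_left using A0
        by (intro mult_mono A arc_strip[OF vd y] Pa) simp_all
    qed (use \<alpha>(3) pi_gt_zero in linarith)
    have i2: "norm (I2 L v) \<le> (A * Y) * (L - \<rho>)"
      unfolding I2_def
    proof (rule integral_bound[OF L(1)])
      show "continuous_on {\<rho>..L} (\<lambda>x. \<kappa> (v - Complex x (d - \<alpha>)) *\<^sub>C G (Complex x (d - \<alpha>)))"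
        by (intro scaleC.continuous_on G_continuous dd ck)
          (intro continuous_intros, intro image_subsetI stripI lower_strip[OF vd])
      fix x assume x: "x \<in> {\<rho>..L}"
      show "norm (\<kappa> (v - Complex x (d - \<alpha>)) *\<^sub>C G (Complex x (d - \<alpha>))) \<le> A * Y"
        unfolding norm_scaleC using A0 x by (intro mult_mono A lower_strip[OF vd] Yc dd) simp_all
    qed
    have i3: "norm (I3 L v) \<le> (A * Y) * (L - \<rho>)"
      unfolding I3_def
    proof (rule integral_bound[OF L(1)])
      show "continuous_on {\<rho>..L} (\<lambda>x. \<kappa> (v - (Complex x (d + \<alpha>) - 2 * of_real pi * \<i>)) *\<^sub>C G (Complex x (d + \<alpha>)))"
        by (intro scaleC.continuous_on G_continuous dd ck)
          (intro continuous_intros, intro image_subsetI stripI upper_strip[OF vd])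
      fix x assume x: "x \<in> {\<rho>..L}"
      show "norm (\<kappa> (v - (Complex x (d + \<alpha>) - 2 * of_real pi * \<i>)) *\<^sub>C G (Complex x (d + \<alpha>))) \<le> A * Y"
        unfolding norm_scaleC using A0 x by (intro mult_mono A upper_strip[OF vd] Yc dd) simp_all
    qed
    have i4: "norm (I4 L v) \<le> (A' * Y) * ((d + \<alpha>) - (d - \<alpha>))"
      unfolding I4_def
    proof (rule integral_bound)
      have *: "\<bar>y - d\<bar> \<le> \<alpha>" if "y \<in> {d - \<alpha>..d + \<alpha>}" for y using that by (simp add: abs_le_iff)
      show "continuous_on {d - \<alpha>..d + \<alpha>} (\<lambda>y. psum l (exp (v - Complex L y)) *\<^sub>C (\<i> *\<^sub>C G (Complex L y)))"
        by (intro scaleC.continuous_on continuous_on_const G_continuous *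
            continuous_on_compose2[OF holomorphic_on_imp_continuous_on[OF psum_l_exp]])
          (use L(2) in \<open>auto intro!: continuous_intros\<close>)
      fix y assume y: "y \<in> {d - \<alpha>..d + \<alpha>}"
      show "norm (psum l (exp (v - Complex L y)) *\<^sub>C (\<i> *\<^sub>C G (Complex L y))) \<le> A' * Y"
        unfolding norm_scaleC norm_ii mult_1_left using A'0 L
        by (intro mult_mono A' Yc *[OF y]) simp_all
    qed (use \<alpha>(1) in simp)
    \<comment> \<open>The edges have logarithmic length L - \<rho>. Its exponential is used so that
      the loss is a power of the modulus, which a growth weight absorbs.\<close>
    have eL: "1 \<le> exp (L - \<rho>)" "L - \<rho> \<le> exp (L - \<rho>)"
      using L(1) exp_ge_add_one_self[of "L - \<rho>"] by (simp, linarith)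
    have "norm (I1 v + I2 L v - I3 L v + I4 L v) \<le> norm (I1 v) + norm (I2 L v) + norm (I3 L v) + norm (I4 L v)"
      using norm_triangle_ineq[of "I1 v" "I2 L v"] norm_triangle_ineq4[of "I1 v + I2 L v" "I3 L v"]
        norm_triangle_ineq[of "I1 v + I2 L v - I3 L v" "I4 L v"] by linarith
    also have "\<dots> \<le> (A * (2 * K)) * (2 * pi) + (A * Y) * (L - \<rho>) + (A * Y) * (L - \<rho>) + (A' * Y) * (2 * \<alpha>)"
    proof (intro add_mono i2 i3)
      show "norm (I1 v) \<le> (A * (2 * K)) * (2 * pi)"
        by (rule order.trans[OF i1]) (use A0 K0 \<alpha>(1) in \<open>intro mult_left_mono; simp\<close>)
      show "norm (I4 L v) \<le> (A' * Y) * (2 * \<alpha>)" using i4 by simp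
    qed
    also have "\<dots> \<le> ((A * (2 * K)) * (2 * pi)) * ((1 + Y) * exp (L - \<rho>)) + A * ((1 + Y) * exp (L - \<rho>))
        + A * ((1 + Y) * exp (L - \<rho>)) + (A' * (2 * \<alpha>)) * ((1 + Y) * exp (L - \<rho>))"
    proof (intro add_mono)
      have y1: "1 \<le> (1 + Y) * exp (L - \<rho>)" using mult_mono[of 1 "1 + Y" 1 "exp (L - \<rho>)"] Y0 eL by simp
      have y2: "Y * (L - \<rho>) \<le> (1 + Y) * exp (L - \<rho>)" using Y0 eL L(1) by (intro mult_mono) auto
      have y3: "Y \<le> (1 + Y) * exp (L - \<rho>)" using mult_mono[of Y "1 + Y" 1 "exp (L - \<rho>)"] Y0 eL by simp
      show "(A * (2 * K)) * (2 * pi) \<le> ((A * (2 * K)) * (2 * pi)) * ((1 + Y) * exp (L - \<rho>))"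
        using mult_left_mono[OF y1, of "(A * (2 * K)) * (2 * pi)"] A0 K0 by simp
      show "(A * Y) * (L - \<rho>) \<le> A * ((1 + Y) * exp (L - \<rho>))"
        unfolding mult.assoc by (rule mult_left_mono[OF y2 A0])
      then show "(A * Y) * (L - \<rho>) \<le> A * ((1 + Y) * exp (L - \<rho>))" .
      show "(A' * Y) * (2 * \<alpha>) \<le> (A' * (2 * \<alpha>)) * ((1 + Y) * exp (L - \<rho>))"
        using mult_left_mono[OF y3, of "A' * (2 * \<alpha>)"] A'0 \<alpha>(1) by (simp add: ac_simps)
    qed
    also have "\<dots> = C1 * ((1 + Y) * exp (L - \<rho>))" by (simp add: C1_def distrib_right)
    finally have *: "norm (I1 v + I2 L v - I3 L v + I4 L v) \<le> C1 * ((1 + Y) * exp (L - \<rho>))" .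
    have pi1: "1 / (2 * pi) \<le> 1" using pi_gt3 by simp
    have "norm (H L v) = 1 / (2 * pi) * norm (I1 v + I2 L v - I3 L v + I4 L v)"
      by (simp add: H_def norm_scaleC norm_divide norm_mult)
    also have "\<dots> \<le> 1 * norm (I1 v + I2 L v - I3 L v + I4 L v)"
      by (intro mult_right_mono pi1 norm_ge_zero)
    also have "\<dots> \<le> C1 * ((1 + Y) * exp (L - \<rho>))" unfolding mult_1_left by (rule *)
    also have "\<dots> \<le> (C1 + 1) * ((1 + Y) * exp (L - \<rho>))"
      using Y0 by (intro mult_right_mono mult_nonneg_nonneg) auto
    also have "\<dots> = C * (1 + Y) * exp L" by (simp add: C_def exp_diff exp_minus field_simps)
    finally show ?thesis .
  qed
  moreover have "C > 0" using C1 by (simp add: C_def add_nonneg_pos)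
  ultimately show ?thesis using that by blast
qed

end

section \<open>Closure of the extendable series under multipliers\<close>

text \<open>The properties of an associated function that the estimates use. They pass to h (t^q),
  the weight that appears after ramification.\<close>

definition growth_fun :: "(real \<Rightarrow> real) \<Rightarrow> bool" where
  "growth_fun h \<longleftrightarrow> (\<forall>s t. 0 < s \<longrightarrow> s \<le> t \<longrightarrow> h s \<le> h t) \<and> (\<forall>t>0. 0 \<le> h t) \<and>
     (\<exists>B>0. \<exists>C>0. \<forall>t>0. t * exp (h t) \<le> C * exp (h (B * t)))"

lemma growth_fun_mono: "growth_fun h \<Longrightarrow> 0 < s \<Longrightarrow> s \<le> t \<Longrightarrow> h s \<le> h t"
  and growth_fun_nonneg: "growth_fun h \<Longrightarrow> 0 < t \<Longrightarrow> 0 \<le> h t"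
  by (auto simp: growth_fun_def)

lemma growth_fun_absorb:
  assumes "growth_fun h"
  obtains B C where "B > 0" "C > 0" "\<And>t. t > 0 \<Longrightarrow> t * exp (h t) \<le> C * exp (h (B * t))"
  using assms unfolding growth_fun_def by blast

lemma growth_fun_assoc_fun:
  assumes "strongly_regular M"
  shows "growth_fun (assoc_fun M)"
proof -
  obtain B C where "B > 0" "C > 0" "\<And>t. t > 0 \<Longrightarrow> t * exp (assoc_fun M t) \<le> C * exp (assoc_fun M (B * t))"
    using assoc_fun_absorb[OF assms] by blast
  then show ?thesis
    unfolding growth_fun_def using assoc_fun_mono[OF assms] assoc_fun_nonneg[OF assms] by blast
qed

lemma growth_fun_power:
  assumes h: "growth_fun h" and q: "q > 0"
  shows "growth_fun (\<lambda>t. h (t ^ q))"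
proof -
  obtain B C where BC: "B > 0" "C > 0" "\<And>t. t > 0 \<Longrightarrow> t * exp (h t) \<le> C * exp (h (B * t))"
    using growth_fun_absorb[OF h] by blast
  define B' where "B' = max 1 B"
  have B': "B' \<ge> 1" "B \<le> B'" by (auto simp: B'_def)
  have "t * exp (h (t ^ q)) \<le> (1 + C) * exp (h ((B' * t) ^ q))" if t: "t > 0" for t
  proof -
    have tq: "t ^ q > 0" using t by simp
    \<comment> \<open>Absorption for h is available for the factor t^q; this reduces the factor t to
      it.\<close>
    have "t \<le> 1 + t ^ q"
    proof (cases "t \<le> 1")
      case False
      then have "t ^ 1 \<le> t ^ q" using q by (intro power_increasing) auto
      then show ?thesis by simp
    qed (use tq in linarith)
    then have "t * exp (h (t ^ q)) \<le> exp (h (t ^ q)) + t ^ q * exp (h (t ^ q))"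
      using mult_right_mono[of t "1 + t ^ q" "exp (h (t ^ q))"] by (simp add: distrib_right)
    also have "\<dots> \<le> exp (h (t ^ q)) + C * exp (h (B * t ^ q))" using BC(3)[OF tq] by simp
    also have "\<dots> \<le> exp (h ((B' * t) ^ q)) + C * exp (h ((B' * t) ^ q))"
    proof -
      have "1 * t ^ q \<le> B' ^ q * t ^ q" using B' tq by (intro mult_right_mono one_le_power) auto
      then have "h (t ^ q) \<le> h ((B' * t) ^ q)"
        by (intro growth_fun_mono[OF h tq]) (simp add: power_mult_distrib)
      moreover have "B' ^ 1 \<le> B' ^ q" using q B' by (intro power_increasing) auto
      then have "B * t ^ q \<le> B' ^ q * t ^ q" using B' tq by (intro mult_right_mono) auto
      then have "h (B * t ^ q) \<le> h ((B' * t) ^ q)"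
        using BC tq by (intro growth_fun_mono[OF h]) (auto simp: power_mult_distrib)
      ultimately show ?thesis using BC by (intro add_mono mult_left_mono) auto
    qed
    finally show ?thesis by (simp add: distrib_right)
  qed
  moreover have "h (s ^ q) \<le> h (t ^ q)" if "0 < s" "s \<le> t" for s t
    using that by (intro growth_fun_mono[OF h] power_mono) auto
  moreover have "h (t ^ q) \<ge> 0" if "t > 0" for t
    using that by (intro growth_fun_nonneg[OF h]) simp
  ultimately show ?thesis
    unfolding growth_fun_def using B' BC by (intro conjI allI impI exI[of _ B'] exI[of _ "1 + C"]) auto
qed

text \<open>Extendability in terms of the coefficients of the transform. The disc is encoded by a
  coefficient bound, and the growth bound holds on the whole sector rather than on subsectors; since
  every operation below may shrink the opening, nothing is lost.\<close>

definition sector_extendable :: "(real \<Rightarrow> real) \<Rightarrow> real \<Rightarrow> (nat \<Rightarrow> 'a::complex_banach) \<Rightarrow> bool" where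
  "sector_extendable h d a \<longleftrightarrow> (\<exists>\<theta> r K G c k. \<theta> > 0 \<and> r > 0 \<and> c > 0 \<and> k > 0 \<and>
     (\<forall>p. norm (a p) * r ^ p \<le> K) \<and> G vec_holomorphic_on log_sector d \<theta> \<and>
     (\<forall>w\<in>log_sector d \<theta>. exp (Re w) < r \<longrightarrow> G w = psum a (exp w)) \<and>
     (\<forall>w\<in>log_sector d \<theta>. norm (G w) \<le> c * exp (h (exp (Re w) / k))))"

lemma sector_extendableE:
  assumes "sector_extendable h d a"
  obtains \<theta> r K G c k where "\<theta> > 0" "r > 0" "c > 0" "k > 0" "K \<ge> 0"
    "\<And>p. norm (a p) * r ^ p \<le> K" "G vec_holomorphic_on log_sector d \<theta>"
    "\<And>w. w \<in> log_sector d \<theta> \<Longrightarrow> exp (Re w) < r \<Longrightarrow> G w = psum a (exp w)"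
    "\<And>w. w \<in> log_sector d \<theta> \<Longrightarrow> norm (G w) \<le> c * exp (h (exp (Re w) / k))"
proof -
  obtain \<theta> r K G c k where *: "\<theta> > 0" "r > 0" "c > 0" "k > 0"
    "\<And>p. norm (a p) * r ^ p \<le> K" "G vec_holomorphic_on log_sector d \<theta>"
    "\<And>w. w \<in> log_sector d \<theta> \<Longrightarrow> exp (Re w) < r \<Longrightarrow> G w = psum a (exp w)"
    "\<And>w. w \<in> log_sector d \<theta> \<Longrightarrow> norm (G w) \<le> c * exp (h (exp (Re w) / k))"
    using assms unfolding sector_extendable_def by metis
  have "K \<ge> 0" using order.trans[OF mult_nonneg_nonneg[OF norm_ge_zero zero_le_power] *(5)[of 0]] *(2) by simp
  with * show ?thesis using that by blast
qed

lemma sector_extendableI: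
  assumes "\<theta> > 0" "r > 0" "c > 0" "k > 0"
    "\<And>p. norm (a p) * r ^ p \<le> K" "G vec_holomorphic_on log_sector d \<theta>"
    "\<And>w. w \<in> log_sector d \<theta> \<Longrightarrow> exp (Re w) < r \<Longrightarrow> G w = psum a (exp w)"
    "\<And>w. w \<in> log_sector d \<theta> \<Longrightarrow> norm (G w) \<le> c * exp (h (exp (Re w) / k))"
  shows "sector_extendable h d a"
  unfolding sector_extendable_def
  by (rule exI[of _ \<theta>], rule exI[of _ r], rule exI[of _ K], rule exI[of _ G], rule exI[of _ c],
      rule exI[of _ k]) (intro conjI allI ballI impI assms)

lemma kernel_momentsE:
  assumes "kernel_moments M n"
  obtains e E where "moment_kernel M n e E"
proof -
  from assms obtain e E where "strongly_regular M" "growth_index M < 2" "kernel_functions M e E"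
    "\<And>p. complex_of_real (n p) = moment_fun e (of_nat p)"
    unfolding kernel_moments_def by (elim conjE exE) simp
  then show ?thesis by (intro that moment_kernel.intro)
qed

lemma kernel_moments_nonzero: "kernel_moments M n \<Longrightarrow> n p \<noteq> 0"
  by (metis kernel_momentsE moment_kernel.n_nonzero)

text \<open>What is left to choose is the outer edge. Placed at a fixed multiple of |z|, it makes
  the bound of \<open>G\<close> along the contour a value of h at a dilate of |z|, times a factor
  |z| to be absorbed.\<close>

theorem sector_extendable_multiplier:
  assumes n: "kernel_moments M n" and h: "growth_fun h" and a: "sector_extendable h d a"
  shows "sector_extendable h d (\<lambda>p. (n (Suc p) / n p) *\<^sub>R a p)"
proof -
  define l where "l p = complex_of_real (n (Suc p) / n p)" for p
  obtain e E where mk: "moment_kernel M n e E" using kernel_momentsE[OF n] by blast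
  have l: "moment_kernel.l n = l" by (simp add: l_def fun_eq_iff moment_kernel.l_def[OF mk])
  obtain \<kappa> s B where ker: "s > 0" "\<And>p. cmod (l p) * s ^ p \<le> B"
    "\<kappa> holomorphic_on {u. 0 < Im u \<and> Im u < 2 * pi}"
    "\<And>u. 0 < Im u \<Longrightarrow> Im u < 2 * pi \<Longrightarrow> exp (Re u) < s \<Longrightarrow> \<kappa> u = psum l (exp u)"
    "\<And>\<epsilon>. \<epsilon> > 0 \<Longrightarrow> \<exists>C. \<forall>u. \<epsilon> \<le> Im u \<and> Im u \<le> 2 * pi - \<epsilon> \<longrightarrow> cmod (\<kappa> u) \<le> C"
    by (rule moment_kernel.summation_kernel[OF mk, unfolded l]) (rule that)
  obtain \<theta> r K G c k where ext: "\<theta> > 0" "r > 0" "c > 0" "k > 0" "K \<ge> 0"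
    "\<And>p. norm (a p) * r ^ p \<le> K" "G vec_holomorphic_on log_sector d \<theta>"
    "\<And>w. w \<in> log_sector d \<theta> \<Longrightarrow> exp (Re w) < r \<Longrightarrow> G w = psum a (exp w)"
    "\<And>w. w \<in> log_sector d \<theta> \<Longrightarrow> norm (G w) \<le> c * exp (h (exp (Re w) / k))"
    by (rule sector_extendableE[OF a]) (rule that)
  interpret contour_convolution \<kappa> l s B a r K G d \<theta>
    by (rule contour_convolution.intro) (fact ker ext)+
  obtain C where C: "C > 0" "\<And>v L Y. v \<in> V L \<Longrightarrow> \<rho> \<le> L \<Longrightarrow> Re v \<le> L + \<sigma> - 1 \<Longrightarrow>
      (\<And>w. w \<in> log_sector d \<theta> \<Longrightarrow> \<rho> \<le> Re w \<Longrightarrow> Re w \<le> L \<Longrightarrow> norm (G w) \<le> Y) \<Longrightarrow>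
      norm (H L v) \<le> C * (1 + Y) * exp L"
  proof (rule norm_H_le)
    fix C assume "C > 0" and "\<And>v L Y. v \<in> V L \<Longrightarrow> \<rho> \<le> L \<Longrightarrow> Re v \<le> L + \<sigma> - 1 \<Longrightarrow>
      (\<And>w. w \<in> log_sector d \<theta> \<Longrightarrow> \<rho> \<le> Re w \<Longrightarrow> Re w \<le> L \<Longrightarrow> norm (G w) \<le> Y) \<Longrightarrow>
      norm (H L v) \<le> C * (1 + Y) * exp L"
    then show thesis by (rule that)
  qed
  obtain B0 C0 where BC: "B0 > 0" "C0 > 0" "\<And>t. t > 0 \<Longrightarrow> t * exp (h t) \<le> C0 * exp (h (B0 * t))"
    using growth_fun_absorb[OF h] by blast
  \<comment> \<open>The smallest position allowed by the margin 1 of \<open>norm_H_le\<close>, but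
    never to the left of the arc.\<close>
  define \<Lambda> where "\<Lambda> v = max \<rho> (Re v - \<sigma> + 1)" for v :: complex
  have \<Lambda>: "\<rho> \<le> \<Lambda> v" "Re v \<le> \<Lambda> v + \<sigma> - 1" "Re v < \<Lambda> v + \<sigma>" for v
    unfolding \<Lambda>_def by (simp_all add: max_def)
  have \<Lambda>': "\<And>v. \<bar>Im v - d\<bar> < \<alpha> / 2 \<Longrightarrow> \<rho> \<le> \<Lambda> v \<and> Re v < \<Lambda> v + \<sigma>" using \<Lambda> by blast
  define D where "D = C * (1 + c) * (k * C0)"
  have D: "D > 0" unfolding D_def using C(1) ext(3,4) BC(1,2) by (intro mult_pos_pos add_pos_pos) auto
  \<comment> \<open>Covers small |z|, where the maximum is \<rho> and the bound is a
    constant.\<close>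
  define D1 where "D1 = D * exp (h (B0 * (exp \<rho> / k)))"
  \<comment> \<open>For large |z| the dilation B0 exp L / k with L = Re v - \<sigma> + 1 equals |z|
    / k'.\<close>
  define k' where "k' = k / (B0 * exp (1 - \<sigma>))"
  have k': "k' > 0" using ext(1-5) BC by (simp add: k'_def)
  have bound: "norm (H (\<Lambda> v) v) \<le> (D + D1) * exp (h (exp (Re v) / k'))" if v: "v \<in> log_sector d \<alpha>" for v
  proof -
    define L where "L = \<Lambda> v"
    define t where "t = exp L / k"
    have t: "t > 0" using ext(1-5) by (simp add: t_def)
    have "norm (H L v) \<le> C * (1 + c * exp (h t)) * exp L"
    proof (rule C(2))
      show "v \<in> V L" using v \<Lambda>[of v] by (simp add: V_def log_sector_def L_def)
      show "\<rho> \<le> L" "Re v \<le> L + \<sigma> - 1" using \<Lambda>[of v] by (auto simp: L_def)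
      fix w assume w: "w \<in> log_sector d \<theta>" "Re w \<le> L"
      have "h (exp (Re w) / k) \<le> h t"
        using w ext(1-5) by (intro growth_fun_mono[OF h]) (auto simp: t_def divide_right_mono)
      then have "c * exp (h (exp (Re w) / k)) \<le> c * exp (h t)" using ext(1-5) by simp
      with ext(9)[OF w(1)] show "norm (G w) \<le> c * exp (h t)" by linarith
    qed
    also have "\<dots> \<le> C * ((1 + c) * exp (h t)) * exp L"
      using C ext(1-5) growth_fun_nonneg[OF h t] by (intro mult_right_mono mult_left_mono) (auto simp: distrib_right)
    also have "\<dots> = C * (1 + c) * k * (t * exp (h t))" using ext(1-5) by (simp add: t_def)
    also have "\<dots> \<le> C * (1 + c) * k * (C0 * exp (h (B0 * t)))"
      using C ext(1-5) by (intro mult_left_mono BC t) auto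
    also have "\<dots> = D * exp (h (B0 * t))" by (simp add: D_def)
    also have "\<dots> \<le> (D + D1) * exp (h (exp (Re v) / k'))"
    proof (cases "L = \<rho>")
      case True
      have "D * exp (h (B0 * t)) = D1 * 1" using True by (simp add: D1_def t_def)
      also have "\<dots> \<le> (D + D1) * exp (h (exp (Re v) / k'))"
        using D growth_fun_nonneg[OF h, of "exp (Re v) / k'"] k' by (intro mult_mono) (auto simp: D1_def)
      finally show ?thesis .
    next
      case False
      then have "L = Re v - \<sigma> + 1" unfolding L_def \<Lambda>_def by (simp add: max_def split: if_splits)
      then have "exp L = exp (1 - \<sigma>) * exp (Re v)" by (simp flip: exp_add)
      then have "B0 * t = exp (Re v) / k'" by (simp add: t_def k'_def)
      then show ?thesis using D by (simp add: D1_def)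
    qed
    finally show ?thesis by (simp add: L_def)
  qed
  have eq: "(\<lambda>p. (n (Suc p) / n p) *\<^sub>R a p) = (\<lambda>p. l p *\<^sub>C a p)"
    by (simp add: l_def scaleR_eq_scaleC)
  show ?thesis
    unfolding eq
  \<comment> \<open>The radius r s / 2 is exp (\<rho> + \<sigma>), below which \<open>v\<close> lies
    in \<open>V \<rho>\<close> and \<open>H_psum\<close> applies.\<close>
  proof (rule sector_extendableI[where r="r * s / 2" and K="B * K" and \<theta>=\<alpha> and G="\<lambda>v. H (\<Lambda> v) v"])
    show "norm (l p *\<^sub>C a p) * (r * s / 2) ^ p \<le> B * K" for p
    proof -
      have "norm (l p *\<^sub>C a p) * (r * s / 2) ^ p \<le> norm (l p *\<^sub>C a p) * (r * s) ^ p"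
        using ext(2) ker(1) by (intro mult_left_mono power_mono) auto
      also have "\<dots> = (cmod (l p) * s ^ p) * (norm (a p) * r ^ p)"
        by (simp add: norm_scaleC power_mult_distrib)
      also have "\<dots> \<le> B * K"
        using ext(2) ker(1) ker(2)[of 0] by (intro mult_mono ker ext) (auto intro: order.trans[OF norm_ge_zero])
      finally show ?thesis .
    qed
    show "(\<lambda>v. H (\<Lambda> v) v) vec_holomorphic_on log_sector d \<alpha>"
      by (rule vec_holomorphic_continuation(1)[OF \<Lambda>'])
    show "H (\<Lambda> w) w = psum (\<lambda>p. l p *\<^sub>C a p) (exp w)"
      if "w \<in> log_sector d \<alpha>" "exp (Re w) < r * s / 2" for w
    proof (rule vec_holomorphic_continuation(2)[OF \<Lambda>'])
      have "exp (Re w) < exp (\<rho> + \<sigma>)" using that(2) by (simp add: exp_add \<rho> \<sigma>)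
      then show "w \<in> V \<rho>" using that(1) by (simp add: V_def log_sector_def)
    qed
    show "norm (H (\<Lambda> w) w) \<le> (D + D1) * exp (h (exp (Re w) / k'))" if "w \<in> log_sector d \<alpha>" for w
      by (rule bound[OF that])
  qed (use \<alpha>(1) ext(1-5) ker(1) D k' in \<open>auto simp: D1_def intro!: add_pos_pos mult_pos_pos\<close>)
qed

text \<open>The shift is the division of \<open>G\<close> - a_0 by z. For |z| < r / 2 the shifted
  series gives the bound; elsewhere 1 / |z| \<le> 2 / r.\<close>

theorem sector_extendable_shift:
  assumes h: "growth_fun h" and a: "sector_extendable h d a"
  shows "sector_extendable h d (\<lambda>p. a (Suc p))"
proof -
  obtain \<theta> r K G c k where G: "\<theta> > 0" "r > 0" "c > 0" "k > 0" "K \<ge> 0"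
    "\<And>p. norm (a p) * r ^ p \<le> K" "G vec_holomorphic_on log_sector d \<theta>"
    "\<And>w. w \<in> log_sector d \<theta> \<Longrightarrow> exp (Re w) < r \<Longrightarrow> G w = psum a (exp w)"
    "\<And>w. w \<in> log_sector d \<theta> \<Longrightarrow> norm (G w) \<le> c * exp (h (exp (Re w) / k))"
    by (rule sector_extendableE[OF a]) (rule that)
  define G' where "G' w = exp (- w) *\<^sub>C (G w - a 0)" for w
  have ab: "norm (a (Suc p)) * r ^ p \<le> K / r" for p
    using G(6)[of "Suc p"] G(2) by (simp add: field_simps)
  have G'_psum: "G' w = psum (\<lambda>p. a (Suc p)) (exp w)" if w: "w \<in> log_sector d \<theta>" "exp (Re w) < r" for w
  proof -
    have "(\<lambda>p. exp w ^ p *\<^sub>C a p) sums psum a (exp w)"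
      by (rule psum_sums[OF G(6) G(2)]) (use w in simp)
    then have "(\<lambda>p. exp w ^ Suc p *\<^sub>C a (Suc p)) sums (psum a (exp w) - exp w ^ 0 *\<^sub>C a 0)"
      by (subst sums_Suc_iff) simp
    from bounded_linear.sums[OF scaleC.bounded_linear_right this, of "exp (- w)"]
    have "(\<lambda>p. (exp (- w) * exp w * exp w ^ p) *\<^sub>C a (Suc p)) sums G' w"
      by (simp add: G'_def G(8)[OF w] scaleC_scaleC mult.assoc)
    then have "(\<lambda>p. exp w ^ p *\<^sub>C a (Suc p)) sums G' w"
      by (simp flip: exp_add)
    then show ?thesis by (simp add: psum_def sums_iff)
  qed
  define c' where "c' = 2 * K / r + 2 / r * (c + norm (a 0))"
  show ?thesis
  proof (rule sector_extendableI[where r=r and K="K / r" and \<theta>=\<theta> and G=G' and c=c' and k=k])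
    show "0 < c'" unfolding c'_def using G(1-5) by (intro add_nonneg_pos mult_pos_pos add_pos_nonneg) auto
    show "G' vec_holomorphic_on log_sector d \<theta>"
      unfolding G'_def by (intro vec_holomorphic_on_scaleC vec_holomorphic_on_diff G(7) vec_holomorphic_on_const)
        (intro holomorphic_intros)
    fix w assume w: "w \<in> log_sector d \<theta>"
    define y where "y = exp (h (exp (Re w) / k))"
    have y: "y \<ge> 1" using growth_fun_nonneg[OF h, of "exp (Re w) / k"] G(1-5) by (simp add: y_def)
    show "norm (G' w) \<le> c' * exp (h (exp (Re w) / k))"
    proof (cases "exp (Re w) < r / 2")
      case True
      have 1: "norm (psum (\<lambda>p. a (Suc p)) (exp w)) \<le> (K / r) / (1 - cmod (exp w) / r)"
        by (rule norm_psum_le[OF ab G(2)]) (use True G(1-5) in simp)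
      have "1 / 2 \<le> 1 - exp (Re w) / r" using True G(1-5) by (simp add: field_simps)
      then have "(K / r) / (1 - cmod (exp w) / r) \<le> (K / r) / (1 / 2)"
        using G(1-5) by (intro divide_left_mono) auto
      from order.trans[OF 1 this] have "norm (psum (\<lambda>p. a (Suc p)) (exp w)) \<le> 2 * K / r" by (simp add: mult.commute)
      then have "norm (G' w) \<le> 2 * K / r"
        using True G(1-5) by (simp add: G'_psum[OF w])
      also have "\<dots> \<le> c' * 1" using G(1-5) by (simp add: c'_def)
      also have "\<dots> \<le> c' * y" using G(1-5) y by (intro mult_left_mono) (auto simp: c'_def)
      finally show ?thesis by (simp add: y_def)
    next
      case False
      have "norm (G' w) = exp (- Re w) * norm (G w - a 0)" by (simp add: G'_def norm_scaleC)
      also have "\<dots> \<le> (2 / r) * (c * y + norm (a 0) * y)"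
      proof (rule mult_mono)
        show "exp (- Re w) \<le> 2 / r" using False G(1-5) by (simp add: exp_minus field_simps)
        have "norm (G w - a 0) \<le> norm (G w) + norm (a 0)" by (rule norm_triangle_ineq4)
        also have "\<dots> \<le> c * y + norm (a 0) * y"
          using G(9)[OF w] y mult_left_mono[OF y, of "norm (a 0)"] by (simp add: y_def)
        finally show "norm (G w - a 0) \<le> c * y + norm (a 0) * y" .
      qed (use G(1-5) in auto)
      also have "\<dots> = (2 / r * (c + norm (a 0))) * y" by (simp add: algebra_simps add_divide_distrib)
      also have "\<dots> \<le> c' * y" using G(1-5) y by (intro mult_right_mono) (auto simp: c'_def)
      finally show ?thesis by (simp add: y_def)
    qed
  qed (use G(1-5) ab G'_psum in auto)
qed

section \<open>Ramification\<close>

lemma psum_ramified: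
  fixes a :: "nat \<Rightarrow> 'a::complex_banach"
  assumes "\<And>p. norm (b (q * p)) * r ^ p \<le> K" "r > 0" "cmod (z ^ q) < r" "q > 0"
    and "\<And>j. \<not> q dvd j \<Longrightarrow> b j = 0"
  shows "psum b z = psum (\<lambda>p. b (q * p)) (z ^ q)"
proof -
  have "(\<lambda>p. (z ^ q) ^ p *\<^sub>C b (q * p)) sums psum (\<lambda>p. b (q * p)) (z ^ q)"
    by (rule psum_sums[OF assms(1-3)])
  then have "(\<lambda>p. z ^ (q * p) *\<^sub>C b (q * p)) sums psum (\<lambda>p. b (q * p)) (z ^ q)"
    by (simp add: power_mult)
  moreover have "strict_mono (\<lambda>p. q * p)" using assms(4) by (simp add: strict_mono_def)
  ultimately have "(\<lambda>j. z ^ j *\<^sub>C b j) sums psum (\<lambda>p. b (q * p)) (z ^ q)"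
  proof (subst (asm) sums_mono_reindex)
    fix j assume "j \<notin> range (\<lambda>p. q * p)"
    then have "\<not> q dvd j" by (auto simp: dvd_def)
    then show "z ^ j *\<^sub>C b j = 0" by (simp add: assms(5) scaleC.zero_right)
  qed
  then show ?thesis by (simp add: psum_def sums_iff)
qed

lemma log_sector_scale:
  assumes "q > 0"
  shows "w \<in> log_sector (d / real q) (\<theta> / real q) \<longleftrightarrow> of_nat q * w \<in> log_sector d \<theta>"
proof -
  have "Im (of_nat q * w) - d = real q * (Im w - d / real q)" using assms by (simp add: field_simps)
  then have "\<bar>Im (of_nat q * w) - d\<bar> = real q * \<bar>Im w - d / real q\<bar>" by (simp add: abs_mult)
  then show ?thesis using assms by (simp add: log_sector_def field_simps)
qed

lemma exp_of_nat_mult_Re: "exp (Re (of_nat q * w)) = exp (Re w) ^ q"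
  by (simp add: exp_of_nat_mult)

text \<open>The substitution z \<mapsto> z^q is w \<mapsto> q w in the log coordinate, so direction
  and opening are divided by q.\<close>

lemma sector_extendable_ramify:
  assumes q: "q > 0" and a: "sector_extendable h d a"
  shows "sector_extendable (\<lambda>t. h (t ^ q)) (d / real q) (\<lambda>j. if q dvd j then a (j div q) else 0)"
proof -
  obtain \<theta> r K G c k where G: "\<theta> > 0" "r > 0" "c > 0" "k > 0" "K \<ge> 0"
    "\<And>p. norm (a p) * r ^ p \<le> K" "G vec_holomorphic_on log_sector d \<theta>"
    "\<And>w. w \<in> log_sector d \<theta> \<Longrightarrow> exp (Re w) < r \<Longrightarrow> G w = psum a (exp w)"
    "\<And>w. w \<in> log_sector d \<theta> \<Longrightarrow> norm (G w) \<le> c * exp (h (exp (Re w) / k))"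
    by (rule sector_extendableE[OF a]) (rule that)
  define b where "b j = (if q dvd j then a (j div q) else 0)" for j
  have bq: "b (q * p) = a p" for p using q by (simp add: b_def)
  have rq: "root q r ^ q = r" "root q k ^ q = k" using q G(1-5) by simp_all
  show ?thesis
    unfolding b_def[symmetric]
  proof (rule sector_extendableI[where r="root q r" and K=K and \<theta>="\<theta> / real q" and G="\<lambda>w. G (of_nat q * w)" and c=c and k="root q k"])
    show "norm (b p) * root q r ^ p \<le> K" for p
    proof (cases "q dvd p")
      case True
      then obtain i where i: "p = q * i" by (auto simp: dvd_def)
      show ?thesis using G(6)[of i] by (simp add: i bq power_mult rq)
    qed (use G(1-5) in \<open>simp add: b_def\<close>)
    show "(\<lambda>w. G (of_nat q * w)) vec_holomorphic_on log_sector (d / real q) (\<theta> / real q)"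
      by (rule vec_holomorphic_on_compose[OF G(7)]) (use log_sector_scale[OF q] in \<open>auto intro!: holomorphic_intros\<close>)
    fix w assume w: "w \<in> log_sector (d / real q) (\<theta> / real q)"
    then have w': "of_nat q * w \<in> log_sector d \<theta>" by (simp add: log_sector_scale[OF q])
    show "norm (G (of_nat q * w)) \<le> c * exp (h ((exp (Re w) / root q k) ^ q))"
      using G(9)[OF w'] by (simp only: exp_of_nat_mult_Re power_divide rq)
    assume "exp (Re w) < root q r"
    then have lt: "exp (Re w) ^ q < r" using power_strict_mono[of "exp (Re w)" "root q r" q] q by (simp add: rq)
    then have "G (of_nat q * w) = psum a (exp (of_nat q * w))"
      using G(8)[OF w'] by (simp only: exp_of_nat_mult_Re)
    also have "exp (of_nat q * w) = exp w ^ q" by (rule exp_of_nat_mult)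
    also have "psum a (exp w ^ q) = psum b (exp w)"
      using psum_ramified[of b q r K "exp w"] G q lt unfolding bq by (simp add: norm_power b_def)
    finally show "G (of_nat q * w) = psum b (exp w)" .
  qed (use G(1-5) q in auto)
qed

text \<open>A series supported on multiples of q is a series in z^q. In the log coordinate the q-th
  root is w / q, so no branch has to be chosen.\<close>

lemma sector_extendable_unramify:
  assumes q: "q > 0" and b: "sector_extendable (\<lambda>t. h (t ^ q)) (d / real q) b"
    and b0: "\<And>j. \<not> q dvd j \<Longrightarrow> b j = 0"
  shows "sector_extendable h d (\<lambda>p. b (q * p))"
proof -
  obtain \<theta> r K G c k where G: "\<theta> > 0" "r > 0" "c > 0" "k > 0" "K \<ge> 0"
    "\<And>p. norm (b p) * r ^ p \<le> K" "G vec_holomorphic_on log_sector (d / real q) \<theta>"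
    "\<And>w. w \<in> log_sector (d / real q) \<theta> \<Longrightarrow> exp (Re w) < r \<Longrightarrow> G w = psum b (exp w)"
    "\<And>w. w \<in> log_sector (d / real q) \<theta> \<Longrightarrow> norm (G w) \<le> c * exp (h ((exp (Re w) / k) ^ q))"
    by (rule sector_extendableE[OF b]) (rule that)
  have nz: "(of_nat q :: complex) \<noteq> 0" using q by simp
  have K: "norm (b (q * p)) * (r ^ q) ^ p \<le> K" for p using G(6)[of "q * p"] by (simp add: power_mult)
  show ?thesis
  proof (rule sector_extendableI[where r="r ^ q" and K=K and \<theta>="real q * \<theta>" and G="\<lambda>w. G (w / of_nat q)" and c=c and k="k ^ q"])
    have sec: "w / of_nat q \<in> log_sector (d / real q) \<theta>" if "w \<in> log_sector d (real q * \<theta>)" for w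
      using log_sector_scale[OF q, of "w / of_nat q" d "real q * \<theta>"] that q by simp
    show "(\<lambda>w. G (w / of_nat q)) vec_holomorphic_on log_sector d (real q * \<theta>)"
      by (rule vec_holomorphic_on_compose[OF G(7)]) (use sec nz in \<open>auto intro!: holomorphic_intros\<close>)
    fix w assume w: "w \<in> log_sector d (real q * \<theta>)"
    define u where "u = w / of_nat q"
    have wu: "w = of_nat q * u" using nz by (simp add: u_def)
    have eRe: "exp (Re w) = exp (Re u) ^ q" unfolding wu by (rule exp_of_nat_mult_Re)
    have u: "u \<in> log_sector (d / real q) \<theta>" unfolding u_def by (rule sec[OF w])
    show "norm (G (w / of_nat q)) \<le> c * exp (h (exp (Re w) / k ^ q))"
      using G(9)[OF u] by (simp only: u_def[symmetric] eRe power_divide)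
    assume "exp (Re w) < r ^ q"
    then have lt: "exp (Re u) ^ q < r ^ q" by (simp only: eRe)
    then have "exp (Re u) < r" using G(2) by (meson less_imp_le power_less_imp_less_base)
    then have "G u = psum b (exp u)" by (rule G(8)[OF u])
    also have "\<dots> = psum (\<lambda>p. b (q * p)) (exp u ^ q)"
      by (rule psum_ramified[OF K _ _ q b0]) (use lt G(1-5) in \<open>simp_all add: norm_power\<close>)
    also have "exp u ^ q = exp w" unfolding wu by (rule exp_of_nat_mult[symmetric])
    finally show "G (w / of_nat q) = psum (\<lambda>p. b (q * p)) (exp w)" unfolding u_def .
  next
    show "norm (b (q * p)) * (r ^ q) ^ p \<le> K" for p by (rule K)
  qed (use G(1-5) q in auto)
qed

section \<open>Passage to and from extendability of the Borel transform\<close>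

lemma borel_extendable_imp_sector_extendable:
  assumes "borel_extendable M m d f"
  shows "sector_extendable (assoc_fun M) d (\<lambda>p. fps_nth f p /\<^sub>R m p)"
proof -
  obtain \<theta> r F G where *: "\<theta> > 0" "r > 0" "F vec_holomorphic_on ball 0 r"
       "G vec_holomorphic_on log_sector d \<theta>"
       "\<forall>w\<in>log_sector d \<theta>. exp w \<in> ball 0 r \<longrightarrow> G w = F (exp w)"
    and F: "\<exists>\<delta>>0. \<forall>z\<in>ball 0 \<delta>. (\<lambda>p. z ^ p *\<^sub>C (fps_nth f p /\<^sub>R m p)) sums F z"
    and bd: "\<forall>\<theta>' r'. 0 < \<theta>' \<and> \<theta>' < \<theta> \<and> 0 < r' \<and> r' < r \<longrightarrow>
          (\<exists>c>0. \<exists>k>0.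
             (\<forall>z\<in>ball 0 r'. norm (F z) \<le> c * exp (assoc_fun M (cmod z / k))) \<and>
             (\<forall>w\<in>log_sector d \<theta>'. norm (G w) \<le> c * exp (assoc_fun M (cmod (exp w) / k))))"
    using assms unfolding borel_extendable_def by (elim exE conjE) (rule that; (assumption | blast))
  obtain \<delta> where \<delta>: "\<delta> > 0" "\<And>z. z \<in> ball 0 \<delta> \<Longrightarrow> (\<lambda>p. z ^ p *\<^sub>C (fps_nth f p /\<^sub>R m p)) sums F z"
    using F by blast
  obtain c k where ck: "c > 0" "k > 0"
      "\<And>w. w \<in> log_sector d (\<theta> / 2) \<Longrightarrow> norm (G w) \<le> c * exp (assoc_fun M (cmod (exp w) / k))"
  proof -
    \<comment> \<open>One instance of the bounds on subsectors is enough: the half-opening becomes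
      the whole sector of the new formulation.\<close>
    have "0 < \<theta> / 2 \<and> \<theta> / 2 < \<theta> \<and> 0 < r / 2 \<and> r / 2 < r" using *(1,2) by simp
    from bd[rule_format, OF this] show thesis using that by blast
  qed
  define a where "a p = fps_nth f p /\<^sub>R m p" for p
  \<comment> \<open>The radius must be below \<delta>, where the series is known to represent
    \<open>F\<close>, and below r, where \<open>F\<close> and \<open>G\<close> agree.\<close>
  define s where "s = min r \<delta> / 2"
  have s: "s > 0" "s < r" "s < \<delta>" using *(1,2) \<delta>(1) by (auto simp: s_def min_def)
  have "(\<lambda>p. of_real s ^ p *\<^sub>C a p) \<longlonglongrightarrow> 0"
    unfolding a_def by (rule summable_LIMSEQ_zero[OF sums_summable[OF \<delta>(2)]]) (use s in simp)
  then have "Bseq (\<lambda>p. of_real s ^ p *\<^sub>C a p)" by (simp add: convergent_imp_Bseq convergentI)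
  then obtain K where K: "\<And>p. norm (of_real s ^ p *\<^sub>C a p) \<le> K" by (auto simp: Bseq_def)
  have sub: "w \<in> log_sector d \<theta>" if "w \<in> log_sector d (\<theta> / 2)" for w
    using that *(1) by (auto simp: log_sector_def)
  show ?thesis
    unfolding a_def[symmetric]
  proof (rule sector_extendableI[where r=s and K=K and \<theta>="\<theta> / 2" and G=G and c=c and k=k])
    show "norm (a p) * s ^ p \<le> K" for p using K[of p] s by (simp add: norm_scaleC norm_power mult.commute)
    show "G vec_holomorphic_on log_sector d (\<theta> / 2)"
      by (rule vec_holomorphic_on_subset[OF *(4)]) (use sub in blast)
    fix w assume w: "w \<in> log_sector d (\<theta> / 2)"
    show "norm (G w) \<le> c * exp (assoc_fun M (exp (Re w) / k))" using ck(3)[OF w] by simp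
    assume lt: "exp (Re w) < s"
    have "G w = F (exp w)" by (rule *(5)[rule_format, OF sub[OF w]]) (use lt s in simp)
    moreover have "(\<lambda>p. exp w ^ p *\<^sub>C a p) sums F (exp w)"
      unfolding a_def by (rule \<delta>(2)) (use lt s in simp)
    ultimately show "G w = psum a (exp w)" by (simp add: psum_def sums_iff)
  qed (use *(1) s ck(1,2) in auto)
qed

lemma sector_extendable_imp_borel_extendable:
  assumes M: "strongly_regular M" and f: "sector_extendable (assoc_fun M) d (\<lambda>p. fps_nth f p /\<^sub>R m p)"
  shows "borel_extendable M m d f"
proof -
  define a where "a p = fps_nth f p /\<^sub>R m p" for p
  have fa: "sector_extendable (assoc_fun M) d a" using f by (simp add: a_def[abs_def])
  obtain \<theta> r K G c k where G: "\<theta> > 0" "r > 0" "c > 0" "k > 0" "K \<ge> 0"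
    "\<And>p. norm (a p) * r ^ p \<le> K" "G vec_holomorphic_on log_sector d \<theta>"
    "\<And>w. w \<in> log_sector d \<theta> \<Longrightarrow> exp (Re w) < r \<Longrightarrow> G w = psum a (exp w)"
    "\<And>w. w \<in> log_sector d \<theta> \<Longrightarrow> norm (G w) \<le> c * exp (assoc_fun M (exp (Re w) / k))"
    by (rule sector_extendableE[OF fa]) (rule that)
  have bound: "\<exists>c>0. \<exists>k>0.
             (\<forall>z\<in>ball 0 r'. norm (psum a z) \<le> c * exp (assoc_fun M (cmod z / k))) \<and>
             (\<forall>w\<in>log_sector d \<theta>'. norm (G w) \<le> c * exp (assoc_fun M (cmod (exp w) / k)))"
    if *: "0 < \<theta>' \<and> \<theta>' < \<theta> \<and> 0 < r' \<and> r' < r" for \<theta>' r'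
  proof (intro exI conjI ballI)
    \<comment> \<open>A bound of the series on the disc of radius r'; c + K' then serves disc and
      sector together, since the exponential weight is at least 1.\<close>
    define K' where "K' = K / (1 - r' / r)"
    have K': "K' \<ge> 0" using * G(1-5) by (simp add: K'_def field_simps)
    show "c + K' > 0" "k > 0" using G(1-5) K' by auto
    have e: "exp (assoc_fun M t) \<ge> 1" for t using assoc_fun_nonneg[OF M, of t] by simp
    fix z :: complex assume z: "z \<in> ball 0 r'"
    have "norm (psum a z) \<le> K / (1 - cmod z / r)" by (rule norm_psum_le[OF G(6,2)]) (use z * in simp)
    also have "\<dots> \<le> K'"
      unfolding K'_def using z * G(1-5) by (intro divide_left_mono mult_pos_pos) (auto simp: field_simps)
    also have "\<dots> \<le> (c + K') * 1" using G(1-5) by simp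
    also have "\<dots> \<le> (c + K') * exp (assoc_fun M (cmod z / k))"
      using G(1-5) K' e by (intro mult_left_mono) auto
    finally show "norm (psum a z) \<le> (c + K') * exp (assoc_fun M (cmod z / k))" .
  next
    define K' where "K' = K / (1 - r' / r)"
    have K': "K' \<ge> 0" using * G(1-5) by (simp add: K'_def field_simps)
    fix w assume "w \<in> log_sector d \<theta>'"
    then have "w \<in> log_sector d \<theta>" using * by (auto simp: log_sector_def)
    from G(9)[OF this] have "norm (G w) \<le> c * exp (assoc_fun M (cmod (exp w) / k))" by simp
    also have "\<dots> \<le> (c + K') * exp (assoc_fun M (cmod (exp w) / k))"
      using K' by (intro mult_right_mono) auto
    finally show "norm (G w) \<le> (c + K / (1 - r' / r)) * exp (assoc_fun M (cmod (exp w) / k))"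
      unfolding K'_def .
  qed
  show ?thesis
    unfolding borel_extendable_def a_def[symmetric]
  proof (rule exI[of _ \<theta>], rule conjI[OF G(1)], rule exI[of _ r], rule conjI[OF G(2)],
      rule exI[of _ "psum a"], rule exI[of _ G], intro conjI)
    show "psum a vec_holomorphic_on ball 0 r" by (rule vec_holomorphic_psum[OF G(6,2)])
    show "G vec_holomorphic_on log_sector d \<theta>" by (rule G(7))
    have "(\<lambda>p. z ^ p *\<^sub>C a p) sums psum a z" if "z \<in> ball 0 r" for z
      by (rule psum_sums[OF G(6,2)]) (use that in simp)
    then show "\<exists>\<delta>>0. \<forall>z\<in>ball 0 \<delta>. (\<lambda>p. z ^ p *\<^sub>C a p) sums psum a z" using G(2) by blast
    show "\<forall>w\<in>log_sector d \<theta>. exp w \<in> ball 0 r \<longrightarrow> G w = psum a (exp w)"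
      using G(8) by simp
    show "\<forall>\<theta>' r'. 0 < \<theta>' \<and> \<theta>' < \<theta> \<and> 0 < r' \<and> r' < r \<longrightarrow>
          (\<exists>c>0. \<exists>k>0.
             (\<forall>z\<in>ball 0 r'. norm (psum a z) \<le> c * exp (assoc_fun M (cmod z / k))) \<and>
             (\<forall>w\<in>log_sector d \<theta>'. norm (G w) \<le> c * exp (assoc_fun M (cmod (exp w) / k))))"
      by (intro allI impI) (rule bound)
  qed
qed

section \<open>Moment differentiation as shifts and multipliers\<close>

lemma sector_extendable_moment_shift:
  assumes n: "kernel_moments M n" and h: "growth_fun h" and a: "sector_extendable h d a"
  shows "sector_extendable h d (\<lambda>j. (n (j + i) / n j) *\<^sub>R a (j + i))"
proof (induction i)
  case 0
  then show ?case using a kernel_moments_nonzero[OF n] by simp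
next
  case (Suc i)
  \<comment> \<open>The quotient over i + 1 places telescopes into consecutive quotients, so each
    induction step is one shift and one multiplier. Ramified moments need i = q.\<close>
  have "(n (Suc j) / n j) *\<^sub>R (n (Suc j + i) / n (Suc j)) *\<^sub>R a (Suc j + i) = (n (j + Suc i) / n j) *\<^sub>R a (j + Suc i)" for j
    using kernel_moments_nonzero[OF n, of "Suc j"] by simp
  with sector_extendable_multiplier[OF n h sector_extendable_shift[OF h Suc.IH]] show ?case by (simp only:)
qed

lemma sector_extendable_summation_moments:
  assumes m: "summation_moments M m" and h: "growth_fun h" and a: "sector_extendable h d a"
  shows "sector_extendable h d (\<lambda>p. (m (Suc p) / m p) *\<^sub>R a (Suc p))" and "m p \<noteq> 0"
proof -
  have "sector_extendable h d (\<lambda>p. (m (Suc p) / m p) *\<^sub>R a (Suc p)) \<and> m p \<noteq> 0"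
  proof (cases "growth_index M < 2")
    case True
    then have "kernel_moments M m" using m by (simp add: summation_moments_def)
    then show ?thesis
      using sector_extendable_moment_shift[OF _ h a, of M m 1] kernel_moments_nonzero by simp
  next
    case False
    then obtain q n where q: "q > 0" and n: "kernel_moments (\<lambda>p. root q (M p)) n"
      and mn: "\<And>p. m p = n (q * p)"
      using m by (auto simp: summation_moments_def)
    \<comment> \<open>The ramified series shifted by exactly q places: the support stays on
      multiples of q, and at j = q p the quotient of \<open>n\<close> is m (p + 1) / m p.\<close>
    define b where "b j = (n (j + q) / n j) *\<^sub>R (if q dvd (j + q) then a ((j + q) div q) else 0)" for j
    have "sector_extendable (\<lambda>t. h (t ^ q)) (d / real q) b"
      unfolding b_def
      by (rule sector_extendable_moment_shift[OF n growth_fun_power[OF h q] sector_extendable_ramify[OF q a]])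
    then have "sector_extendable h d (\<lambda>p. b (q * p))"
      by (rule sector_extendable_unramify[OF q]) (simp add: b_def)
    also have "(\<lambda>p. b (q * p)) = (\<lambda>p. (m (Suc p) / m p) *\<^sub>R a (Suc p))"
      using q by (simp add: b_def mn add.commute)
    finally show ?thesis using kernel_moments_nonzero[OF n] mn by simp
  qed
  then show "sector_extendable h d (\<lambda>p. (m (Suc p) / m p) *\<^sub>R a (Suc p))" "m p \<noteq> 0" by blast+
qed

theorem corollary1:
  fixes m\<^sub>e M :: "nat \<Rightarrow> real" and d :: real and f :: "'a::complex_banach fps"
  assumes "moment_sequence m\<^sub>e"
    and "strongly_regular M"
    and "admits_nonzero_proximate_order M"
    and "f \<in> summable_series M d"
  shows "moment_diff m\<^sub>e f \<in> summable_series M d"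
proof -
  obtain m where m: "summation_moments M m" and f: "borel_extendable M m d f"
    using assms(4) by (auto simp: summable_series_def)
  obtain M' where me: "kernel_moments M' m\<^sub>e"
    using assms(1) by (auto simp: moment_sequence_def)
  note h = growth_fun_assoc_fun[OF assms(2)]
  note a = borel_extendable_imp_sector_extendable[OF f]
  have nz: "m p \<noteq> 0" for p by (rule sector_extendable_summation_moments(2)[OF m h a])
  \<comment> \<open>Multiplying and dividing by \<open>m (p + 1)\<close> writes the transform of the
    derivative as two multipliers applied to the shifted transform of \<open>f\<close>: first the
    quotient of \<open>m\<close>, then that of \<open>m\<^sub>e\<close>.\<close>
  have "sector_extendable (assoc_fun M) d (\<lambda>p. (m\<^sub>e (Suc p) / m\<^sub>e p) *\<^sub>R
      (m (Suc p) / m p) *\<^sub>R (fps_nth f (Suc p) /\<^sub>R m (Suc p)))"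
    by (rule sector_extendable_multiplier[OF me h sector_extendable_summation_moments(1)[OF m h a]])
  also have "(\<lambda>p. (m\<^sub>e (Suc p) / m\<^sub>e p) *\<^sub>R (m (Suc p) / m p) *\<^sub>R (fps_nth f (Suc p) /\<^sub>R m (Suc p))) =
      (\<lambda>p. fps_nth (moment_diff m\<^sub>e f) p /\<^sub>R m p)"
    using nz by (simp add: moment_diff_def fun_eq_iff divide_inverse ac_simps)
  finally have "borel_extendable M m d (moment_diff m\<^sub>e f)"
    by (rule sector_extendable_imp_borel_extendable[OF assms(2)])
  with m show ?thesis by (auto simp: summable_series_def)
qed

end
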